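(* Let $g \in L^2(\mathbb{R}^d)$ be such that $\{ g_{m,n} : m,n \in \mathbb{Z}^d \}$ is an exact frame for $L^2(\mathbb{R}^d)$, where $g_{m,n}(x) = e^{2\pi i n\cdot x} g(x-m)$, and let $\tilde g$ be the canonical dual of $g$. If $v, w \in \mathbb{R}^d$ satisfy $v \cdot w \neq 0$, then $$\| P_{v}(g) \|_2 \, \| M_{w}(g) \|_2 \, \|P_{v} (\tilde g) \|_2 \, \| M_{w}(\tilde g) \|_2 = \infty .$$
   Context: A collection $\{f_k\}\subset L^2(\mathbb{R}^d)$ is a frame for $L^2(\mathbb{R}^d)$ if there are constants $0<A\le B<\infty$ with $A\|f\|_2^2 \le \sum_k |\langle f,f_k\rangle|^2 \le B\|f\|_2^2$ for all $f\in L^2(\mathbb{R}^d)$; it is exact if it is no longer a frame after removal of any one of its elements. The frame operator is $S(f) = \sum_k \langle f,f_k\rangle f_k$, a bounded invertible operator of $L^2(\mathbb{R}^d)$ onto itself. The canonical dual of $g$ is $\tilde g = S^{-1}(g)$, where $S$ is the frame operator of $\{g_{m,n}\}$. The Fourier transform is $\hat f(\xi) = \mathcal{F}(f)(\xi) = \int_{\mathbb{R}^d} f(x) e^{2\pi i x\cdot \xi}\,dx$, extended to a unitary operator on $L^2(\mathbb{R}^d)$. For $v, w\in\mathbb{R}^d$ put $P_v(f)(x) = \left(\sum_{i=1}^d v^i x^i\right) f(x)$ and $M_w(f) = \mathcal{F}^{-1}(P_w(\hat f))$, where $v^i$ is the $i$th coordinate of $v$. The norm $\|P_v(f)\|_2$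 (resp. $\|M_w(f)\|_2$) is understood to be $\infty$ if $P_v(f)$ (resp. $P_w(\hat f)$) does not belong to $L^2$; thus $\|M_w(f)\|_2^2 = \int |w\cdot\xi|^2|\hat f(\xi)|^2\,d\xi$. *)

theory Defs
  imports "HOL-Analysis.Analysis"
begin

text \<open>
  Elements of \<open>L\<^sup>2(\<real>\<^sup>d)\<close> are represented by Lebesgue measurable functions; almost everywhere
  equal functions represent the same element. Operators that are only determined up to null sets
  (the frame operator, the Fourier transform, and their inverses) pick some representative by
  Hilbert choice. Every quantity below depends on a function only up to null sets.
\<close>

definition L2 :: "(real ^ 'd \<Rightarrow> complex) set" where
  "L2 = {f. f \<in> borel_measurable lebesgue \<and> integrable lebesgue (\<lambda>x. (cmod (f x))\<^sup>2)}"

definition L2_inner :: "(real ^ 'd \<Rightarrow> complex) \<Rightarrow> (real ^ 'd \<Rightarrow> complex) \<Rightarrow> complex" where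
  "L2_inner f h = (LINT x|lebesgue. f x * cnj (h x))"

text \<open>The norm takes the value \<open>\<infinity>\<close> outside \<^const>\<open>L2\<close>, so convergence to \<open>0\<close> in it entails
  eventual membership in \<^const>\<open>L2\<close>.\<close>

definition L2_norm :: "(real ^ 'd \<Rightarrow> complex) \<Rightarrow> ennreal" where
  "L2_norm f = (if f \<in> L2 then ennreal (sqrt (LINT x|lebesgue. (cmod (f x))\<^sup>2)) else \<infinity>)"


subsection \<open>Frames\<close>

text \<open>Families are indexed by a set \<open>I\<close>; removing an element means removing an index. The sum of
  squares is taken in \<^typ>\<open>ennreal\<close>, so it always has a value (possibly \<open>\<infinity>\<close>).\<close>

definition is_frame :: "'k set \<Rightarrow> ('k \<Rightarrow> real ^ 'd \<Rightarrow> complex) \<Rightarrow> bool" where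
  "is_frame I \<phi> \<longleftrightarrow>
     (\<forall>k\<in>I. \<phi> k \<in> L2) \<and>
     (\<exists>A B :: real. 0 < A \<and> A \<le> B \<and>
        (\<forall>f\<in>L2.
           ennreal A * (L2_norm f)\<^sup>2 \<le> (\<Sum>\<^sub>\<infinity>k\<in>I. ennreal ((cmod (L2_inner f (\<phi> k)))\<^sup>2)) \<and>
           (\<Sum>\<^sub>\<infinity>k\<in>I. ennreal ((cmod (L2_inner f (\<phi> k)))\<^sup>2)) \<le> ennreal B * (L2_norm f)\<^sup>2))"

definition is_exact_frame :: "'k set \<Rightarrow> ('k \<Rightarrow> real ^ 'd \<Rightarrow> complex) \<Rightarrow> bool" where
  "is_exact_frame I \<phi> \<longleftrightarrow> is_frame I \<phi> \<and> (\<forall>j\<in>I. \<not> is_frame (I - {j}) \<phi>)"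

text \<open>The series \<open>\<Sum>\<^sub>k \<langle>f, \<phi>\<^sub>k\<rangle> \<phi>\<^sub>k\<close> converges unconditionally in \<open>L\<^sup>2\<close>, hence the limit along the
  net of finite subsets of \<open>I\<close>.\<close>

definition frame_operator ::
    "'k set \<Rightarrow> ('k \<Rightarrow> real ^ 'd \<Rightarrow> complex) \<Rightarrow> (real ^ 'd \<Rightarrow> complex) \<Rightarrow> real ^ 'd \<Rightarrow> complex" where
  "frame_operator I \<phi> f =
     (SOME h. h \<in> L2 \<and>
        ((\<lambda>K. L2_norm (\<lambda>x. h x - (\<Sum>k\<in>K. L2_inner f (\<phi> k) * \<phi> k x))) \<longlongrightarrow> 0)
          (finite_subsets_at_top I))"


subsection \<open>Gabor systems\<close>

definition real_vec :: "int ^ 'd \<Rightarrow> real ^ 'd" where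
  "real_vec m = (\<chi> i. real_of_int (m $ i))"

definition gabor ::
    "(real ^ 'd \<Rightarrow> complex) \<Rightarrow> (int ^ 'd) \<times> (int ^ 'd) \<Rightarrow> real ^ 'd \<Rightarrow> complex" where
  "gabor g = (\<lambda>(m, n) x.
     exp (2 * complex_of_real pi * \<i> * complex_of_real (real_vec n \<bullet> x)) * g (x - real_vec m))"

text \<open>\<open>S\<^sup>-\<^sup>1 g\<close>, where \<open>S\<close> is the frame operator of the Gabor system of \<open>g\<close>.\<close>

definition canonical_dual :: "(real ^ 'd \<Rightarrow> complex) \<Rightarrow> real ^ 'd \<Rightarrow> complex" where
  "canonical_dual g =
     (SOME h. h \<in> L2 \<and> (AE x in lebesgue. frame_operator UNIV (gabor g) h x = g x))"


subsection \<open>Fourier transform, position and momentum\<close>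

text \<open>The exponent carries a plus sign.\<close>

definition fourier_integral :: "(real ^ 'd \<Rightarrow> complex) \<Rightarrow> real ^ 'd \<Rightarrow> complex" where
  "fourier_integral f \<xi> =
     (LINT x|lebesgue. f x * exp (2 * complex_of_real pi * \<i> * complex_of_real (x \<bullet> \<xi>)))"

text \<open>Extension by continuity from \<open>L\<^sup>1 \<inter> L\<^sup>2\<close>.\<close>

definition fourier :: "(real ^ 'd \<Rightarrow> complex) \<Rightarrow> real ^ 'd \<Rightarrow> complex" where
  "fourier f =
     (SOME F. F \<in> L2 \<and>
        (\<exists>h :: nat \<Rightarrow> real ^ 'd \<Rightarrow> complex.
           (\<forall>k. integrable lebesgue (h k) \<and> h k \<in> L2) \<and>
           (\<lambda>k. L2_norm (\<lambda>x. f x - h k x)) \<longlonglongrightarrow> 0 \<and>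
           (\<lambda>k. L2_norm (\<lambda>\<xi>. F \<xi> - fourier_integral (h k) \<xi>)) \<longlonglongrightarrow> 0))"

definition inv_fourier :: "(real ^ 'd \<Rightarrow> complex) \<Rightarrow> real ^ 'd \<Rightarrow> complex" where
  "inv_fourier F = (SOME f. f \<in> L2 \<and> (AE \<xi> in lebesgue. fourier f \<xi> = F \<xi>))"

definition P_op :: "real ^ 'd \<Rightarrow> (real ^ 'd \<Rightarrow> complex) \<Rightarrow> real ^ 'd \<Rightarrow> complex" where
  "P_op v f x = complex_of_real (v \<bullet> x) * f x"

definition M_op :: "real ^ 'd \<Rightarrow> (real ^ 'd \<Rightarrow> complex) \<Rightarrow> real ^ 'd \<Rightarrow> complex" where
  "M_op w f = inv_fourier (P_op w (fourier f))"

text \<open>\<open>\<parallel>M\<^sub>w f\<parallel>\<^sub>2\<close>, with the value \<open>\<infinity>\<close> when \<open>f\<close> is outside the domain of \<open>M\<^sub>w\<close>, where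
  \<^const>\<open>inv_fourier\<close> carries no information. For \<open>P\<^sub>v\<close> the convention is built into
  \<^const>\<open>L2_norm\<close>.\<close>

definition M_norm :: "real ^ 'd \<Rightarrow> (real ^ 'd \<Rightarrow> complex) \<Rightarrow> ennreal" where
  "M_norm w f = (if P_op w (fourier f) \<in> L2 then L2_norm (M_op w f) else \<infinity>)"

end

theory Submission
  imports Defs "HOL-Probability.Characteristic_Functions"
begin

text \<open>
  Write \<open>G, D\<close> for \<open>g\<close> and its canonical dual, \<open>\<pi>\<^sub>k\<close> for the time-frequency shift by \<open>k = (m, n)\<close> and
  \<open>T\<^sub>s\<close> for translation by \<open>s\<close>. Exactness makes the Gabor system of \<open>D\<close> biorthogonal to that of \<open>G\<close>.
  Hence \<open>P\<^sub>v\<close> commutes with \<open>\<pi>\<^sub>k\<close> as far as the coefficients \<open>\<langle>P\<^sub>v G, \<pi>\<^sub>k D\<rangle>\<close> are concerned, and \<open>T\<^sub>s\<close> does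
  so up to the phase \<open>exp (2 \<pi> i n \<cdot> s)\<close>. Expanding \<open>\<langle>P\<^sub>v G, T\<^sub>s D - D\<rangle>\<close> and \<open>\<langle>T\<^sub>-\<^sub>s G - G, P\<^sub>v D\<rangle>\<close> in the dual
  pair of frames therefore gives two series that differ only by these phases, whereas the commutation
  relation of \<open>P\<^sub>v\<close> and \<open>T\<^sub>s\<close> makes the difference of the two inner products \<open>(v \<cdot> s) \<langle>G, T\<^sub>s D\<rangle>\<close>.
  For \<open>s = t w\<close>, finiteness of \<open>\<parallel>M\<^sub>w G\<parallel>\<close> means \<open>\<parallel>T\<^sub>s G - G\<parallel> = O(t)\<close>, so the difference of the series is
  \<open>o(t)\<close>; dividing by \<open>t\<close> yields \<open>v \<cdot> w = (v \<cdot> w) \<langle>G, D\<rangle> = 0\<close>. So one of the norms is infinite, and none of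
  them vanishes because the Fourier transform is a surjective isometry.
\<close>

text \<open>Difference quotients of translations stand in for \<open>M_w\<close> because
  translations are bounded and commute with the time-frequency shifts up to a scalar, so no weak
  derivative has to be moved across an inner product. The obstacle is that the phases
  \<open>e1 (- (n \<bullet> s))\<close> tend to 1 for each index but not uniformly in
  \<open>n\<close>. Cauchy-Schwarz separates two square sums: that of the coefficients of
  \<open>T_{-s} G - G\<close>, which is O(t^2) by the upper bound of the dual frame, and that of the
  coefficients of \<open>P_v D\<close> weighted by the phase differences, which tends to 0 by
  dominated convergence. Their product is therefore o(t^2), which is the o(t) for the series itself.
  The operators in the statement pick representatives by Hilbert choice. The argument therefore
  lives in the quotient of \<open>L2\<close> by null sets, where the bounded operators are honest
  maps, and returns to functions only at the end.\<close>

section \<open>Closure and integrability properties of square integrable functions\<close>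

lemma L2_measurable [measurable_dest]: "f \<in> L2 \<Longrightarrow> f \<in> borel_measurable lebesgue"
  by (simp add: L2_def)

lemma L2_square_integrable: "f \<in> L2 \<Longrightarrow> integrable lebesgue (\<lambda>x. (cmod (f x))\<^sup>2)"
  by (simp add: L2_def)

lemma L2_zero [simp]: "(\<lambda>x. 0) \<in> L2"
  by (simp add: L2_def)

lemma L2_bound:
  assumes "f \<in> L2" "h \<in> borel_measurable lebesgue"
    and "AE x in lebesgue. cmod (h x) \<le> C * cmod (f x)"
  shows "h \<in> L2"
proof -
  have "integrable lebesgue (\<lambda>x. (cmod (h x))\<^sup>2)"
  proof (rule Bochner_Integration.integrable_bound)
    show "integrable lebesgue (\<lambda>x. C\<^sup>2 * (cmod (f x))\<^sup>2)"
      using assms(1) L2_square_integrable by auto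
    show "(\<lambda>x. (cmod (h x))\<^sup>2) \<in> borel_measurable lebesgue"
      using assms(2) by measurable
    show "AE x in lebesgue. norm ((cmod (h x))\<^sup>2) \<le> norm (C\<^sup>2 * (cmod (f x))\<^sup>2)"
      using assms(3) by eventually_elim (auto simp flip: power_mult_distrib intro: power_mono)
  qed
  then show ?thesis using assms(2) by (simp add: L2_def)
qed

lemma L2_cong_AE:
  assumes "f \<in> L2" "h \<in> borel_measurable lebesgue" "AE x in lebesgue. f x = h x"
  shows "h \<in> L2"
proof (rule L2_bound[OF assms(1,2), of 1])
  show "AE x in lebesgue. cmod (h x) \<le> 1 * cmod (f x)"
    using assms(3) by eventually_elim auto
qed

lemma L2_bounded_mult:
  assumes "f \<in> L2" "\<phi> \<in> borel_measurable lebesgue" "\<And>x. cmod (\<phi> x) \<le> C"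
  shows "(\<lambda>x. \<phi> x * f x) \<in> L2"
  by (rule L2_bound[OF assms(1), of _ C])
     (use assms(2,3) L2_measurable[OF assms(1)] in \<open>auto intro!: AE_I2 mult_right_mono borel_measurable_times simp: norm_mult\<close>)

lemma L2_cmult: "f \<in> L2 \<Longrightarrow> (\<lambda>x. c * f x) \<in> L2"
  by (rule L2_bounded_mult[of _ _ "cmod c"]) auto

lemma L2_uminus: "f \<in> L2 \<Longrightarrow> (\<lambda>x. - f x) \<in> L2"
  using L2_cmult[of f "-1"] by simp

lemma borel_measurable_cnj:
  "f \<in> borel_measurable M \<Longrightarrow> (\<lambda>x. cnj (f x)) \<in> borel_measurable M"
  by (rule measurable_compose[OF _ borel_measurable_continuous_onI]) (simp_all add: continuous_on_cnj)

lemma L2_cnj: "f \<in> L2 \<Longrightarrow> (\<lambda>x. cnj (f x)) \<in> L2"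
  by (rule L2_bound[where C = 1 and f = f]) (simp_all add: L2_measurable borel_measurable_cnj)

lemma L2_add:
  assumes "f \<in> L2" "h \<in> L2"
  shows "(\<lambda>x. f x + h x) \<in> L2"
proof -
  note [measurable] = L2_measurable[OF assms(1)] L2_measurable[OF assms(2)]
  have "integrable lebesgue (\<lambda>x. (cmod (f x + h x))\<^sup>2)"
  proof (rule Bochner_Integration.integrable_bound)
    show "integrable lebesgue (\<lambda>x. 2 * (cmod (f x))\<^sup>2 + 2 * (cmod (h x))\<^sup>2)"
      using assms by (auto intro!: Bochner_Integration.integrable_add integrable_mult_right L2_square_integrable)
    have "(cmod (a + b))\<^sup>2 \<le> 2 * (cmod a)\<^sup>2 + 2 * (cmod b)\<^sup>2" for a b
    proof -
      have "(cmod (a + b))\<^sup>2 \<le> (cmod a + cmod b)\<^sup>2"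
        by (simp add: norm_triangle_ineq power_mono)
      also have "\<dots> \<le> 2 * (cmod a)\<^sup>2 + 2 * (cmod b)\<^sup>2"
        using sum_squares_bound[of "cmod a" "cmod b"] by (simp add: power2_sum)
      finally show ?thesis .
    qed
    then show "AE x in lebesgue. norm ((cmod (f x + h x))\<^sup>2)
        \<le> norm (2 * (cmod (f x))\<^sup>2 + 2 * (cmod (h x))\<^sup>2)"
      by auto
  qed measurable
  then show ?thesis by (simp add: L2_def)
qed

lemma L2_diff: "f \<in> L2 \<Longrightarrow> h \<in> L2 \<Longrightarrow> (\<lambda>x. f x - h x) \<in> L2"
  using L2_add[of f "\<lambda>x. - h x"] L2_uminus by fastforce

lemma L2_sum: "finite K \<Longrightarrow> (\<And>k. k \<in> K \<Longrightarrow> f k \<in> L2) \<Longrightarrow> (\<lambda>x. \<Sum>k\<in>K. f k x) \<in> L2"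
  by (induction K rule: finite_induct) (auto intro: L2_add)

lemma L2_mult_integrable:
  assumes "f \<in> L2" "h \<in> L2"
  shows "integrable lebesgue (\<lambda>x. f x * h x)"
proof (rule Bochner_Integration.integrable_bound)
  note [measurable] = L2_measurable[OF assms(1)] L2_measurable[OF assms(2)]
  show "integrable lebesgue (\<lambda>x. (cmod (f x))\<^sup>2 + (cmod (h x))\<^sup>2)"
    using assms by (auto intro!: Bochner_Integration.integrable_add L2_square_integrable)
  show "(\<lambda>x. f x * h x) \<in> borel_measurable lebesgue"
    by measurable
  have "cmod a * cmod b \<le> (cmod a)\<^sup>2 + (cmod b)\<^sup>2" for a b
  proof -
    have "2 * (cmod a * cmod b) \<le> (cmod a)\<^sup>2 + (cmod b)\<^sup>2"
      using sum_squares_bound[of "cmod a" "cmod b"] by (simp only: mult.assoc)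
    moreover have "0 \<le> cmod a * cmod b" by simp
    ultimately show ?thesis by linarith
  qed
  then show "AE x in lebesgue. norm (f x * h x) \<le> norm ((cmod (f x))\<^sup>2 + (cmod (h x))\<^sup>2)"
    by (auto simp: norm_mult)
qed

lemma L2_inner_integrable:
  "f \<in> L2 \<Longrightarrow> h \<in> L2 \<Longrightarrow> integrable lebesgue (\<lambda>x. f x * cnj (h x))"
  by (intro L2_mult_integrable L2_cnj)

lemma L2_nn_integral_iff:
  assumes "f \<in> borel_measurable lebesgue"
  shows "f \<in> L2 \<longleftrightarrow> (\<integral>\<^sup>+x. ennreal ((cmod (f x))\<^sup>2) \<partial>lebesgue) < \<infinity>"
  using assms by (simp add: L2_def integrable_iff_bounded)


subsection \<open>The Hilbert space of square integrable functions\<close>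

\<comment> \<open>A partial quotient: a function outside \<open>L2\<close> is related to nothing, so
  no junk class arises and lifted operations have to be justified on \<open>L2\<close> only. The
  price is the \<open>L2\<close> side condition on every rule for \<open>cls\<close>.\<close>
quotient_type (overloaded) 'd l2 = "real ^ ('d::finite) \<Rightarrow> complex" / partial:
  "\<lambda>f h. f \<in> L2 \<and> h \<in> L2 \<and> (AE x in lebesgue. f x = h x)"
proof (rule part_equivpI)
  show "\<exists>f::real ^ 'd \<Rightarrow> complex. f \<in> L2 \<and> f \<in> L2 \<and> (AE x in lebesgue. f x = f x)"
    by (intro exI[of _ "\<lambda>x. 0"]) auto
  show "symp (\<lambda>f h::real ^ 'd \<Rightarrow> complex. f \<in> L2 \<and> h \<in> L2 \<and> (AE x in lebesgue. f x = h x))"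
    by (auto simp: symp_def)
  show "transp (\<lambda>f h::real ^ 'd \<Rightarrow> complex. f \<in> L2 \<and> h \<in> L2 \<and> (AE x in lebesgue. f x = h x))"
    unfolding transp_def by (auto elim: eventually_elim2)
qed

lift_definition cinner :: "'d::finite l2 \<Rightarrow> 'd l2 \<Rightarrow> complex" is L2_inner
proof -
  fix f f' h h' :: "real ^ 'd \<Rightarrow> complex"
  assume f: "f \<in> L2 \<and> f' \<in> L2 \<and> (AE x in lebesgue. f x = f' x)"
    and h: "h \<in> L2 \<and> h' \<in> L2 \<and> (AE x in lebesgue. h x = h' x)"
  have "AE x in lebesgue. f x * cnj (h x) = f' x * cnj (h' x)"
    using f h by (auto elim: eventually_elim2)
  then show "L2_inner f h = L2_inner f' h'"
    unfolding L2_inner_def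
    using f h L2_inner_integrable by (intro integral_cong_AE) (blast dest: borel_measurable_integrable)+
qed

text \<open>The space becomes a real inner product space through the type classes, which supply
  topology, completeness and unordered sums; the complex structure is carried separately by
  \<open>scaleC\<close> and \<open>cinner\<close>. The real part of \<open>cinner\<close> induces
  the same norm, so nothing is lost.\<close>

lift_definition scaleC :: "complex \<Rightarrow> 'd::finite l2 \<Rightarrow> 'd l2" (infixr "*\<^sub>C" 75)
  is "\<lambda>c f x. c * f x"
proof (intro conjI)
  fix c and f f' :: "real ^ 'd \<Rightarrow> complex"
  assume f: "f \<in> L2 \<and> f' \<in> L2 \<and> (AE x in lebesgue. f x = f' x)"
  then show "(\<lambda>x. c * f x) \<in> L2" "(\<lambda>x. c * f' x) \<in> L2"
    by (simp_all add: L2_cmult)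
  from f have "AE x in lebesgue. f x = f' x" by simp
  then show "AE x in lebesgue. c * f x = c * f' x" by eventually_elim simp
qed

instantiation l2 :: (finite) real_vector
begin

lift_definition zero_l2 :: "'a l2" is "\<lambda>x. 0" by simp
lift_definition plus_l2 :: "'a l2 \<Rightarrow> 'a l2 \<Rightarrow> 'a l2" is "\<lambda>f h x. f x + h x"
  by (auto intro: L2_add elim: eventually_elim2)
lift_definition minus_l2 :: "'a l2 \<Rightarrow> 'a l2 \<Rightarrow> 'a l2" is "\<lambda>f h x. f x - h x"
  by (auto intro: L2_diff elim: eventually_elim2)
lift_definition uminus_l2 :: "'a l2 \<Rightarrow> 'a l2" is "\<lambda>f x. - f x"
  by (auto intro: L2_uminus elim: eventually_mono)
definition scaleR_l2 :: "real \<Rightarrow> 'a l2 \<Rightarrow> 'a l2" where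
  "scaleR_l2 r f = complex_of_real r *\<^sub>C f"

instance
proof
  fix a b c :: "'a l2" and r s :: real
  show "a + b + c = a + (b + c)" by transfer (simp add: L2_add algebra_simps)
  show "a + b = b + a" by transfer (simp add: L2_add algebra_simps)
  show "0 + a = a" by transfer simp
  show "- a + a = 0" by transfer simp
  show "a - b = a + - b" by transfer (simp add: L2_diff)
  show "r *\<^sub>R (a + b) = r *\<^sub>R a + r *\<^sub>R b" unfolding scaleR_l2_def
    by transfer (simp add: distrib_left distrib_right mult.assoc L2_add L2_cmult)
  show "(r + s) *\<^sub>R a = r *\<^sub>R a + s *\<^sub>R a" unfolding scaleR_l2_def
    by transfer (simp add: distrib_left distrib_right mult.assoc L2_add L2_cmult)
  show "r *\<^sub>R s *\<^sub>R a = (r * s) *\<^sub>R a" unfolding scaleR_l2_def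
    by transfer (simp add: mult.assoc mult.left_commute L2_cmult)
  show "1 *\<^sub>R a = a" unfolding scaleR_l2_def by transfer simp
qed

end

lemma cinner_add_left: "cinner (f + f') h = cinner f h + cinner f' h"
  by transfer (simp add: L2_inner_def distrib_right L2_inner_integrable)

lemma cinner_scaleC_left: "cinner (c *\<^sub>C f) h = c * cinner f h"
  by transfer (simp add: L2_inner_def mult.assoc)

lemma cinner_commute: "cinner f h = cnj (cinner h f)"
  by transfer (unfold L2_inner_def, subst Bochner_Integration.integral_cnj[symmetric], simp add: mult.commute)

lemma cinner_add_right: "cinner f (h + h') = cinner f h + cinner f h'"
  by (metis cinner_add_left cinner_commute complex_cnj_add)

lemma cinner_scaleC_right: "cinner f (c *\<^sub>C h) = cnj c * cinner f h"
  by (metis cinner_scaleC_left cinner_commute complex_cnj_mult)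

lemma cinner_self: "cinner f f = complex_of_real (Re (cinner f f))" "0 \<le> Re (cinner f f)"
proof -
  have "cinner f f = complex_of_real (LINT x|lebesgue. (cmod (rep_l2 f x))\<^sup>2)"
    unfolding cinner.rep_eq L2_inner_def by (simp only: complex_norm_square[symmetric] integral_complex_of_real)
  then show "cinner f f = complex_of_real (Re (cinner f f))" "0 \<le> Re (cinner f f)"
    by auto
qed

lemma cinner_self_eq_0: "Re (cinner f f) = 0 \<longleftrightarrow> f = 0"
proof transfer
  fix f :: "real ^ 'a \<Rightarrow> complex"
  assume f: "f \<in> L2 \<and> f \<in> L2 \<and> (AE x in lebesgue. f x = f x)"
  have "Re (L2_inner f f) = (LINT x|lebesgue. (cmod (f x))\<^sup>2)"
    unfolding L2_inner_def by (simp only: complex_norm_square[symmetric] integral_complex_of_real Re_complex_of_real)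
  also have "\<dots> = 0 \<longleftrightarrow> (AE x in lebesgue. (cmod (f x))\<^sup>2 = 0)"
    using f L2_square_integrable by (intro integral_nonneg_eq_0_iff_AE) auto
  finally show "(Re (L2_inner f f) = 0) =
      (f \<in> L2 \<and> (\<lambda>x. 0) \<in> L2 \<and> (AE x in lebesgue. f x = 0))"
    using f by simp
qed

instantiation l2 :: (finite) real_inner
begin

definition inner_l2 :: "'a l2 \<Rightarrow> 'a l2 \<Rightarrow> real" where "inner_l2 f h = Re (cinner f h)"
definition norm_l2 :: "'a l2 \<Rightarrow> real" where "norm_l2 f = sqrt (inner f f)"
definition sgn_l2 :: "'a l2 \<Rightarrow> 'a l2" where "sgn_l2 f = f /\<^sub>R norm f"
definition dist_l2 :: "'a l2 \<Rightarrow> 'a l2 \<Rightarrow> real" where "dist_l2 f h = norm (f - h)"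
definition uniformity_l2 :: "('a l2 \<times> 'a l2) filter" where
  "uniformity_l2 = (INF e\<in>{0 <..}. principal {(x, y). dist x y < e})"
definition open_l2 :: "'a l2 set \<Rightarrow> bool" where
  "open_l2 U = (\<forall>x\<in>U. eventually (\<lambda>(x', y). x' = x \<longrightarrow> y \<in> U) uniformity)"

instance
proof
  fix x y z :: "'a l2" and r :: real
  show "dist x y = norm (x - y)" by (rule dist_l2_def)
  show "sgn x = x /\<^sub>R norm x" by (rule sgn_l2_def)
  show "inner x y = inner y x"
    unfolding inner_l2_def by (subst cinner_commute) simp
  show "inner (x + y) z = inner x z + inner y z"
    by (simp add: inner_l2_def cinner_add_left)
  show "inner (r *\<^sub>R x) y = r * inner x y"
    by (simp add: inner_l2_def scaleR_l2_def cinner_scaleC_left)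
  show "0 \<le> inner x x" by (simp add: inner_l2_def cinner_self(2))
  show "inner x x = 0 \<longleftrightarrow> x = 0" by (simp add: inner_l2_def cinner_self_eq_0)
  show "norm x = sqrt (inner x x)" by (rule norm_l2_def)
qed (simp_all add: uniformity_l2_def open_l2_def)

end

lemma cinner_eq_norm: "cinner f f = complex_of_real ((norm f)\<^sup>2)"
  using cinner_self(1)[of f] by (simp add: inner_l2_def power2_norm_eq_inner)

lemma scaleC_add_right: "c *\<^sub>C (f + h) = c *\<^sub>C f + c *\<^sub>C h"
  by transfer (simp add: distrib_left distrib_right mult.assoc L2_add L2_cmult)

lemma scaleC_add_left: "(c + d) *\<^sub>C f = c *\<^sub>C f + d *\<^sub>C f"
  by transfer (simp add: distrib_left distrib_right mult.assoc L2_add L2_cmult)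

lemma scaleC_one [simp]: "1 *\<^sub>C f = f"
  by transfer simp

lemma scaleC_scaleR: "c *\<^sub>C (r *\<^sub>R f) = r *\<^sub>R (c *\<^sub>C f)"
  unfolding scaleR_l2_def by transfer (simp add: mult.assoc mult.left_commute L2_cmult)

lemma scaleC_scaleC: "c *\<^sub>C (d *\<^sub>C f) = (c * d) *\<^sub>C f"
  by transfer (simp add: mult.assoc mult.left_commute L2_cmult)

lemma norm_scaleC: "norm (c *\<^sub>C f) = cmod c * norm f"
proof -
  have "complex_of_real ((norm (c *\<^sub>C f))\<^sup>2) = complex_of_real ((cmod c)\<^sup>2) * complex_of_real ((norm f)\<^sup>2)"
    unfolding cinner_eq_norm[symmetric]
    by (simp only: cinner_scaleC_left cinner_scaleC_right complex_norm_square mult.assoc mult.left_commute)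
  then have "(norm (c *\<^sub>C f))\<^sup>2 = (cmod c * norm f)\<^sup>2"
    by (simp only: of_real_mult[symmetric] of_real_eq_iff power_mult_distrib)
  then show ?thesis
    by (rule power2_eq_imp_eq) auto
qed

text \<open>The real Cauchy-Schwarz inequality controls only the real part. Multiplying
  \<open>h\<close> by the phase \<open>c\<close> of the inner product makes the product real without
  changing norms.\<close>

lemma cmod_cinner_le: "cmod (cinner f h) \<le> norm f * norm h"
proof -
  obtain c where c: "cmod c = 1" "cinner f h = c * complex_of_real (cmod (cinner f h))"
  proof (cases "cinner f h = 0")
    case False
    then show ?thesis
      by (intro that[of "cinner f h / complex_of_real (cmod (cinner f h))"]) (auto simp: norm_divide)
  qed (use that[of 1] in auto)
  have "cnj c * c = 1"
    using c(1) complex_norm_square[of c] by (simp add: mult.commute)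
  then have "cnj c * cinner f h = complex_of_real (cmod (cinner f h))"
    by (subst c(2)) (simp flip: mult.assoc)
  then have "cmod (cinner f h) = inner f (c *\<^sub>C h)"
    by (simp add: inner_l2_def cinner_scaleC_right)
  also have "\<dots> \<le> norm f * norm (c *\<^sub>C h)"
    by (rule norm_cauchy_schwarz)
  finally show ?thesis using c by (simp add: norm_scaleC)
qed

lemma bounded_bilinear_cinner: "bounded_bilinear cinner"
proof
  show "\<exists>K. \<forall>a b. norm (cinner a b) \<le> norm a * norm b * K"
    by (intro exI[of _ 1]) (simp add: cmod_cinner_le)
qed (simp_all add: cinner_add_left cinner_add_right scaleR_l2_def cinner_scaleC_left
    cinner_scaleC_right scaleR_conv_of_real)

interpretation cinner: bounded_bilinear cinner
  by (rule bounded_bilinear_cinner)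

lemma bounded_linear_scaleC: "bounded_linear (scaleC c)"
proof
  show "\<exists>K. \<forall>f. norm (c *\<^sub>C f) \<le> norm f * K"
    by (intro exI[of _ "cmod c"]) (simp add: norm_scaleC)
qed (simp_all add: scaleC_add_right scaleC_scaleR)

lemma bounded_linear_scaleC_left: "bounded_linear (\<lambda>c. c *\<^sub>C f)"
proof
  show "\<exists>K. \<forall>c. norm (c *\<^sub>C f) \<le> norm c * K"
    by (intro exI[of _ "norm f"]) (simp add: norm_scaleC)
qed (simp_all add: scaleC_add_left scaleR_l2_def scaleC_scaleC scaleR_conv_of_real)

section \<open>Passage between functions and classes\<close>

abbreviation cls :: "(real ^ 'd \<Rightarrow> complex) \<Rightarrow> 'd::finite l2" where
  "cls \<equiv> abs_l2"

lemma cls_eq_iff: "f \<in> L2 \<Longrightarrow> h \<in> L2 \<Longrightarrow> cls f = cls h \<longleftrightarrow> (AE x in lebesgue. f x = h x)"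
  using Quotient3_rel[OF Quotient3_l2, of f h] by auto

lemma rep_l2_L2 [simp]: "rep_l2 F \<in> L2"
  using Quotient3_rep_reflp[OF Quotient3_l2, of F] by simp

lemma cls_rep [simp]: "cls (rep_l2 F) = F"
  by (rule Quotient3_abs_rep[OF Quotient3_l2])

lemma l2_cases [case_names cls]:
  obtains f where "f \<in> L2" "F = cls f"
  by (rule that[of "rep_l2 F"]) auto

lemma cls_add: "f \<in> L2 \<Longrightarrow> h \<in> L2 \<Longrightarrow> cls (\<lambda>x. f x + h x) = cls f + cls h"
  by (simp add: plus_l2.abs_eq)
lemma cls_diff: "f \<in> L2 \<Longrightarrow> h \<in> L2 \<Longrightarrow> cls (\<lambda>x. f x - h x) = cls f - cls h"
  by (simp add: minus_l2.abs_eq)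
lemma cls_scaleC: "f \<in> L2 \<Longrightarrow> cls (\<lambda>x. c * f x) = c *\<^sub>C cls f"
  by (simp add: scaleC.abs_eq)
lemma cls_zero: "cls (\<lambda>x. 0) = 0"
  by (simp add: zero_l2_def)
lemma cinner_cls: "f \<in> L2 \<Longrightarrow> h \<in> L2 \<Longrightarrow> cinner (cls f) (cls h) = L2_inner f h"
  by (simp add: cinner.abs_eq)

lemma cls_sum:
  "finite K \<Longrightarrow> (\<And>k. k \<in> K \<Longrightarrow> f k \<in> L2) \<Longrightarrow> cls (\<lambda>x. \<Sum>k\<in>K. f k x) = (\<Sum>k\<in>K. cls (f k))"
  by (induction K rule: finite_induct) (auto simp: cls_zero cls_add L2_sum)

lemma norm_cls_square:
  assumes "f \<in> L2"
  shows "(norm (cls f))\<^sup>2 = (LINT x|lebesgue. (cmod (f x))\<^sup>2)"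
proof -
  have "complex_of_real ((norm (cls f))\<^sup>2) = complex_of_real (LINT x|lebesgue. (cmod (f x))\<^sup>2)"
    unfolding cinner_eq_norm[symmetric] cinner_cls[OF assms assms] L2_inner_def
    by (simp only: complex_norm_square[symmetric] integral_complex_of_real)
  then show ?thesis by (simp only: of_real_eq_iff)
qed

lemma L2_norm_cls: "f \<in> L2 \<Longrightarrow> L2_norm f = ennreal (norm (cls f))"
  unfolding L2_norm_def norm_cls_square[symmetric] by simp

lemma nn_integral_cls:
  assumes "f \<in> L2"
  shows "(\<integral>\<^sup>+x. ennreal ((cmod (f x))\<^sup>2) \<partial>lebesgue) = ennreal ((norm (cls f))\<^sup>2)"
  unfolding norm_cls_square[OF assms]
  using assms L2_square_integrable by (intro nn_integral_eq_integral) auto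

text \<open>Membership and norm bound are obtained together from one nonnegative integral, which is
  the form in which Fatou's lemma delivers its conclusion.\<close>

lemma norm_cls_le_iff:
  assumes "f \<in> borel_measurable lebesgue" "0 \<le> c"
  shows "f \<in> L2 \<and> norm (cls f) \<le> c \<longleftrightarrow> (\<integral>\<^sup>+x. ennreal ((cmod (f x))\<^sup>2) \<partial>lebesgue) \<le> ennreal (c\<^sup>2)"
proof
  assume "f \<in> L2 \<and> norm (cls f) \<le> c"
  then show "(\<integral>\<^sup>+x. ennreal ((cmod (f x))\<^sup>2) \<partial>lebesgue) \<le> ennreal (c\<^sup>2)"
    by (simp add: nn_integral_cls ennreal_leI power_mono)
next
  assume *: "(\<integral>\<^sup>+x. ennreal ((cmod (f x))\<^sup>2) \<partial>lebesgue) \<le> ennreal (c\<^sup>2)"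
  then have f: "f \<in> L2"
    using L2_nn_integral_iff[OF assms(1)] by (simp add: le_less_trans)
  with * have "(norm (cls f))\<^sup>2 \<le> c\<^sup>2"
    by (simp add: nn_integral_cls)
  with f show "f \<in> L2 \<and> norm (cls f) \<le> c"
    using assms(2) power2_le_imp_le by blast
qed

text \<open>\<open>d \<le> 2\<^sup>-\<^sup>n + 2\<^sup>n d\<^sup>2\<close> by AM-GM.\<close>

lemma summable_if_summable_weighted_squares:
  fixes d :: "nat \<Rightarrow> complex"
  assumes "summable (\<lambda>n. 2 ^ n * (cmod (d n))\<^sup>2)"
  shows "summable d"
proof (rule summable_comparison_test'[where N = 0])
  show "summable (\<lambda>n. (1/2)^n + 2 ^ n * (cmod (d n))\<^sup>2)"
    using assms by (intro summable_add summable_geometric) auto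
  fix n :: nat
  have "0 \<le> (2 ^ n * cmod (d n) - 1)\<^sup>2 / 2 ^ n" by simp
  also have "\<dots> = 2 ^ n * (cmod (d n))\<^sup>2 - 2 * cmod (d n) + (1/2)^n"
    by (simp add: power2_eq_square field_simps power_divide)
  finally show "norm (d n) \<le> (1/2)^n + 2 ^ n * (cmod (d n))\<^sup>2"
    using norm_ge_zero[of "d n"] by linarith
qed

section \<open>Completeness (Riesz-Fischer)\<close>

text \<open>The squared increments integrate to at most \<open>4^-n\<close>, which leaves room for
  the weight \<open>2^n\<close>: the weighted squares still have a finite total integral. Hence
  their sum is finite almost everywhere, and the weight is exactly what turns summable squares into
  summable increments.\<close>

lemma l2_geometric_Cauchy_AE_convergent:
  fixes f :: "nat \<Rightarrow> real ^ 'd \<Rightarrow> complex"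
  assumes f: "\<And>n. f n \<in> L2"
    and d: "\<And>n. norm (cls (f (Suc n)) - cls (f n)) \<le> (1/2)^n"
  shows "AE x in lebesgue. convergent (\<lambda>n. f n x)"
proof -
  define d where "d n x = f (Suc n) x - f n x" for n x
  have dL2: "d n \<in> L2" for n
    unfolding d_def using f by (intro L2_diff)
  have [measurable]: "d n \<in> borel_measurable lebesgue" for n
    using dL2 by (rule L2_measurable)
  have int_d: "(\<integral>\<^sup>+x. ennreal (2 ^ n * (cmod (d n x))\<^sup>2) \<partial>lebesgue) \<le> ennreal ((1/2)^n)" for n
  proof -
    have "(\<integral>\<^sup>+x. ennreal (2 ^ n * (cmod (d n x))\<^sup>2) \<partial>lebesgue)
        = ennreal (2 ^ n) * (\<integral>\<^sup>+x. ennreal ((cmod (d n x))\<^sup>2) \<partial>lebesgue)"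
      by (subst nn_integral_cmult[symmetric]) (auto simp: ennreal_mult)
    also have "\<dots> = ennreal (2 ^ n * (norm (cls (d n)))\<^sup>2)"
      using dL2 by (simp add: nn_integral_cls ennreal_mult)
    also have "\<dots> \<le> ennreal (2 ^ n * ((1/2)^n)\<^sup>2)"
      using d[of n] f unfolding d_def
      by (intro ennreal_leI mult_left_mono power_mono) (auto simp: cls_diff)
    also have "2 ^ n * ((1/2)^n)\<^sup>2 = (1/2 :: real)^n"
      by (simp add: power2_eq_square power_divide)
    finally show ?thesis .
  qed
  have "(\<integral>\<^sup>+x. (\<Sum>n. ennreal (2 ^ n * (cmod (d n x))\<^sup>2)) \<partial>lebesgue)
      = (\<Sum>n. \<integral>\<^sup>+x. ennreal (2 ^ n * (cmod (d n x))\<^sup>2) \<partial>lebesgue)"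
    by (rule nn_integral_suminf) measurable
  also have "\<dots> \<le> (\<Sum>n. ennreal ((1/2)^n))"
    by (intro suminf_le int_d) auto
  also have "\<dots> = ennreal (\<Sum>n. (1/2)^n)"
    by (rule suminf_ennreal2) (auto intro: summable_geometric)
  also have "\<dots> < \<infinity>" by simp
  finally have "AE x in lebesgue. (\<Sum>n. ennreal (2 ^ n * (cmod (d n x))\<^sup>2)) \<noteq> \<infinity>"
    by (intro nn_integral_noteq_infinite) auto
  then show ?thesis
  proof eventually_elim
    case (elim x)
    then have "summable (\<lambda>n. 2 ^ n * (cmod (d n x))\<^sup>2)"
      by (intro summable_suminf_not_top) auto
    then have "summable (\<lambda>n. d n x)"
      by (rule summable_if_summable_weighted_squares)
    then have "(\<lambda>n. \<Sum>i<n. d i x) \<longlonglongrightarrow> (\<Sum>n. d n x)"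
      by (rule summable_LIMSEQ)
    then have "(\<lambda>n. (\<Sum>i<n. d i x) + f 0 x) \<longlonglongrightarrow> (\<Sum>n. d n x) + f 0 x"
      by (rule tendsto_add[OF _ tendsto_const])
    moreover have "(\<Sum>i<n. d i x) + f 0 x = f n x" for n
      unfolding d_def using sum_lessThan_telescope[of "\<lambda>n. f n x" n] by simp
    ultimately have "(\<lambda>n. f n x) \<longlonglongrightarrow> (\<Sum>n. d n x) + f 0 x" by simp
    then show "convergent (\<lambda>n. f n x)"
      by (auto simp: convergent_def)
  qed
qed

text \<open>A subsequence with geometric increments has a pointwise limit almost everywhere. Fatou's
  lemma upgrades this to a limit in norm, and a Cauchy sequence with a convergent subsequence
  converges.\<close>

instance l2 :: (finite) complete_space
proof
  fix X :: "nat \<Rightarrow> 'a l2"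
  assume X: "Cauchy X"
  have "\<exists>M. \<forall>m\<ge>M. \<forall>k\<ge>M. norm (X m - X k) < (1/2)^n" for n
    using X by (simp add: Cauchy_iff)
  then obtain M where M: "\<And>n m k. m \<ge> M n \<Longrightarrow> k \<ge> M n \<Longrightarrow> norm (X m - X k) < (1/2)^n"
    by metis
  \<comment> \<open>The partial sums give \<open>M n \<le> r m\<close> for all
    \<open>m \<ge> n\<close>; the summand \<open>n\<close> makes \<open>r\<close> strictly
    increasing even where \<open>M\<close> vanishes.\<close>
  define r where "r n = (\<Sum>i\<le>n. M i) + n" for n :: nat
  have r: "strict_mono r"
    unfolding strict_mono_Suc_iff r_def by simp
  have rM: "M n \<le> r m" if "n \<le> m" for n m
    using member_le_sum[of n "{..m}" M] that unfolding r_def by simp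
  define f where "f n = rep_l2 (X (r n))" for n
  have f: "f n \<in> L2" "cls (f n) = X (r n)" for n
    by (simp_all add: f_def)
  have [measurable]: "f n \<in> borel_measurable lebesgue" for n
    using f(1) by (rule L2_measurable)
  have bound: "norm (cls (f m) - cls (f n)) \<le> (1/2)^n" if "n \<le> m" for n m
    using M[of n "r m" "r n"] rM that f by (simp add: less_imp_le)
  have "AE x in lebesgue. convergent (\<lambda>n. f n x)"
    by (rule l2_geometric_Cauchy_AE_convergent[OF f(1)]) (simp add: bound)
  then have conv: "AE x in lebesgue. (\<lambda>n. f n x) \<longlonglongrightarrow> lim (\<lambda>n. f n x)"
    by eventually_elim (simp add: convergent_LIMSEQ_iff)
  define g where "g x = lim (\<lambda>n. f n x)" for x
  have [measurable]: "g \<in> borel_measurable lebesgue"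
    unfolding g_def by measurable
  \<comment> \<open>Fatou's lemma in \<open>m\<close> with \<open>n\<close> fixed: the uniform bound
    on \<open>f m - f n\<close> survives the pointwise limit.\<close>
  have tail: "(\<lambda>x. g x - f n x) \<in> L2 \<and> norm (cls (\<lambda>x. g x - f n x)) \<le> (1/2)^n" for n
  proof (subst norm_cls_le_iff)
    have "(\<integral>\<^sup>+x. ennreal ((cmod (g x - f n x))\<^sup>2) \<partial>lebesgue)
        = (\<integral>\<^sup>+x. liminf (\<lambda>m. ennreal ((cmod (f m x - f n x))\<^sup>2)) \<partial>lebesgue)"
    proof (rule nn_integral_cong_AE)
      show "AE x in lebesgue. ennreal ((cmod (g x - f n x))\<^sup>2)
          = liminf (\<lambda>m. ennreal ((cmod (f m x - f n x))\<^sup>2))"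
        using conv
      proof eventually_elim
        case (elim x)
        then have "(\<lambda>m. ennreal ((cmod (f m x - f n x))\<^sup>2)) \<longlonglongrightarrow> ennreal ((cmod (g x - f n x))\<^sup>2)"
          unfolding g_def by (intro tendsto_intros) auto
        then show ?case
          by (intro lim_imp_Liminf[symmetric]) auto
      qed
    qed
    also have "\<dots> \<le> liminf (\<lambda>m. \<integral>\<^sup>+x. ennreal ((cmod (f m x - f n x))\<^sup>2) \<partial>lebesgue)"
      by (rule nn_integral_liminf) measurable
    also have "\<dots> \<le> liminf (\<lambda>m::nat. ennreal (((1/2)^n)\<^sup>2))"
    proof (rule Liminf_mono)
      show "\<forall>\<^sub>F m in sequentially. (\<integral>\<^sup>+x. ennreal ((cmod (f m x - f n x))\<^sup>2) \<partial>lebesgue) \<le> ennreal (((1/2)^n)\<^sup>2)"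
        using eventually_ge_at_top[of n]
      proof eventually_elim
        case (elim m)
        show ?case
          by (subst norm_cls_le_iff[symmetric]) (use f bound[OF elim] in \<open>auto simp: L2_diff cls_diff\<close>)
      qed
    qed
    also have "\<dots> = ennreal (((1/2)^n)\<^sup>2)"
      by (simp add: Liminf_const)
    finally show "(\<integral>\<^sup>+x. ennreal ((cmod (g x - f n x))\<^sup>2) \<partial>lebesgue) \<le> ennreal (((1/2)^n)\<^sup>2)" .
  qed auto
  have g: "g \<in> L2"
    using L2_add[OF conjunct1[OF tail[of 0]] f(1)[of 0]] by simp
  have "norm ((X \<circ> r) n - cls g) \<le> (1/2)^n" for n
    using tail[of n] g f by (simp add: cls_diff norm_minus_commute)
  then have "(\<lambda>n. (X \<circ> r) n - cls g) \<longlonglongrightarrow> 0"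
    by (rule Lim_null_comparison[OF always_eventually[OF allI]]) (simp add: LIMSEQ_power_zero)
  then have "(X \<circ> r) \<longlonglongrightarrow> cls g"
    by (rule LIM_zero_cancel)
  then show "convergent X"
    using Cauchy_converges_subseq[OF X r] by (auto simp: convergent_def)
qed

instance l2 :: (finite) banach ..


subsection \<open>Translations, modulations and multiplication by linear forms\<close>

definition e1 :: "real \<Rightarrow> complex" where
  "e1 t = exp (2 * complex_of_real pi * \<i> * complex_of_real t)"

lemma e1_cis: "e1 t = cis (2 * pi * t)"
  by (simp add: e1_def cis_conv_exp mult_ac)

lemma e1_add: "e1 (s + t) = e1 s * e1 t"
  by (simp add: e1_cis cis_mult distrib_left)

lemma e1_0 [simp]: "e1 0 = 1"
  by (simp add: e1_cis)

lemma cmod_e1 [simp]: "cmod (e1 t) = 1"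
  by (simp add: e1_cis)

lemma cnj_e1: "cnj (e1 t) = e1 (- t)"
  by (simp add: e1_cis cis_cnj)

lemma e1_of_int [simp]: "e1 (of_int n) = 1"
  by (simp add: e1_cis cis_multiple_2pi)

lemma continuous_e1 [continuous_intros]:
  "continuous_on A f \<Longrightarrow> continuous_on A (\<lambda>x. e1 (f x))"
  unfolding e1_def by (intro continuous_intros)

lemma isCont_e1: "isCont e1 t"
  unfolding e1_def by (intro continuous_intros)

lemma borel_measurable_e1 [measurable]:
  "f \<in> borel_measurable M \<Longrightarrow> (\<lambda>x. e1 (f x)) \<in> borel_measurable M"
  by (rule measurable_compose[OF _ borel_measurable_continuous_onI])
     (auto intro: continuous_intros)

text \<open>Half-angle formula: the chord has length \<open>2 |sin (pi t)|\<close>. The factor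
  \<open>2 pi\<close> reappears as the Lipschitz constant of translations.\<close>

lemma cmod_e1_minus_1_le: "cmod (e1 t - 1) \<le> 2 * pi * \<bar>t\<bar>"
proof -
  have "cmod (e1 t - 1) = 2 * \<bar>sin (pi * t)\<bar>"
    using dist_exp_i_1[of "2 * pi * t"] by (simp add: e1_def mult_ac)
  also have "\<dots> \<le> 2 * \<bar>pi * t\<bar>"
    using abs_sin_x_le_abs_x by (intro mult_left_mono) auto
  finally show ?thesis by (simp add: abs_mult)
qed

section \<open>Translation invariance of Lebesgue measure\<close>

lemma
  fixes a :: "'a::euclidean_space"
  shows measurable_lebesgue_shift: "(\<lambda>x. x - a) \<in> lebesgue \<rightarrow>\<^sub>M lebesgue"
    and lebesgue_distr_shift: "distr lebesgue lebesgue (\<lambda>x. x - a) = lebesgue"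
proof -
  have *: "(\<lambda>x. x - a) = (\<lambda>x. - a + (\<Sum>j\<in>Basis. (1 * (x \<bullet> j)) *\<^sub>R j))"
    by (simp add: euclidean_representation)
  show "(\<lambda>x. x - a) \<in> lebesgue \<rightarrow>\<^sub>M lebesgue"
    unfolding * by (rule lebesgue_affine_measurable) simp
  show "distr lebesgue lebesgue (\<lambda>x. x - a) = lebesgue"
    using lebesgue_affine_euclidean[of "\<lambda>_. 1" "- a"] unfolding * by (simp add: density_1)
qed

lemma AE_lebesgue_shift:
  fixes a :: "'a::euclidean_space"
  assumes "AE x in lebesgue. P x"
  shows "AE x in lebesgue. P (x - a)"
proof (rule AE_distrD[OF measurable_lebesgue_shift])
  show "AE x in distr lebesgue lebesgue (\<lambda>x. x - a). P x"
    unfolding lebesgue_distr_shift by (rule assms)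
qed

lemma integral_lebesgue_shift:
  fixes f :: "'a::euclidean_space \<Rightarrow> 'b::{banach, second_countable_topology}"
  assumes "f \<in> borel_measurable lebesgue"
  shows "(LINT x|lebesgue. f (x - a)) = (LINT x|lebesgue. f x)"
  using integral_distr[OF measurable_lebesgue_shift assms] by (simp add: lebesgue_distr_shift)

lemma integrable_lebesgue_shift:
  fixes f :: "'a::euclidean_space \<Rightarrow> 'b::{banach, second_countable_topology}"
  assumes "integrable lebesgue f"
  shows "integrable lebesgue (\<lambda>x. f (x - a))"
  using integrable_distr[OF measurable_lebesgue_shift[of a], of f] assms by (simp add: lebesgue_distr_shift)

lemma L2_shift:
  assumes "f \<in> L2"
  shows "(\<lambda>x. f (x - a)) \<in> L2"
proof -
  have "(\<lambda>x. f (x - a)) \<in> borel_measurable lebesgue"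
    using measurable_compose[OF measurable_lebesgue_shift L2_measurable[OF assms]] .
  then show ?thesis
    using integrable_lebesgue_shift[OF L2_square_integrable[OF assms]] by (simp add: L2_def)
qed

lemma borel_measurable_lebesgue_e1: "(\<lambda>x. e1 (b \<bullet> x)) \<in> borel_measurable lebesgue"
  by (intro measurable_completion) measurable

lemma L2_modulate: "f \<in> L2 \<Longrightarrow> (\<lambda>x. e1 (b \<bullet> x) * f x) \<in> L2"
  by (rule L2_bounded_mult[where C = 1]) (auto intro: borel_measurable_lebesgue_e1)

section \<open>The operators on classes and their commutation rules\<close>

lift_definition shift :: "real ^ 'd \<Rightarrow> 'd::finite l2 \<Rightarrow> 'd l2" is "\<lambda>a f x. f (x - a)"
  by (simp add: L2_shift) (rule AE_lebesgue_shift, simp)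

lift_definition modulate :: "real ^ 'd \<Rightarrow> 'd::finite l2 \<Rightarrow> 'd l2" is "\<lambda>b f x. e1 (b \<bullet> x) * f x"
  by (auto intro: L2_modulate elim: eventually_mono)

text \<open>A relation instead of an operator because multiplication by a linear form is unbounded:
  that \<open>is_P v F P\<close> holds for some class \<open>P\<close> says that \<open>F\<close>
  lies in the domain, and \<open>P\<close> is then the value.\<close>

lift_definition is_P :: "real ^ 'd \<Rightarrow> 'd::finite l2 \<Rightarrow> 'd l2 \<Rightarrow> bool"
  is "\<lambda>v f h. AE x in lebesgue. h x = P_op v f x"
  unfolding P_op_def by (auto elim: eventually_elim2)

lemma shift_cls: "f \<in> L2 \<Longrightarrow> shift a (cls f) = cls (\<lambda>x. f (x - a))"
  by (simp add: shift.abs_eq)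

lemma modulate_cls: "f \<in> L2 \<Longrightarrow> modulate b (cls f) = cls (\<lambda>x. e1 (b \<bullet> x) * f x)"
  by (simp add: modulate.abs_eq)

lemma is_P_cls: "f \<in> L2 \<Longrightarrow> P_op v f \<in> L2 \<Longrightarrow> is_P v (cls f) (cls (P_op v f))"
  by (simp add: is_P.abs_eq)

lemma cinner_shift_shift: "cinner (shift a F) (shift a H) = cinner F H"
proof (transfer, unfold L2_inner_def)
  fix a and f h :: "real ^ 'd \<Rightarrow> complex"
  assume "f \<in> L2 \<and> f \<in> L2 \<and> (AE x in lebesgue. f x = f x)"
    and "h \<in> L2 \<and> h \<in> L2 \<and> (AE x in lebesgue. h x = h x)"
  then have "(\<lambda>x. f x * cnj (h x)) \<in> borel_measurable lebesgue"
    using borel_measurable_integrable[OF L2_inner_integrable[of f h]] by simp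
  then show "(CLINT x|lebesgue. f (x - a) * cnj (h (x - a))) = (CLINT x|lebesgue. f x * cnj (h x))"
    by (rule integral_lebesgue_shift)
qed

lemma shift_shift: "shift a (shift b F) = shift (a + b) F"
  by transfer (simp add: L2_shift algebra_simps)

lemma shift_0 [simp]: "shift 0 F = F"
  by transfer simp

lemma cinner_shift_left: "cinner (shift a F) H = cinner F (shift (- a) H)"
  using cinner_shift_shift[of a F "shift (- a) H"] by (simp add: shift_shift)

lemma modulate_modulate: "modulate a (modulate b F) = modulate (a + b) F"
  by transfer (simp add: L2_modulate e1_add inner_add_left mult.assoc)

lemma modulate_0 [simp]: "modulate 0 F = F"
  by transfer simp

lemma cinner_modulate_left: "cinner (modulate b F) H = cinner F (modulate (- b) H)"
  by transfer (simp add: L2_inner_def mult_ac cnj_e1)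

text \<open>The Weyl commutation relation, the source of the phases in the Gabor expansions.\<close>

lemma shift_modulate: "shift a (modulate b F) = e1 (- (b \<bullet> a)) *\<^sub>C modulate b (shift a F)"
  by transfer (simp add: L2_modulate L2_shift L2_cmult inner_diff_right mult.assoc mult.left_commute
      e1_add[of _ "- _", simplified])

lemma norm_eqI_cinner: "cinner F F = cinner H H \<Longrightarrow> norm F = norm H"
  by (simp add: norm_l2_def inner_l2_def)

lemma norm_shift [simp]: "norm (shift a F) = norm F"
  by (rule norm_eqI_cinner) (rule cinner_shift_shift)

lemma norm_modulate [simp]: "norm (modulate b F) = norm F"
  by (rule norm_eqI_cinner) (simp add: cinner_modulate_left modulate_modulate)

lemma shift_add: "shift a (F + H) = shift a F + shift a H"
  by transfer (simp add: L2_add L2_shift)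

lemma shift_scaleC: "shift a (c *\<^sub>C F) = c *\<^sub>C shift a F"
  by transfer (simp add: L2_cmult L2_shift)

lemma modulate_add: "modulate b (F + H) = modulate b F + modulate b H"
  by transfer (simp add: L2_add L2_modulate distrib_left)

lemma modulate_scaleC: "modulate b (c *\<^sub>C F) = c *\<^sub>C modulate b F"
  by transfer (simp add: L2_cmult L2_modulate mult.left_commute)

lemma bounded_linear_shift: "bounded_linear (shift a)"
  by (rule bounded_linear_intro[of _ 1]) (simp_all add: shift_add shift_scaleC scaleR_l2_def)

lemma bounded_linear_modulate: "bounded_linear (modulate b)"
  by (rule bounded_linear_intro[of _ 1]) (simp_all add: modulate_add modulate_scaleC scaleR_l2_def)

text \<open>Symmetry of the position operator: the linear form is real and passes through the
  conjugation.\<close>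

lemma is_P_cinner: "is_P v F P \<Longrightarrow> is_P v H Q \<Longrightarrow> cinner P H = cinner F Q"
proof (transfer, unfold L2_inner_def)
  fix v and f p h q :: "real ^ 'd \<Rightarrow> complex"
  assume L2: "f \<in> L2 \<and> f \<in> L2 \<and> (AE x in lebesgue. f x = f x)" "p \<in> L2 \<and> p \<in> L2 \<and> (AE x in lebesgue. p x = p x)"
    "h \<in> L2 \<and> h \<in> L2 \<and> (AE x in lebesgue. h x = h x)" "q \<in> L2 \<and> q \<in> L2 \<and> (AE x in lebesgue. q x = q x)"
    and "AE x in lebesgue. p x = P_op v f x" "AE x in lebesgue. q x = P_op v h x"
  from this(5,6) have "AE x in lebesgue. p x * cnj (h x) = f x * cnj (q x)"
    by eventually_elim (simp add: P_op_def)
  then show "(CLINT x|lebesgue. p x * cnj (h x)) = (CLINT x|lebesgue. f x * cnj (q x))"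
    using L2 borel_measurable_integrable[OF L2_inner_integrable[of p h]]
      borel_measurable_integrable[OF L2_inner_integrable[of f q]] by (intro integral_cong_AE) simp_all
qed

text \<open>The canonical commutation relation in integrated form, from
  \<open>v \<bullet> x = v \<bullet> (x - a) + v \<bullet> a\<close>. The extra term is what finally
  produces \<open>v \<bullet> w\<close>.\<close>

lemma is_P_shift:
  "is_P v F P \<Longrightarrow> is_P v (shift a F) (shift a P + complex_of_real (v \<bullet> a) *\<^sub>C shift a F)"
proof transfer
  fix v a and f p :: "real ^ 'd \<Rightarrow> complex"
  assume "AE x in lebesgue. p x = P_op v f x"
  then have "AE x in lebesgue. p (x - a) = P_op v f (x - a)"
    by (rule AE_lebesgue_shift)
  then show "AE x in lebesgue. p (x - a) + complex_of_real (v \<bullet> a) * f (x - a) = P_op v (\<lambda>x. f (x - a)) x"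
    by eventually_elim (simp add: P_op_def inner_diff_right algebra_simps)
qed

lemma is_P_modulate: "is_P v F P \<Longrightarrow> is_P v (modulate b F) (modulate b P)"
proof transfer
  fix v b and f p :: "real ^ 'd \<Rightarrow> complex"
  assume "AE x in lebesgue. p x = P_op v f x"
  then show "AE x in lebesgue. e1 (b \<bullet> x) * p x = P_op v (\<lambda>x. e1 (b \<bullet> x) * f x) x"
    by eventually_elim (simp add: P_op_def)
qed

subsection \<open>Frames\<close>

lemma infsum_ennreal_real:
  fixes f :: "'k \<Rightarrow> real"
  assumes "f summable_on A" "\<And>k. k \<in> A \<Longrightarrow> 0 \<le> f k"
  shows "(\<Sum>\<^sub>\<infinity>k\<in>A. ennreal (f k)) = ennreal (\<Sum>\<^sub>\<infinity>k\<in>A. f k)"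
proof (rule infsumI)
  have "((\<lambda>K. ennreal (sum f K)) \<longlongrightarrow> ennreal (infsum f A)) (finite_subsets_at_top A)"
    using has_sum_infsum[OF assms(1)] unfolding has_sum_def by (rule tendsto_ennrealI)
  moreover have "\<forall>\<^sub>F K in finite_subsets_at_top A. ennreal (sum f K) = (\<Sum>k\<in>K. ennreal (f k))"
    using assms(2) by (intro eventually_finite_subsets_at_top_weakI) (auto intro!: sum_ennreal[symmetric])
  ultimately show "((\<lambda>k. ennreal (f k)) has_sum ennreal (infsum f A)) A"
    unfolding has_sum_def by (rule Lim_transform_eventually)
qed

text \<open>Finite partial sums stay below the total. This is how the upper frame inequality, stated
  in \<open>ennreal\<close>, yields the summability that real sums require.\<close>

lemma summable_on_if_infsum_ennreal_finite:
  fixes f :: "'k \<Rightarrow> real"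
  assumes "(\<Sum>\<^sub>\<infinity>k\<in>A. ennreal (f k)) \<le> ennreal c" "\<And>k. k \<in> A \<Longrightarrow> 0 \<le> f k"
  shows "f summable_on A"
proof (rule nonneg_bdd_above_summable_on)
  \<comment> \<open>\<open>max c 0\<close> covers negative \<open>c\<close>, for which
    \<open>ennreal c\<close> is 0.\<close>
  have "sum f K \<le> max c 0" if K: "K \<in> {F. F \<subseteq> A \<and> finite F}" for K
  proof -
    have "ennreal (sum f K) = (\<Sum>k\<in>K. ennreal (f k))"
      using K assms(2) by (intro sum_ennreal[symmetric]) auto
    also have "\<dots> \<le> (\<Sum>\<^sub>\<infinity>k\<in>A. ennreal (f k))"
      using K unfolding infsum_finite[OF conjunct2[OF K[simplified]], symmetric]
      by (intro infsum_mono_neutral nonneg_summable_on_complete) auto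
    also have "\<dots> \<le> ennreal (max c 0)"
      using assms(1) by (rule order_trans) (simp add: ennreal_leI)
    finally show ?thesis by (subst (asm) ennreal_le_iff) auto
  qed
  then show "bdd_above (sum f ` {F. F \<subseteq> A \<and> finite F})"
    by (rule bdd_aboveI2)
qed (use assms in auto)

text \<open>Cauchy criterion for the net of finite subsets: for a finite superset of
  \<open>K0\<close> the sum differs from that over \<open>K0\<close> by a sum over a set disjoint
  from \<open>K0\<close>, so any two such sums are within \<open>e\<close>, and completeness gives
  the limit.\<close>

lemma summable_onI_Cauchy:
  fixes f :: "'k \<Rightarrow> 'b::banach"
  assumes "\<And>e. e > 0 \<Longrightarrow> \<exists>K0. finite K0 \<and> K0 \<subseteq> A \<and>
    (\<forall>K. finite K \<and> K \<subseteq> A \<and> K \<inter> K0 = {} \<longrightarrow> norm (sum f K) < e)"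
  shows "f summable_on A"
proof -
  have "\<exists>P. eventually P (finite_subsets_at_top A) \<and>
      (\<forall>F F'. P F \<and> P F' \<longrightarrow> dist (sum f F) (sum f F') < e)" if "e > 0" for e
  proof -
    have "\<exists>K0. finite K0 \<and> K0 \<subseteq> A \<and>
        (\<forall>K. finite K \<and> K \<subseteq> A \<and> K \<inter> K0 = {} \<longrightarrow> norm (sum f K) < e / 2)"
      using that by (intro assms) simp
    then obtain K0 where K0: "finite K0" "K0 \<subseteq> A"
      and K0': "\<forall>K. finite K \<and> K \<subseteq> A \<and> K \<inter> K0 = {} \<longrightarrow> norm (sum f K) < e / 2"
      by (elim exE conjE)
    define P where "P F \<longleftrightarrow> finite F \<and> K0 \<subseteq> F \<and> F \<subseteq> A" for F
    have near: "dist (sum f F) (sum f K0) < e / 2" if "P F" for F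
    proof -
      have "sum f F - sum f K0 = sum f (F - K0)"
        using that K0(1,2) unfolding P_def by (simp add: sum_diff)
      then show ?thesis
        using K0'[rule_format, of "F - K0"] that unfolding P_def dist_norm by auto
    qed
    have "eventually P (finite_subsets_at_top A)"
      unfolding eventually_finite_subsets_at_top P_def using K0(1,2) by (intro exI[of _ K0]) auto
    moreover have "dist (sum f F) (sum f F') < e" if "P F" "P F'" for F F'
      by (rule dist_triangle_half_l[OF near[OF that(1)] near[OF that(2)]])
    ultimately show ?thesis by (intro exI[of _ P]) simp
  qed
  then have "cauchy_filter (filtermap (sum f) (finite_subsets_at_top A))"
    by (simp add: cauchy_filter_metric_filtermap)
  then obtain L' where "(sum f \<longlongrightarrow> L') (finite_subsets_at_top A)"
    using complete_UNIV complete_uniform[where S = "UNIV :: 'b set"] by (force simp add: filterlim_def)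
  then show ?thesis
    using summable_on_def has_sum_def by blast
qed

lemma summable_on_nonneg_small_tail:
  fixes f :: "'k \<Rightarrow> real"
  assumes "f summable_on A" "\<And>k. k \<in> A \<Longrightarrow> 0 \<le> f k" "e > 0"
  obtains K0 where "finite K0" "K0 \<subseteq> A"
    "\<And>K. finite K \<Longrightarrow> K \<subseteq> A \<Longrightarrow> K \<inter> K0 = {} \<Longrightarrow> sum f K < e"
proof -
  obtain K0 where K0: "finite K0" "K0 \<subseteq> A" "dist (sum f K0) (infsum f A) \<le> e / 2"
    using infsum_finite_approximation[OF assms(1), of "e / 2"] assms(3) by auto
  show ?thesis
  proof (rule that[OF K0(1,2)])
    fix K assume K: "finite K" "K \<subseteq> A" "K \<inter> K0 = {}"
    have "sum f K + sum f K0 = sum f (K \<union> K0)"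
      using K K0 by (simp add: sum.union_disjoint)
    also have "\<dots> \<le> infsum f A"
      using K K0 assms by (intro finite_sum_le_infsum) auto
    finally show "sum f K < e"
      using K0(3) assms(3) unfolding dist_real_def by arith
  qed
qed

lemma Cauchy_Schwarz_cmod_sum:
  fixes x y :: "'k \<Rightarrow> complex"
  shows "(cmod (\<Sum>k\<in>K. x k * y k))\<^sup>2 \<le> (\<Sum>k\<in>K. (cmod (x k))\<^sup>2) * (\<Sum>k\<in>K. (cmod (y k))\<^sup>2)"
proof -
  have "(cmod (\<Sum>k\<in>K. x k * y k))\<^sup>2 \<le> (\<Sum>k\<in>K. cmod (x k) * cmod (y k))\<^sup>2"
    by (intro power_mono order_trans[OF norm_sum]) (auto simp: norm_mult)
  also have "\<dots> \<le> (\<Sum>k\<in>K. (cmod (x k))\<^sup>2) * (\<Sum>k\<in>K. (cmod (y k))\<^sup>2)"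
    by (rule Cauchy_Schwarz_ineq_sum)
  finally show ?thesis .
qed

lemma Cauchy_Schwarz_has_sum:
  fixes x y :: "'k \<Rightarrow> complex"
  assumes s: "((\<lambda>k. x k * y k) has_sum s) A"
    and x: "(\<lambda>k. (cmod (x k))\<^sup>2) summable_on A" and y: "(\<lambda>k. (cmod (y k))\<^sup>2) summable_on A"
  shows "(cmod s)\<^sup>2 \<le> (\<Sum>\<^sub>\<infinity>k\<in>A. (cmod (x k))\<^sup>2) * (\<Sum>\<^sub>\<infinity>k\<in>A. (cmod (y k))\<^sup>2)"
proof (rule tendsto_upperbound)
  show "((\<lambda>K. (cmod (\<Sum>k\<in>K. x k * y k))\<^sup>2) \<longlongrightarrow> (cmod s)\<^sup>2) (finite_subsets_at_top A)"
    using s unfolding has_sum_def by (intro tendsto_intros)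
  show "\<forall>\<^sub>F K in finite_subsets_at_top A. (cmod (\<Sum>k\<in>K. x k * y k))\<^sup>2
      \<le> (\<Sum>\<^sub>\<infinity>k\<in>A. (cmod (x k))\<^sup>2) * (\<Sum>\<^sub>\<infinity>k\<in>A. (cmod (y k))\<^sup>2)"
  proof (rule eventually_finite_subsets_at_top_weakI)
    fix K assume K: "finite K" "K \<subseteq> A"
    have "(cmod (\<Sum>k\<in>K. x k * y k))\<^sup>2 \<le> (\<Sum>k\<in>K. (cmod (x k))\<^sup>2) * (\<Sum>k\<in>K. (cmod (y k))\<^sup>2)"
      by (rule Cauchy_Schwarz_cmod_sum)
    also have "\<dots> \<le> (\<Sum>\<^sub>\<infinity>k\<in>A. (cmod (x k))\<^sup>2) * (\<Sum>\<^sub>\<infinity>k\<in>A. (cmod (y k))\<^sup>2)"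
      using K by (intro mult_mono finite_sum_le_infsum x y infsum_nonneg sum_nonneg) auto
    finally show "(cmod (\<Sum>k\<in>K. x k * y k))\<^sup>2
      \<le> (\<Sum>\<^sub>\<infinity>k\<in>A. (cmod (x k))\<^sup>2) * (\<Sum>\<^sub>\<infinity>k\<in>A. (cmod (y k))\<^sup>2)" .
  qed
qed simp

section \<open>Frame inequalities and the frame operator\<close>

text \<open>Summability is demanded explicitly since \<open>infsum\<close> over a family that is not
  summable has the default value 0, which would satisfy the upper inequality vacuously. The
  constants are parameters because the later estimates are quantitative.\<close>

definition frame_bounds :: "'k set \<Rightarrow> real \<Rightarrow> real \<Rightarrow> ('k \<Rightarrow> 'd::finite l2) \<Rightarrow> bool" where
  "frame_bounds I A B \<Phi> \<longleftrightarrow> 0 < A \<and> A \<le> B \<and>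
     (\<forall>F. (\<lambda>k. (cmod (cinner F (\<Phi> k)))\<^sup>2) summable_on I \<and>
        A * (norm F)\<^sup>2 \<le> (\<Sum>\<^sub>\<infinity>k\<in>I. (cmod (cinner F (\<Phi> k)))\<^sup>2) \<and>
        (\<Sum>\<^sub>\<infinity>k\<in>I. (cmod (cinner F (\<Phi> k)))\<^sup>2) \<le> B * (norm F)\<^sup>2)"

lemma frame_inequalities_cls:
  assumes f: "f \<in> L2" and \<phi>: "\<And>k. k \<in> I \<Longrightarrow> \<phi> k \<in> L2" and "0 \<le> A" "0 \<le> B"
  defines "s \<equiv> (\<Sum>\<^sub>\<infinity>k\<in>I. ennreal ((cmod (L2_inner f (\<phi> k)))\<^sup>2))"
  defines "t k \<equiv> (cmod (cinner (cls f) (cls (\<phi> k))))\<^sup>2"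
  shows "ennreal A * (L2_norm f)\<^sup>2 \<le> s \<and> s \<le> ennreal B * (L2_norm f)\<^sup>2 \<longleftrightarrow>
    t summable_on I \<and> A * (norm (cls f))\<^sup>2 \<le> infsum t I \<and> infsum t I \<le> B * (norm (cls f))\<^sup>2"
proof -
  have s: "s = (\<Sum>\<^sub>\<infinity>k\<in>I. ennreal (t k))"
    unfolding s_def t_def using f \<phi> by (intro infsum_cong) (simp add: cinner_cls)
  have norm: "ennreal C * (L2_norm f)\<^sup>2 = ennreal (C * (norm (cls f))\<^sup>2)" if "0 \<le> C" for C
    using f that by (simp add: L2_norm_cls ennreal_mult ennreal_power)
  have t0: "0 \<le> t k" for k
    by (simp add: t_def)
  have st: "s = ennreal (infsum t I)" if "t summable_on I"
    unfolding s using that t0 by (intro infsum_ennreal_real)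
  have "0 \<le> infsum t I"
    using t0 by (intro infsum_nonneg)
  moreover have "t summable_on I" if "s \<le> ennreal (B * (norm (cls f))\<^sup>2)"
    using that unfolding s by (rule summable_on_if_infsum_ennreal_finite) (rule t0)
  ultimately show ?thesis
    using st assms(3,4) by (auto simp: norm)
qed

lemma is_frame_iff_frame_bounds:
  assumes \<phi>: "\<And>k. k \<in> I \<Longrightarrow> \<phi> k \<in> L2"
  shows "is_frame I \<phi> \<longleftrightarrow> (\<exists>A B. frame_bounds I A B (\<lambda>k. cls (\<phi> k)))"
proof -
  have "(\<forall>f\<in>L2. ennreal A * (L2_norm f)\<^sup>2 \<le> (\<Sum>\<^sub>\<infinity>k\<in>I. ennreal ((cmod (L2_inner f (\<phi> k)))\<^sup>2)) \<and>
      (\<Sum>\<^sub>\<infinity>k\<in>I. ennreal ((cmod (L2_inner f (\<phi> k)))\<^sup>2)) \<le> ennreal B * (L2_norm f)\<^sup>2) \<longleftrightarrow>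
    (\<forall>F. (\<lambda>k. (cmod (cinner F (cls (\<phi> k))))\<^sup>2) summable_on I \<and>
        A * (norm F)\<^sup>2 \<le> (\<Sum>\<^sub>\<infinity>k\<in>I. (cmod (cinner F (cls (\<phi> k))))\<^sup>2) \<and>
        (\<Sum>\<^sub>\<infinity>k\<in>I. (cmod (cinner F (cls (\<phi> k))))\<^sup>2) \<le> B * (norm F)\<^sup>2)" (is "?L \<longleftrightarrow> ?R")
    if "0 < A" "A \<le> B" for A B
  proof
    assume ?L
    then show ?R
      using frame_inequalities_cls[of "rep_l2 _" I \<phi> A B] \<phi> that by simp
  next
    assume ?R
    then show ?L
      using frame_inequalities_cls[of _ I \<phi> A B] \<phi> that by simp
  qed
  then show ?thesis
    unfolding is_frame_def frame_bounds_def using \<phi> by (intro iffI; elim conjE exE; blast)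
qed

text \<open>Duality: testing the finite combination \<open>F\<close> against itself gives
  \<open>|F|^2 = \<Sum> c k * <\<Phi> k, F>\<close>. Cauchy-Schwarz and the upper frame bound for
  \<open>F\<close> leave one factor \<open>|F|^2\<close> to cancel.\<close>

lemma synthesis_bound:
  assumes "frame_bounds UNIV A B \<Phi>" "finite K"
  shows "(norm (\<Sum>k\<in>K. c k *\<^sub>C \<Phi> k))\<^sup>2 \<le> B * (\<Sum>k\<in>K. (cmod (c k))\<^sup>2)"
proof (cases "(\<Sum>k\<in>K. c k *\<^sub>C \<Phi> k) = 0")
  case True
  then show ?thesis using assms unfolding frame_bounds_def by (auto intro!: mult_nonneg_nonneg sum_nonneg)
next
  case False
  define F where "F = (\<Sum>k\<in>K. c k *\<^sub>C \<Phi> k)"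
  have le: "(\<Sum>k\<in>K. (cmod (cinner F (\<Phi> k)))\<^sup>2) \<le> B * (norm F)\<^sup>2"
  proof -
    have "(\<Sum>k\<in>K. (cmod (cinner F (\<Phi> k)))\<^sup>2) \<le> (\<Sum>\<^sub>\<infinity>k. (cmod (cinner F (\<Phi> k)))\<^sup>2)"
      using assms unfolding frame_bounds_def by (intro finite_sum_le_infsum) auto
    also have "\<dots> \<le> B * (norm F)\<^sup>2"
      using assms unfolding frame_bounds_def by auto
    finally show ?thesis .
  qed
  have "((norm F)\<^sup>2)\<^sup>2 = (cmod (cinner F F))\<^sup>2"
    by (simp add: cinner_eq_norm norm_power)
  also have "cinner F F = (\<Sum>k\<in>K. c k * cinner (\<Phi> k) F)"
    by (subst F_def) (simp add: cinner.sum_left cinner_scaleC_left)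
  also have "(cmod \<dots>)\<^sup>2 \<le> (\<Sum>k\<in>K. (cmod (c k))\<^sup>2) * (\<Sum>k\<in>K. (cmod (cinner (\<Phi> k) F))\<^sup>2)"
    by (rule Cauchy_Schwarz_cmod_sum)
  also have "(\<Sum>k\<in>K. (cmod (cinner (\<Phi> k) F))\<^sup>2) = (\<Sum>k\<in>K. (cmod (cinner F (\<Phi> k)))\<^sup>2)"
    by (subst cinner_commute) simp
  also have "(\<Sum>k\<in>K. (cmod (c k))\<^sup>2) * \<dots> \<le> (\<Sum>k\<in>K. (cmod (c k))\<^sup>2) * (B * (norm F)\<^sup>2)"
    by (intro mult_left_mono le sum_nonneg) auto
  finally have "(norm F)\<^sup>2 * (norm F)\<^sup>2 \<le> (B * (\<Sum>k\<in>K. (cmod (c k))\<^sup>2)) * (norm F)\<^sup>2"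
    by (simp add: power2_eq_square mult_ac)
  moreover have "0 < (norm F)\<^sup>2"
    using False by (simp add: F_def)
  ultimately show ?thesis
    unfolding F_def[symmetric] by (rule mult_right_le_imp_le)
qed

lemma synthesis_summable:
  assumes fr: "frame_bounds UNIV A B \<Phi>" and c: "(\<lambda>k. (cmod (c k))\<^sup>2) summable_on UNIV"
  shows "(\<lambda>k. c k *\<^sub>C \<Phi> k) summable_on UNIV"
proof (rule summable_onI_Cauchy)
  fix e :: real assume e: "e > 0"
  have B: "0 < B" using fr unfolding frame_bounds_def by auto
  \<comment> \<open>The threshold is chosen so that \<open>synthesis_bound\<close>, with its factor
    \<open>B\<close>, returns \<open>e\<^sup>2\<close>.\<close>
  obtain K0 where K0: "finite K0"
    "\<And>K. finite K \<Longrightarrow> K \<inter> K0 = {} \<Longrightarrow> (\<Sum>k\<in>K. (cmod (c k))\<^sup>2) < e\<^sup>2 / B"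
    using summable_on_nonneg_small_tail[OF c, of "e\<^sup>2 / B"] e B by auto
  have "norm (\<Sum>k\<in>K. c k *\<^sub>C \<Phi> k) < e" if K: "finite K" "K \<inter> K0 = {}" for K
  proof -
    have "(norm (\<Sum>k\<in>K. c k *\<^sub>C \<Phi> k))\<^sup>2 \<le> B * (\<Sum>k\<in>K. (cmod (c k))\<^sup>2)"
      using synthesis_bound[OF fr K(1)] .
    also have "\<dots> < e\<^sup>2"
      using K0(2)[OF K] B by (simp add: pos_less_divide_eq mult.commute)
    finally show ?thesis
      using power2_less_imp_less[of "norm (\<Sum>k\<in>K. c k *\<^sub>C \<Phi> k)" e] e by simp
  qed
  then show "\<exists>K0. finite K0 \<and> K0 \<subseteq> UNIV \<and>
      (\<forall>K. finite K \<and> K \<subseteq> UNIV \<and> K \<inter> K0 = {} \<longrightarrow> norm (\<Sum>k\<in>K. c k *\<^sub>C \<Phi> k) < e)"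
    using K0(1) by (intro exI[of _ K0]) simp
qed

definition frame_op :: "('k \<Rightarrow> 'd::finite l2) \<Rightarrow> 'd l2 \<Rightarrow> 'd l2" where
  "frame_op \<Phi> F = (\<Sum>\<^sub>\<infinity>k. cinner F (\<Phi> k) *\<^sub>C \<Phi> k)"

lemma has_sum_frame_op:
  assumes "frame_bounds UNIV A B \<Phi>"
  shows "((\<lambda>k. cinner F (\<Phi> k) *\<^sub>C \<Phi> k) has_sum frame_op \<Phi> F) UNIV"
  unfolding frame_op_def
  by (rule has_sum_infsum, rule synthesis_summable[OF assms])
     (use assms in \<open>auto simp: frame_bounds_def\<close>)

lemma has_sum_cinner_frame_op:
  assumes "frame_bounds UNIV A B \<Phi>"
  shows "((\<lambda>k. cinner F (\<Phi> k) * cinner (\<Phi> k) U) has_sum cinner (frame_op \<Phi> F) U) UNIV"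
  using has_sum_bounded_linear[OF cinner.bounded_linear_left has_sum_frame_op[OF assms]]
  by (simp add: cinner_scaleC_left)

text \<open>Self-adjointness: conjugating the series for the right-hand side reproduces the series
  for the left-hand side.\<close>

lemma cinner_frame_op_left:
  assumes "frame_bounds UNIV A B \<Phi>"
  shows "cinner (frame_op \<Phi> F) U = cinner F (frame_op \<Phi> U)"
proof (rule has_sum_unique)
  show "((\<lambda>k. cinner F (\<Phi> k) * cinner (\<Phi> k) U) has_sum cinner (frame_op \<Phi> F) U) UNIV"
    by (rule has_sum_cinner_frame_op[OF assms])
  have "((\<lambda>k. cnj (cinner U (\<Phi> k) * cinner (\<Phi> k) F)) has_sum cnj (cinner (frame_op \<Phi> U) F)) UNIV"
    unfolding has_sum_cnj_iff by (rule has_sum_cinner_frame_op[OF assms])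
  then show "((\<lambda>k. cinner F (\<Phi> k) * cinner (\<Phi> k) U) has_sum cinner F (frame_op \<Phi> U)) UNIV"
    by (simp add: cinner_commute[symmetric] mult.commute)
qed

lemma cinner_frame_op_self:
  assumes "frame_bounds UNIV A B \<Phi>"
  shows "cinner (frame_op \<Phi> F) F = complex_of_real (\<Sum>\<^sub>\<infinity>k. (cmod (cinner F (\<Phi> k)))\<^sup>2)"
proof (rule has_sum_unique)
  show "((\<lambda>k. complex_of_real ((cmod (cinner F (\<Phi> k)))\<^sup>2)) has_sum cinner (frame_op \<Phi> F) F) UNIV"
    using has_sum_cinner_frame_op[OF assms, of F F]
    unfolding complex_norm_square cinner_commute[of "\<Phi> _" F] .
  show "((\<lambda>k. complex_of_real ((cmod (cinner F (\<Phi> k)))\<^sup>2)) has_sum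
      complex_of_real (\<Sum>\<^sub>\<infinity>k. (cmod (cinner F (\<Phi> k)))\<^sup>2)) UNIV"
    using assms unfolding frame_bounds_def by (intro has_sum_of_real has_sum_infsum) auto
qed

text \<open>The synthesis bound with the frame coefficients themselves, whose square sum is
  \<open><S F, F>\<close>, passed to the limit over finite sets. The quadratic form on the right is
  what the contraction argument for inverting \<open>S\<close> needs.\<close>

lemma norm_frame_op_le:
  assumes fr: "frame_bounds UNIV A B \<Phi>"
  shows "(norm (frame_op \<Phi> F))\<^sup>2 \<le> B * inner (frame_op \<Phi> F) F"
proof (rule tendsto_upperbound)
  show "((\<lambda>K. (norm (\<Sum>k\<in>K. cinner F (\<Phi> k) *\<^sub>C \<Phi> k))\<^sup>2) \<longlongrightarrow> (norm (frame_op \<Phi> F))\<^sup>2)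
      (finite_subsets_at_top UNIV)"
    using has_sum_frame_op[OF fr, of F] unfolding has_sum_def by (intro tendsto_intros)
  show "\<forall>\<^sub>F K in finite_subsets_at_top UNIV. (norm (\<Sum>k\<in>K. cinner F (\<Phi> k) *\<^sub>C \<Phi> k))\<^sup>2
      \<le> B * inner (frame_op \<Phi> F) F"
  proof (rule eventually_finite_subsets_at_top_weakI)
    fix K :: "'a set" assume K: "finite K"
    have B: "0 \<le> B" using fr unfolding frame_bounds_def by auto
    have "(norm (\<Sum>k\<in>K. cinner F (\<Phi> k) *\<^sub>C \<Phi> k))\<^sup>2 \<le> B * (\<Sum>k\<in>K. (cmod (cinner F (\<Phi> k)))\<^sup>2)"
      by (rule synthesis_bound[OF fr K])
    also have "\<dots> \<le> B * (\<Sum>\<^sub>\<infinity>k. (cmod (cinner F (\<Phi> k)))\<^sup>2)"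
      using fr K B unfolding frame_bounds_def by (intro mult_left_mono finite_sum_le_infsum) auto
    also have "\<dots> = B * inner (frame_op \<Phi> F) F"
      by (simp add: inner_l2_def cinner_frame_op_self[OF fr])
    finally show "(norm (\<Sum>k\<in>K. cinner F (\<Phi> k) *\<^sub>C \<Phi> k))\<^sup>2 \<le> B * inner (frame_op \<Phi> F) F" .
  qed
qed simp

lemma frame_op_diff:
  assumes "frame_bounds UNIV A B \<Phi>"
  shows "frame_op \<Phi> (F - H) = frame_op \<Phi> F - frame_op \<Phi> H"
proof -
  have "((\<lambda>k. cinner F (\<Phi> k) *\<^sub>C \<Phi> k + - (cinner H (\<Phi> k) *\<^sub>C \<Phi> k)) has_sum frame_op \<Phi> F + - frame_op \<Phi> H) UNIV"
    by (intro has_sum_add has_sum_uminus[THEN iffD2]) (simp_all add: has_sum_frame_op[OF assms])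
  then have "((\<lambda>k. cinner (F - H) (\<Phi> k) *\<^sub>C \<Phi> k) has_sum frame_op \<Phi> F - frame_op \<Phi> H) UNIV"
    by (simp add: cinner.diff_left linear_diff[OF bounded_linear.linear[OF bounded_linear_scaleC_left]])
  with has_sum_frame_op[OF assms] show ?thesis
    by (rule has_sum_unique)
qed

text \<open>The map \<open>F \<mapsto> F + (U - S F) / B\<close> is a contraction, since
  \<open>\<parallel>E - S E / B\<parallel>\<^sup>2 \<le> \<parallel>E\<parallel>\<^sup>2 - \<langle>S E, E\<rangle> / B\<close> by \<open>norm_frame_op_le\<close>.\<close>

lemma frame_op_surj:
  assumes fr: "frame_bounds UNIV A B \<Phi>"
  obtains F where "frame_op \<Phi> F = U"
proof -
  have AB: "0 < A" "A \<le> B" "0 < B" using fr unfolding frame_bounds_def by auto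
  define T where "T F = F + (1 / B) *\<^sub>R (U - frame_op \<Phi> F)" for F
  \<comment> \<open>The lower bound \<open><S E, E> \<ge> A |E|^2\<close> leaves the factor
    \<open>1 - A / B\<close> in the squared norm; \<open>A \<le> B\<close> keeps it nonnegative and
    \<open>A > 0\<close> keeps it below 1.\<close>
  define q where "q = sqrt (1 - A / B)"
  have q: "0 \<le> q" "q < 1" "q\<^sup>2 = 1 - A / B" using AB by (auto simp: q_def)
  have contr: "norm (E - (1 / B) *\<^sub>R frame_op \<Phi> E) \<le> q * norm E" for E
  proof -
    have expand: "(norm (E - c *\<^sub>R X))\<^sup>2 = (norm E)\<^sup>2 - 2 * c * inner X E + c\<^sup>2 * (norm X)\<^sup>2" for c X
      by (simp add: power2_norm_eq_inner inner_diff_left inner_diff_right inner_commute[of E X]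
          power2_eq_square[of c] algebra_simps)
    have "(norm (E - (1 / B) *\<^sub>R frame_op \<Phi> E))\<^sup>2
        = (norm E)\<^sup>2 - 2 * (1 / B) * inner (frame_op \<Phi> E) E + (1 / B)\<^sup>2 * (norm (frame_op \<Phi> E))\<^sup>2"
      by (simp only: expand)
    also have "\<dots> \<le> (norm E)\<^sup>2 - 2 * (1 / B) * inner (frame_op \<Phi> E) E + (1 / B)\<^sup>2 * (B * inner (frame_op \<Phi> E) E)"
      using norm_frame_op_le[OF fr, of E] by (intro add_left_mono mult_left_mono) auto
    also have "\<dots> = (norm E)\<^sup>2 - (1 / B) * inner (frame_op \<Phi> E) E"
      using AB by (simp add: power2_eq_square field_simps)
    also have "\<dots> \<le> (norm E)\<^sup>2 - (1 / B) * (A * (norm E)\<^sup>2)"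
      using fr AB unfolding frame_bounds_def inner_l2_def cinner_frame_op_self[OF fr]
      by (intro diff_left_mono mult_left_mono) auto
    also have "\<dots> = (q * norm E)\<^sup>2"
      by (simp add: power_mult_distrib q(3) algebra_simps)
    finally show ?thesis
      by (rule power2_le_imp_le) (use q in simp)
  qed
  have "\<forall>F H. dist (T F) (T H) \<le> q * dist F H"
  proof (intro allI)
    fix F H
    have "T F - T H = (F - H) - (1 / B) *\<^sub>R frame_op \<Phi> (F - H)"
      by (simp add: T_def frame_op_diff[OF fr] algebra_simps)
    then show "dist (T F) (T H) \<le> q * dist F H"
      using contr[of "F - H"] by (simp add: dist_norm)
  qed
  then obtain F where "T F = F"
    using banach_fix_type[OF q(1,2)] by blast
  then show ?thesis
    using AB by (intro that[of F]) (simp add: T_def)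
qed

text \<open>With \<open>a\<^sub>k = \<langle>\<Phi>\<^sub>k, D\<rangle>\<close> one has \<open>(1 - a\<^sub>j) \<langle>F, \<Phi>\<^sub>j\<rangle> = \<Sum>\<^sub>k\<^sub>\<noteq>\<^sub>j \<langle>F, \<Phi>\<^sub>k\<rangle> a\<^sub>k\<close>; if \<open>a\<^sub>j \<noteq> 1\<close>, the element
  \<open>\<Phi>\<^sub>j\<close> is redundant in the lower frame inequality. Then
  \<open>\<Sum>\<^sub>k \<bar>a\<^sub>k\<bar>\<^sup>2 = \<langle>S D, D\<rangle> = a\<^sub>j = 1\<close> leaves no room for the other coefficients.\<close>

lemma exact_frame_biorthogonal:
  assumes fr: "frame_bounds UNIV A B \<Phi>"
    and ex: "\<not> (\<exists>A B. frame_bounds (UNIV - {j}) A B \<Phi>)"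
    and D: "frame_op \<Phi> D = \<Phi> j"
  shows "cinner (\<Phi> k) D = (if k = j then 1 else 0)"
proof -
  define a where "a k = cinner (\<Phi> k) D" for k
  have cmod_a: "cmod (a k) = cmod (cinner D (\<Phi> k))" for k
    unfolding a_def by (subst cinner_commute) simp
  have summ: "(\<lambda>k. (cmod (cinner F (\<Phi> k)))\<^sup>2) summable_on UNIV" for F
    using fr unfolding frame_bounds_def by blast
  have summ': "(\<lambda>k. (cmod (cinner F (\<Phi> k)))\<^sup>2) summable_on UNIV - {j}" for F
    by (rule summable_on_subset_banach[OF summ]) auto
  have a_summ: "(\<lambda>k. (cmod (a k))\<^sup>2) summable_on UNIV - {j}"
    using summ'[of D] by (simp add: cmod_a)
  define s where "s F = (\<Sum>\<^sub>\<infinity>k\<in>UNIV - {j}. (cmod (cinner F (\<Phi> k)))\<^sup>2)" for F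
  define C where "C = (\<Sum>\<^sub>\<infinity>k\<in>UNIV - {j}. (cmod (a k))\<^sup>2)"
  have C0: "0 \<le> C" unfolding C_def by (intro infsum_nonneg) auto
  have s0: "0 \<le> s F" for F unfolding s_def by (intro infsum_nonneg) auto
  have split: "(\<Sum>\<^sub>\<infinity>k. (cmod (cinner F (\<Phi> k)))\<^sup>2) = (cmod (cinner F (\<Phi> j)))\<^sup>2 + s F" for F
    unfolding s_def using infsum_insert[OF summ', of j] by (simp add: insert_absorb)
  have aj: "a j = 1"
  proof (rule ccontr)
    assume "a j \<noteq> 1"
    define M where "M = C / (cmod (1 - a j))\<^sup>2"
    have M0: "0 \<le> M" using C0 by (simp add: M_def)
    have bound: "(cmod (cinner F (\<Phi> j)))\<^sup>2 \<le> s F * M" for F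
    proof -
      have "((\<lambda>k. cinner F (\<Phi> k) * a k) has_sum cinner (frame_op \<Phi> F) D) UNIV"
        unfolding a_def by (rule has_sum_cinner_frame_op[OF fr])
      then have "((\<lambda>k. cinner F (\<Phi> k) * a k) has_sum cinner F (\<Phi> j)) UNIV"
        by (simp add: cinner_frame_op_left[OF fr] D)
      then have "((\<lambda>k. cinner F (\<Phi> k) * a k) has_sum
          cinner F (\<Phi> j) - cinner F (\<Phi> j) * a j) (UNIV - {j})"
        by (rule has_sum_Diff[OF _ has_sum_finiteI]) auto
      from Cauchy_Schwarz_has_sum[OF this summ' a_summ]
      have "(cmod (cinner F (\<Phi> j) * (1 - a j)))\<^sup>2 \<le> s F * C"
        by (simp add: s_def C_def right_diff_distrib)
      then have "(cmod (cinner F (\<Phi> j)))\<^sup>2 * (cmod (1 - a j))\<^sup>2 \<le> s F * C"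
        by (simp only: norm_mult power_mult_distrib)
      then show ?thesis
        using \<open>a j \<noteq> 1\<close> by (simp add: M_def pos_le_divide_eq)
    qed
    \<comment> \<open>By \<open>bound\<close> the full square sum is at most \<open>1 + M\<close>
      times the one without \<open>j\<close>, so the lower constant only drops to
      \<open>A / (1 + M)\<close>.\<close>
    have "frame_bounds (UNIV - {j}) (A / (1 + M)) B \<Phi>"
      unfolding frame_bounds_def
    proof (intro conjI allI)
      show "0 < A / (1 + M)" using fr M0 unfolding frame_bounds_def by simp
      have "A / (1 + M) \<le> A / 1"
        using fr M0 unfolding frame_bounds_def by (intro divide_left_mono) auto
      then show "A / (1 + M) \<le> B" using fr unfolding frame_bounds_def by simp
      fix F
      show "(\<lambda>k. (cmod (cinner F (\<Phi> k)))\<^sup>2) summable_on UNIV - {j}" by (rule summ')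
      have "A * (norm F)\<^sup>2 \<le> (cmod (cinner F (\<Phi> j)))\<^sup>2 + s F"
        using fr split[of F] unfolding frame_bounds_def by metis
      also have "\<dots> \<le> s F * (1 + M)" using bound[of F] by (simp add: algebra_simps)
      finally show "A / (1 + M) * (norm F)\<^sup>2 \<le> (\<Sum>\<^sub>\<infinity>k\<in>UNIV - {j}. (cmod (cinner F (\<Phi> k)))\<^sup>2)"
        unfolding s_def[symmetric] using M0 by (simp add: field_simps)
      have "s F \<le> (\<Sum>\<^sub>\<infinity>k. (cmod (cinner F (\<Phi> k)))\<^sup>2)" by (simp add: split)
      also have "\<dots> \<le> B * (norm F)\<^sup>2" using fr unfolding frame_bounds_def by blast
      finally show "(\<Sum>\<^sub>\<infinity>k\<in>UNIV - {j}. (cmod (cinner F (\<Phi> k)))\<^sup>2) \<le> B * (norm F)\<^sup>2"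
        unfolding s_def .
    qed
    with ex show False by blast
  qed
  have "complex_of_real (\<Sum>\<^sub>\<infinity>k. (cmod (cinner D (\<Phi> k)))\<^sup>2) = a j"
    unfolding cinner_frame_op_self[OF fr, symmetric] by (simp add: D a_def)
  then have "(cmod (a j))\<^sup>2 + C = 1"
    unfolding split using aj by (simp add: s_def C_def cmod_a complex_eq_iff)
  then have "C = 0" using aj by simp
  then have "(cmod (a k))\<^sup>2 = 0" if "k \<noteq> j" for k
    using nonneg_infsum_le_0D[of "\<lambda>k. (cmod (a k))\<^sup>2" "UNIV - {j}" k] a_summ that
    unfolding C_def by auto
  then show ?thesis using aj by (auto simp: a_def)
qed

section \<open>Expansions in the dual frame\<close>

text \<open>The lower frame inequality bounds the quadratic form of \<open>S\<close> below, and
  Cauchy-Schwarz bounds it above; the inverse of \<open>S\<close> thus has norm at most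
  \<open>1 / A\<close>.\<close>

lemma inverse_frame_op_bound:
  assumes fr: "frame_bounds UNIV A B \<Phi>"
  shows "A * norm Z \<le> norm (frame_op \<Phi> Z)"
proof (cases "Z = 0")
  case False
  have "A * (norm Z)\<^sup>2 \<le> inner (frame_op \<Phi> Z) Z"
    using fr unfolding frame_bounds_def inner_l2_def cinner_frame_op_self[OF fr] by auto
  also have "\<dots> \<le> norm (frame_op \<Phi> Z) * norm Z" by (rule norm_cauchy_schwarz)
  finally show ?thesis using False by (simp add: power2_eq_square mult.assoc[symmetric])
qed simp

text \<open>Writing \<open>F = S Z\<close>, self-adjointness turns the coefficient of
  \<open>F\<close> against \<open>\<Psi> k\<close> into that of \<open>Z\<close> against
  \<open>\<Phi> k\<close>. All three claims become facts about the frame \<open>\<Phi>\<close> at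
  \<open>Z\<close>; the square sum is \<open><F, Z>\<close>, and \<open>|Z| \<le> |F| / A\<close>
  gives the constant.\<close>

lemma dual_frame_expansion:
  assumes fr: "frame_bounds UNIV A B \<Phi>" and \<Psi>: "\<And>k. frame_op \<Phi> (\<Psi> k) = \<Phi> k"
  shows "((\<lambda>k. cinner F (\<Psi> k) * cinner (\<Phi> k) U) has_sum cinner F U) UNIV"
    and "(\<lambda>k. (cmod (cinner F (\<Psi> k)))\<^sup>2) summable_on UNIV"
    and "(\<Sum>\<^sub>\<infinity>k. (cmod (cinner F (\<Psi> k)))\<^sup>2) \<le> (norm F)\<^sup>2 / A"
proof -
  obtain Z where Z: "frame_op \<Phi> Z = F" using frame_op_surj[OF fr] .
  have eq: "cinner F (\<Psi> k) = cinner Z (\<Phi> k)" for k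
    unfolding Z[symmetric] cinner_frame_op_left[OF fr] \<Psi> ..
  show "((\<lambda>k. cinner F (\<Psi> k) * cinner (\<Phi> k) U) has_sum cinner F U) UNIV"
    unfolding eq using has_sum_cinner_frame_op[OF fr, of Z U] by (simp add: Z)
  show "(\<lambda>k. (cmod (cinner F (\<Psi> k)))\<^sup>2) summable_on UNIV"
    unfolding eq using fr unfolding frame_bounds_def by blast
  have A: "0 < A" using fr unfolding frame_bounds_def by blast
  have "inner F Z = (\<Sum>\<^sub>\<infinity>k. (cmod (cinner Z (\<Phi> k)))\<^sup>2)"
    unfolding inner_l2_def Z[symmetric] cinner_frame_op_self[OF fr] by simp
  then have "(\<Sum>\<^sub>\<infinity>k. (cmod (cinner F (\<Psi> k)))\<^sup>2) = inner F Z"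
    by (simp only: eq)
  also have "\<dots> \<le> norm F * norm Z" by (rule norm_cauchy_schwarz)
  also have "\<dots> \<le> norm F * (norm F / A)"
    using inverse_frame_op_bound[OF fr, of Z] A Z
    by (intro mult_left_mono) (auto simp: field_simps)
  finally show "(\<Sum>\<^sub>\<infinity>k. (cmod (cinner F (\<Psi> k)))\<^sup>2) \<le> (norm F)\<^sup>2 / A"
    by (simp add: power2_eq_square)
qed

subsection \<open>Continuity of translations\<close>

text \<open>Dominated convergence applied to \<open>|s n - f|^2\<close>, with majorant
  \<open>2 C^2 |h|^2 + 2 |f|^2\<close>. It serves both the approximation by simple functions and the
  truncation to balls.\<close>

lemma cls_tendsto_dominated:
  assumes f: "f \<in> L2" and h: "h \<in> L2" and s: "\<And>n. s n \<in> borel_measurable lebesgue"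
    and bound: "\<And>n. AE x in lebesgue. cmod (s n x) \<le> C * cmod (h x)"
    and lim: "AE x in lebesgue. (\<lambda>n. s n x) \<longlonglongrightarrow> f x"
  shows "s n \<in> L2" and "(\<lambda>n. cls (s n)) \<longlonglongrightarrow> cls f"
proof -
  show sL2: "s n \<in> L2" for n
    using L2_bound[OF h s bound] .
  note [measurable] = s L2_measurable[OF f] L2_measurable[OF h]
  have "(\<lambda>n. LINT x|lebesgue. (cmod (s n x - f x))\<^sup>2) \<longlonglongrightarrow> (LINT x::real^'a|lebesgue. 0)"
  proof (rule integral_dominated_convergence[where w = "\<lambda>x. 2 * C\<^sup>2 * (cmod (h x))\<^sup>2 + 2 * (cmod (f x))\<^sup>2"])
    show "integrable lebesgue (\<lambda>x. 2 * C\<^sup>2 * (cmod (h x))\<^sup>2 + 2 * (cmod (f x))\<^sup>2)"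
      using f h by (intro Bochner_Integration.integrable_add integrable_mult_right L2_square_integrable)
    show "AE x in lebesgue. (\<lambda>n. (cmod (s n x - f x))\<^sup>2) \<longlonglongrightarrow> 0"
      using lim
    proof eventually_elim
      case (elim x)
      then have "(\<lambda>n. (cmod (s n x - f x))\<^sup>2) \<longlonglongrightarrow> (cmod (f x - f x))\<^sup>2"
        by (intro tendsto_intros)
      then show ?case by simp
    qed
    show "AE x in lebesgue. norm ((cmod (s n x - f x))\<^sup>2) \<le> 2 * C\<^sup>2 * (cmod (h x))\<^sup>2 + 2 * (cmod (f x))\<^sup>2" for n
      using bound[of n]
    proof eventually_elim
      case (elim x)
      have "(cmod (s n x - f x))\<^sup>2 \<le> (cmod (s n x) + cmod (f x))\<^sup>2"
        by (intro power_mono norm_triangle_ineq4) simp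
      also have "\<dots> \<le> 2 * (cmod (s n x))\<^sup>2 + 2 * (cmod (f x))\<^sup>2"
        using sum_squares_bound[of "cmod (s n x)" "cmod (f x)"] by (simp add: power2_sum)
      also have "(cmod (s n x))\<^sup>2 \<le> (C * cmod (h x))\<^sup>2"
        using elim by (intro power_mono) auto
      finally show ?case by (simp add: power_mult_distrib)
    qed
  qed measurable
  then have "(\<lambda>n. (norm (cls (s n) - cls f))\<^sup>2) \<longlonglongrightarrow> 0"
    using sL2 f by (simp add: norm_cls_square[symmetric] L2_diff cls_diff)
  then have "(\<lambda>n. sqrt ((norm (cls (s n) - cls f))\<^sup>2)) \<longlonglongrightarrow> sqrt 0"
    by (rule tendsto_real_sqrt)
  then show "(\<lambda>n. cls (s n)) \<longlonglongrightarrow> cls f"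
    by (simp add: tendsto_norm_zero_iff LIM_zero_iff)
qed

text \<open>Made a predicate so that the good \<open>F\<close> can be seen to form a closed
  subspace; once it contains the square integrable indicators, it is everything.\<close>

definition shift_cont :: "'d::finite l2 \<Rightarrow> bool" where
  "shift_cont F \<longleftrightarrow> (\<forall>X. X \<longlonglongrightarrow> 0 \<longrightarrow> (\<lambda>n. shift (X n) F) \<longlonglongrightarrow> F)"

lemma shift_cont_add: "shift_cont F \<Longrightarrow> shift_cont H \<Longrightarrow> shift_cont (F + H)"
  unfolding shift_cont_def by (auto simp: shift_add intro: tendsto_add)

lemma shift_cont_scaleC: "shift_cont F \<Longrightarrow> shift_cont (c *\<^sub>C F)"
  unfolding shift_cont_def
  by (auto simp: shift_scaleC intro: bounded_linear.tendsto[OF bounded_linear_scaleC])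

lemma shift_cont_0: "shift_cont 0"
  unfolding shift_cont_def
  by (simp add: linear_0[OF bounded_linear.linear[OF bounded_linear_shift]])

lemma shift_cont_sum: "finite K \<Longrightarrow> (\<And>k. k \<in> K \<Longrightarrow> shift_cont (F k)) \<Longrightarrow> shift_cont (sum F K)"
  by (induction K rule: finite_induct) (auto intro: shift_cont_0 shift_cont_add)

text \<open>Three-epsilon argument; since translations are isometries, replacing \<open>F\<close> by
  \<open>H\<close> costs the same for every shift.\<close>

lemma shift_cont_lim:
  assumes H: "\<And>e. e > 0 \<Longrightarrow> \<exists>H. shift_cont H \<and> norm (H - F) < e"
  shows "shift_cont F"
  unfolding shift_cont_def
proof (intro allI impI LIMSEQ_I)
  fix X :: "nat \<Rightarrow> real ^ 'a" and r :: real
  assume X: "X \<longlonglongrightarrow> 0" and r: "0 < r"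
  obtain H where H: "shift_cont H" "norm (H - F) < r / 3"
    using assms[of "r / 3"] r by auto
  then obtain N where N: "\<And>n. n \<ge> N \<Longrightarrow> norm (shift (X n) H - H) < r / 3"
    using X r LIMSEQ_D[of "\<lambda>n. shift (X n) H" H "r / 3"] unfolding shift_cont_def by auto
  have "norm (shift (X n) F - F) < r" if "n \<ge> N" for n
  proof -
    have "shift (X n) F - F = - shift (X n) (H - F) + (shift (X n) H - H) + (H - F)"
      by (simp add: linear_diff[OF bounded_linear.linear[OF bounded_linear_shift]])
    also have "norm \<dots> \<le> norm (shift (X n) (H - F)) + norm (shift (X n) H - H) + norm (H - F)"
      by (metis (no_types) add_mono norm_minus_cancel norm_triangle_ineq norm_triangle_mono order_refl)
    finally show ?thesis
      using N[OF that] H(2) by simp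
  qed
  then show "\<exists>N. \<forall>n\<ge>N. norm (shift (X n) F - F) < r" by blast
qed

text \<open>As translations preserve the norm, \<open>|T F - F|^2 = 2 |F|^2 - 2 Re <T F, F>\<close>,
  so convergence of a single inner product forces convergence in norm.\<close>

lemma shift_cont_if_weakly:
  assumes "\<And>X. X \<longlonglongrightarrow> 0 \<Longrightarrow> (\<lambda>n. cinner (shift (X n) F) F) \<longlonglongrightarrow> cinner F F"
  shows "shift_cont F"
  unfolding shift_cont_def
proof (intro allI impI)
  fix X :: "nat \<Rightarrow> real ^ 'a" assume "X \<longlonglongrightarrow> 0"
  then have "(\<lambda>n. Re (cinner (shift (X n) F) F)) \<longlonglongrightarrow> Re (cinner F F)"
    by (intro tendsto_Re assms)
  then have "(\<lambda>n. inner (shift (X n) F) F) \<longlonglongrightarrow> (norm F)\<^sup>2"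
    unfolding inner_l2_def[symmetric] power2_norm_eq_inner .
  then have "(\<lambda>n. (norm F)\<^sup>2 - 2 * inner (shift (X n) F) F + (norm F)\<^sup>2) \<longlonglongrightarrow> (norm F)\<^sup>2 - 2 * (norm F)\<^sup>2 + (norm F)\<^sup>2"
    by (intro tendsto_intros)
  moreover have "(norm F)\<^sup>2 - 2 * inner (shift (X n) F) F + (norm F)\<^sup>2 = (norm (shift (X n) F - F))\<^sup>2" for n
  proof -
    have "(norm (G - F))\<^sup>2 = (norm G)\<^sup>2 - 2 * inner G F + (norm F)\<^sup>2" for G
      by (simp add: power2_norm_eq_inner inner_diff_left inner_diff_right inner_commute[of F G])
    then show ?thesis by simp
  qed
  ultimately have "(\<lambda>n. (norm (shift (X n) F - F))\<^sup>2) \<longlonglongrightarrow> 0" by simp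
  then have "(\<lambda>n. sqrt ((norm (shift (X n) F - F))\<^sup>2)) \<longlonglongrightarrow> sqrt 0"
    by (rule tendsto_real_sqrt)
  then show "(\<lambda>n. shift (X n) F) \<longlonglongrightarrow> F"
    by (simp add: tendsto_norm_zero_iff LIM_zero_iff)
qed

text \<open>For open \<open>T\<close> and \<open>x \<in> T\<close>, the indicator of \<open>T\<close> at \<open>x - a\<close> is eventually \<open>1\<close> as \<open>a \<rightarrow> 0\<close>, so weak
  convergence needs no compactness.\<close>

lemma shift_cont_open:
  fixes T :: "(real ^ 'd) set"
  assumes T: "open T" "(indicator T :: _ \<Rightarrow> complex) \<in> L2"
  shows "shift_cont (cls (indicator T))"
proof (rule shift_cont_if_weakly)
  fix X :: "nat \<Rightarrow> real ^ 'd" assume X: "X \<longlonglongrightarrow> 0"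
  have *: "(\<lambda>x. indicator T (x - a) :: complex) \<in> L2" for a
    using L2_shift[OF T(2)] .
  have "(\<lambda>n. LINT x|lebesgue. indicator T (x - X n) * cnj (indicator T x))
      \<longlonglongrightarrow> (LINT x|lebesgue. (indicator T x :: complex) * cnj (indicator T x))"
  proof (rule integral_dominated_convergence[where w = "\<lambda>x. (cmod (indicator T x))\<^sup>2"])
    show "integrable lebesgue (\<lambda>x. (cmod (indicator T x))\<^sup>2)"
      using L2_square_integrable[OF T(2)] .
    show "AE x in lebesgue. (\<lambda>n. indicator T (x - X n) * cnj (indicator T x))
        \<longlonglongrightarrow> (indicator T x :: complex) * cnj (indicator T x)"
    proof (rule AE_I2)
      fix x
      show "(\<lambda>n. indicator T (x - X n) * cnj (indicator T x)) \<longlonglongrightarrow> (indicator T x :: complex) * cnj (indicator T x)"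
      proof (cases "x \<in> T")
        case True
        have "(\<lambda>n. x - X n) \<longlonglongrightarrow> x - 0" using X by (intro tendsto_intros)
        then have "\<forall>\<^sub>F n in sequentially. x - X n \<in> T"
          using topological_tendstoD[OF _ T(1)] True by simp
        then have "\<forall>\<^sub>F n in sequentially. indicator T (x - X n) * cnj (indicator T x)
            = (indicator T x :: complex) * cnj (indicator T x)"
          by eventually_elim (simp add: True)
        then show ?thesis by (rule tendsto_eventually)
      qed simp
    qed
    show "AE x in lebesgue. norm (indicator T (x - X n) * cnj (indicator T x) :: complex)
        \<le> (cmod (indicator T x))\<^sup>2" for n
      by (auto simp: indicator_def)
    show "(\<lambda>x. (indicator T x :: complex) * cnj (indicator T x)) \<in> borel_measurable lebesgue"
      using borel_measurable_integrable[OF L2_inner_integrable[OF T(2) T(2)]] .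
    show "(\<lambda>x. indicator T (x - X n) * cnj (indicator T x) :: complex) \<in> borel_measurable lebesgue" for n
      using borel_measurable_integrable[OF L2_inner_integrable[OF * T(2)]] .
  qed
  then show "(\<lambda>n. cinner (shift (X n) (cls (indicator T))) (cls (indicator T)))
      \<longlonglongrightarrow> cinner (cls (indicator T)) (cls (indicator T))"
    using T(2) * by (simp add: shift_cls cinner_cls L2_inner_def)
qed

text \<open>Outer regularity reduces a measurable set to an open one.\<close>

lemma shift_cont_indicator:
  fixes E :: "(real ^ 'd) set"
  assumes E: "E \<in> sets lebesgue" "(indicator E :: _ \<Rightarrow> complex) \<in> L2"
  shows "shift_cont (cls (indicator E))"
proof (rule shift_cont_lim)
  fix e :: real assume e: "e > 0"
  \<comment> \<open>The norm of an indicator is the square root of the measure, hence the square;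
    the half makes up for the non-strict bound in \<open>norm_cls_le_iff\<close>.\<close>
  obtain T where T: "open T" "E \<subseteq> T" "T - E \<in> lmeasurable" "emeasure lebesgue (T - E) < ennreal ((e/2)\<^sup>2)"
    using sets_lebesgue_outer_open[OF E(1), of "(e/2)\<^sup>2"] e by auto
  have [measurable]: "T - E \<in> sets lebesgue" using T(3) by auto
  have nn: "(\<integral>\<^sup>+x. ennreal ((cmod (indicator (T - E) x))\<^sup>2) \<partial>lebesgue) = emeasure lebesgue (T - E)"
  proof -
    have "(\<integral>\<^sup>+x. ennreal ((cmod (indicator (T - E) x))\<^sup>2) \<partial>lebesgue) = (\<integral>\<^sup>+x. indicator (T - E) x \<partial>lebesgue)"
      by (intro nn_integral_cong) (auto simp: indicator_def)
    then show ?thesis by simp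
  qed
  have D: "(indicator (T - E) :: _ \<Rightarrow> complex) \<in> L2 \<and> norm (cls (indicator (T - E))) \<le> e / 2"
    using T(4) e by (subst norm_cls_le_iff) (auto simp: nn less_imp_le)
  have eq: "(indicator T :: _ \<Rightarrow> complex) = (\<lambda>x. indicator E x + indicator (T - E) x)"
    using T(2) by (intro ext) (auto simp: indicator_def)
  have TL2: "(indicator T :: _ \<Rightarrow> complex) \<in> L2"
    unfolding eq using E(2) D by (intro L2_add) auto
  have "cls (indicator T) - cls (indicator E) = cls (indicator (T - E))"
    unfolding eq using E(2) D by (simp add: cls_add)
  then have "norm (cls (indicator T) - cls (indicator E)) < e"
    using D e by simp
  then show "\<exists>H. shift_cont H \<and> norm (H - cls (indicator E)) < e"
    using shift_cont_open[OF T(1) TL2] by blast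
qed

lemma shift_cont_simple:
  fixes s :: "real ^ 'd \<Rightarrow> complex"
  assumes s: "simple_function lebesgue s" "s \<in> L2"
  shows "shift_cont (cls s)"
proof -
  define E where "E y = s -` {y}" for y
  have E: "E y \<in> sets lebesgue" for y
    using simple_functionD(2)[OF s(1), of "{y}"] by (simp add: E_def)
  \<comment> \<open>The value 0 is left out because its level set may have infinite measure; for
    \<open>y \<noteq> 0\<close> the indicator is dominated by \<open>|s| / |y|\<close>.\<close>
  have fin: "finite (range s - {0})"
    using simple_functionD(1)[OF s(1)] by simp
  have ind: "(indicator (E y) :: _ \<Rightarrow> complex) \<in> L2" if "y \<noteq> 0" for y
  proof (rule L2_bound[OF s(2), where C = "1 / cmod y"])
    show "indicator (E y) \<in> borel_measurable lebesgue"
      using E by (rule borel_measurable_indicator)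
    show "AE x in lebesgue. cmod (indicator (E y) x) \<le> 1 / cmod y * cmod (s x)"
      using that by (auto simp: indicator_def E_def)
  qed
  have s_eq: "s = (\<lambda>x. \<Sum>y\<in>range s - {0}. y * indicator (E y) x)"
  proof
    fix x
    have "(\<Sum>y\<in>range s - {0}. y * indicator (E y) x) = (\<Sum>y\<in>range s - {0}. if y = s x then s x else 0)"
      by (intro sum.cong) (auto simp: indicator_def E_def)
    also have "\<dots> = s x"
      using fin by (auto simp: sum.delta')
    finally show "s x = (\<Sum>y\<in>range s - {0}. y * indicator (E y) x)" ..
  qed
  have "cls s = (\<Sum>y\<in>range s - {0}. cls (\<lambda>x. y * indicator (E y) x))"
    by (subst s_eq, rule cls_sum[OF fin]) (auto intro: L2_cmult ind)
  also have "\<dots> = (\<Sum>y\<in>range s - {0}. y *\<^sub>C cls (indicator (E y)))"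
    by (intro sum.cong) (auto simp: cls_scaleC ind)
  finally show ?thesis
    using fin by (auto intro!: shift_cont_sum shift_cont_scaleC shift_cont_indicator E ind)
qed

lemma shift_tendsto:
  fixes F :: "'d::finite l2"
  assumes "X \<longlonglongrightarrow> 0"
  shows "(\<lambda>n. shift (X n) F) \<longlonglongrightarrow> F"
proof -
  have "shift_cont F"
  proof (rule shift_cont_lim)
    fix e :: real assume e: "e > 0"
    obtain f where f: "f \<in> L2" "F = cls f" by (rule l2_cases)
    obtain s where s: "\<And>i. simple_function lebesgue (s i)" "\<And>x. (\<lambda>i. s i x) \<longlonglongrightarrow> f x"
      "\<And>i x. cmod (s i x) \<le> 2 * cmod (f x)"
      using borel_measurable_implies_sequence_metric[OF L2_measurable[OF f(1)], of 0] by auto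
    note sm = borel_measurable_simple_function[OF s(1)]
    have ae: "AE x in lebesgue. cmod (s i x) \<le> 2 * cmod (f x)" "AE x in lebesgue. (\<lambda>i. s i x) \<longlonglongrightarrow> f x" for i
      using s(2,3) by simp_all
    note lim = cls_tendsto_dominated(2)[OF f(1) f(1) sm ae] and sL2 = cls_tendsto_dominated(1)[OF f(1) f(1) sm ae]
    obtain i where "norm (cls (s i) - cls f) < e"
      using LIMSEQ_D[OF lim e] by blast
    then show "\<exists>H. shift_cont H \<and> norm (H - F) < e"
      using shift_cont_simple[OF s(1) sL2] f(2) by blast
  qed
  then show ?thesis using assms unfolding shift_cont_def by blast
qed

subsection \<open>Fourier integrals and the Gaussian\<close>

lemma fourier_integral_e1: "fourier_integral f \<xi> = (LINT x|lebesgue. f x * e1 (x \<bullet> \<xi>))"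
  by (simp add: fourier_integral_def e1_def)

lemma fourier_integral_borel:
  assumes [measurable]: "f \<in> borel_measurable borel"
  shows "fourier_integral f \<xi> = (LINT x|lborel. f x * e1 (x \<bullet> \<xi>))"
proof -
  have "(\<lambda>x. f x * e1 (x \<bullet> \<xi>)) \<in> borel_measurable borel" by measurable
  then show ?thesis
    unfolding fourier_integral_e1 by (intro integral_completion) simp
qed

lemma borel_measurable_fourier_integral [measurable]:
  fixes f :: "real ^ 'd \<Rightarrow> complex"
  assumes [measurable]: "f \<in> borel_measurable borel"
  shows "fourier_integral f \<in> borel_measurable borel"
  unfolding fourier_integral_borel[OF assms, abs_def]
  by (rule lborel.borel_measurable_lebesgue_integral) measurable

lemma integrable_mult_bounded:
  fixes f \<phi> :: "'a \<Rightarrow> complex"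
  assumes "integrable M f" "\<phi> \<in> borel_measurable M" "\<And>x. cmod (\<phi> x) \<le> C"
  shows "integrable M (\<lambda>x. f x * \<phi> x)"
proof (rule Bochner_Integration.integrable_bound)
  show "integrable M (\<lambda>x. complex_of_real C * f x)"
    using assms(1) by simp
  show "(\<lambda>x. f x * \<phi> x) \<in> borel_measurable M"
    using assms(1,2) by measurable
  have "0 \<le> C" using assms(3) norm_ge_zero order_trans by blast
  then show "AE x in M. norm (f x * \<phi> x) \<le> norm (complex_of_real C * f x)"
    using assms(3) by (intro AE_I2) (simp add: norm_mult mult.commute mult_right_mono)
qed

lemma cmod_fourier_integral_le:
  assumes "integrable lebesgue f"
  shows "cmod (fourier_integral f \<xi>) \<le> (LINT x|lebesgue. cmod (f x))"
proof -
  have "cmod (fourier_integral f \<xi>) \<le> (LINT x|lebesgue. cmod (f x * e1 (x \<bullet> \<xi>)))"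
    unfolding fourier_integral_e1 by (rule integral_norm_bound)
  then show ?thesis by (simp add: norm_mult)
qed

text \<open>Fubini for the kernel \<open>e1 (x \<bullet> \<xi>)\<close>, which is symmetric in its
  two arguments and unimodular, so \<open>|f x| |g \<xi>|\<close> controls the double
  integral.\<close>

lemma fourier_integral_multiplication:
  fixes f g :: "real ^ 'd \<Rightarrow> complex"
  assumes [measurable]: "f \<in> borel_measurable borel" "g \<in> borel_measurable borel"
    and f: "integrable lborel f" and g: "integrable lborel g"
  shows "(LINT \<xi>|lborel. fourier_integral f \<xi> * g \<xi>) = (LINT x|lborel. f x * fourier_integral g x)"
proof -
  have "integrable (lborel \<Otimes>\<^sub>M lborel) (\<lambda>(x, \<xi>). f x * g \<xi> * e1 (x \<bullet> \<xi>))"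
  proof (rule lborel_pair.Fubini_integrable)
    have "(\<lambda>x. LINT \<xi>|lborel. norm (f x * g \<xi> * e1 (x \<bullet> \<xi>))) = (\<lambda>x. cmod (f x) * (LINT \<xi>|lborel. cmod (g \<xi>)))"
      by (simp add: norm_mult)
    then show "integrable lborel (\<lambda>x. LINT \<xi>|lborel. norm (case (x, \<xi>) of (x, \<xi>) \<Rightarrow> f x * g \<xi> * e1 (x \<bullet> \<xi>)))"
      using f by simp
    show "AE x in lborel. integrable lborel (\<lambda>\<xi>. case (x, \<xi>) of (x, \<xi>) \<Rightarrow> f x * g \<xi> * e1 (x \<bullet> \<xi>))"
    proof (rule AE_I2)
      fix x
      have "integrable lborel (\<lambda>\<xi>. g \<xi> * (f x * e1 (x \<bullet> \<xi>)))"
        using g by (rule integrable_mult_bounded[where C = "cmod (f x)"]) (auto simp: norm_mult)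
      then show "integrable lborel (\<lambda>\<xi>. case (x, \<xi>) of (x, \<xi>) \<Rightarrow> f x * g \<xi> * e1 (x \<bullet> \<xi>))"
        by (simp add: mult_ac)
    qed
  qed measurable
  then have "(LINT \<xi>|lborel. LINT x|lborel. f x * g \<xi> * e1 (x \<bullet> \<xi>)) = (LINT x|lborel. LINT \<xi>|lborel. f x * g \<xi> * e1 (x \<bullet> \<xi>))"
    by (rule lborel_pair.Fubini_integral)
  moreover have "(LINT x|lborel. f x * g \<xi> * e1 (x \<bullet> \<xi>)) = fourier_integral f \<xi> * g \<xi>" for \<xi>
  proof -
    have "f x * g \<xi> * e1 (x \<bullet> \<xi>) = (f x * e1 (x \<bullet> \<xi>)) * g \<xi>" for x
      by (simp only: mult_ac)
    then show ?thesis
      unfolding fourier_integral_borel[OF assms(1)] by (simp only: integral_mult_left_zero)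
  qed
  moreover have "(LINT \<xi>|lborel. f x * g \<xi> * e1 (x \<bullet> \<xi>)) = f x * fourier_integral g x" for x
  proof -
    have "f x * g \<xi> * e1 (x \<bullet> \<xi>) = f x * (g \<xi> * e1 (\<xi> \<bullet> x))" for \<xi>
      by (simp only: mult.assoc inner_commute)
    then show ?thesis
      unfolding fourier_integral_borel[OF assms(2)] by (simp only: integral_mult_right_zero)
  qed
  ultimately show ?thesis by simp
qed

section \<open>The Gaussian and its transform\<close>

text \<open>A rescaling of the characteristic function of the standard normal distribution.\<close>

lemma gauss_fourier_1:
  "integrable lborel (\<lambda>x. complex_of_real (exp (- pi * x\<^sup>2)))"
  "(LINT x|lborel. complex_of_real (exp (- pi * x\<^sup>2)) * e1 (x * s)) = complex_of_real (exp (- pi * s\<^sup>2))"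
proof -
  \<comment> \<open>With \<open>r^2 = 2 pi\<close> the exponent \<open>(r x)^2 / 2\<close> becomes
    \<open>pi x^2\<close>, the phase \<open>(r s) (r x)\<close> becomes \<open>2 pi s x\<close>, and
    the Jacobian \<open>r\<close> cancels the normalisation of the density.\<close>
  define r where "r = sqrt (2 * pi)"
  have r: "r > 0" "r\<^sup>2 = 2 * pi" by (simp_all add: r_def)
  have dens: "std_normal_density (r * x) * r = exp (- pi * x\<^sup>2)" for x
    using r by (simp add: std_normal_density_def r_def[symmetric] power_mult_distrib)
  have "integrable lborel (\<lambda>x. complex_of_real (std_normal_density (0 + r * x)) * r)"
    using r by (intro integrable_mult_left integrable_of_real
        lborel_integrable_real_affine[where f = "\<lambda>x. std_normal_density x"]) auto
  then show "integrable lborel (\<lambda>x. complex_of_real (exp (- pi * x\<^sup>2)))"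
    using dens by (simp flip: of_real_mult)
  have "complex_of_real (exp (- ((r * s)\<^sup>2) / 2)) = char std_normal_distribution (r * s)"
    by (simp add: char_std_normal_distribution)
  also have "\<dots> = (LINT x|lborel. std_normal_density x *\<^sub>R iexp (r * s * x))"
    unfolding char_def by (subst integral_density) (auto simp: normal_density_nonneg)
  also have "\<dots> = \<bar>r\<bar> *\<^sub>R (LINT x|lborel. std_normal_density (0 + r * x) *\<^sub>R iexp (r * s * (0 + r * x)))"
    using r by (intro lborel_integral_real_affine) simp
  also have "\<dots> = (LINT x|lborel. complex_of_real (exp (- pi * x\<^sup>2)) * e1 (x * s))"
  proof (subst integral_scaleR_right[symmetric], intro Bochner_Integration.integral_cong refl)
    fix x
    have "iexp (r * s * (0 + r * x)) = e1 (x * s)"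
    proof -
      have "r * s * (0 + r * x) = r\<^sup>2 * (x * s)" by (simp add: power2_eq_square)
      also note r(2)
      finally show ?thesis by (simp only: e1_cis cis_conv_exp)
    qed
    then show "\<bar>r\<bar> *\<^sub>R (std_normal_density (0 + r * x) *\<^sub>R iexp (r * s * (0 + r * x)))
        = complex_of_real (exp (- pi * x\<^sup>2)) * e1 (x * s)"
      using r dens[of x, symmetric] by (simp add: scaleR_conv_of_real mult_ac)
  qed
  finally show "(LINT x|lborel. complex_of_real (exp (- pi * x\<^sup>2)) * e1 (x * s)) = complex_of_real (exp (- pi * s\<^sup>2))"
    using r by (simp add: power_mult_distrib)
qed

text \<open>Lebesgue measure is the image of the product measure under the coordinate map; this
  reduces the Gaussian to one variable.\<close>

lemma
  fixes h :: "'a::euclidean_space \<Rightarrow> real \<Rightarrow> complex"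
  assumes h: "\<And>b. b \<in> Basis \<Longrightarrow> integrable lborel (h b)"
  shows integrable_lborel_prod: "integrable lborel (\<lambda>x. \<Prod>b\<in>Basis. h b (x \<bullet> b))"
    and integral_lborel_prod: "(LINT x|lborel. (\<Prod>b\<in>Basis. h b (x \<bullet> b))) = (\<Prod>b\<in>Basis. (LINT x|lborel. h b x))"
proof -
  interpret product_sigma_finite "\<lambda>_::'a. lborel :: real measure" ..
  have [measurable]: "h b \<in> borel_measurable borel" if "b \<in> Basis" for b
    using borel_measurable_integrable[OF h[OF that]] by simp
  define T where "T f = (\<Sum>b\<in>Basis. f b *\<^sub>R b)" for f :: "'a \<Rightarrow> real"
  have T: "T \<in> (\<Pi>\<^sub>M b\<in>Basis. lborel) \<rightarrow>\<^sub>M borel"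
    unfolding T_def by measurable
  have lb: "(lborel :: 'a measure) = distr (\<Pi>\<^sub>M b\<in>Basis. lborel) borel T"
    unfolding T_def by (rule lborel_eq)
  have m: "(\<lambda>x. \<Prod>b\<in>Basis. h b (x \<bullet> b)) \<in> borel_measurable (borel :: 'a measure)"
    by measurable
  have T_inner: "T f \<bullet> b = f b" if "b \<in> Basis" for f b
    using that by (simp add: T_def inner_sum_left inner_Basis sum.delta' if_distrib cong: if_cong)
  have eq: "(\<Prod>b\<in>Basis. h b (T f \<bullet> b)) = (\<Prod>b\<in>Basis. h b (f b))" for f
    by (intro prod.cong) (auto simp: T_inner)
  show "integrable lborel (\<lambda>x. \<Prod>b\<in>Basis. h b (x \<bullet> b))"
    unfolding lb integrable_distr_eq[OF T m] eq by (rule product_integrable_prod) (auto simp: h)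
  show "(LINT x|lborel. (\<Prod>b\<in>Basis. h b (x \<bullet> b))) = (\<Prod>b\<in>Basis. (LINT x|lborel. h b x))"
    unfolding lb integral_distr[OF T m] eq by (rule product_integral_prod) (auto simp: h)
qed

text \<open>Normalised to have integral 1 and to be its own Fourier transform for the kernel
  \<open>e1\<close>.\<close>

definition gauss :: "'a::euclidean_space \<Rightarrow> real" where
  "gauss x = exp (- pi * (norm x)\<^sup>2)"

lemma borel_measurable_gauss [measurable]: "gauss \<in> borel_measurable borel"
  unfolding gauss_def[abs_def] by measurable

lemma gauss_bounds: "0 < gauss x" "gauss x \<le> 1"
  by (simp_all add: gauss_def)

lemma gauss_prod: "gauss x = (\<Prod>b\<in>Basis. exp (- pi * (x \<bullet> b)\<^sup>2))"
  unfolding gauss_def power2_norm_eq_inner euclidean_inner[of x x]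
  by (simp add: exp_sum sum_distrib_left power2_eq_square flip: sum_negf)

lemma
  fixes \<xi> :: "'a::euclidean_space"
  shows integrable_gauss: "integrable lborel (\<lambda>x::'a. complex_of_real (gauss x))"
    and gauss_fourier: "(LINT x|lborel. complex_of_real (gauss x) * e1 (x \<bullet> \<xi>)) = complex_of_real (gauss \<xi>)"
proof -
  show "integrable lborel (\<lambda>x::'a. complex_of_real (gauss x))"
    using integrable_lborel_prod[of "\<lambda>b::'a. \<lambda>x. complex_of_real (exp (- pi * x\<^sup>2))"] gauss_fourier_1(1)
    by (simp add: gauss_prod)
  have "e1 (x \<bullet> \<xi>) = (\<Prod>b\<in>Basis. e1 ((x \<bullet> b) * (\<xi> \<bullet> b)))" for x
    unfolding euclidean_inner[of x \<xi>] e1_def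
    by (simp add: sum_distrib_left flip: exp_sum)
  then have *: "complex_of_real (gauss x) * e1 (x \<bullet> \<xi>)
      = (\<Prod>b\<in>Basis. complex_of_real (exp (- pi * (x \<bullet> b)\<^sup>2)) * e1 ((x \<bullet> b) * (\<xi> \<bullet> b)))" for x
    by (simp add: gauss_prod prod.distrib)
  show "(LINT x|lborel. complex_of_real (gauss x) * e1 (x \<bullet> \<xi>)) = complex_of_real (gauss \<xi>)"
    unfolding *
    by (subst integral_lborel_prod)
       (auto intro!: integrable_mult_bounded[where C = 1] gauss_fourier_1(1)[simplified] simp: gauss_fourier_1(2)[simplified] gauss_prod[of \<xi>])
qed

section \<open>Affine changes of variables\<close>

lemma integral_lborel_scale:
  fixes f :: "'a::euclidean_space \<Rightarrow> complex"
  assumes [measurable]: "f \<in> borel_measurable borel" and c: "c > 0"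
  shows "(LINT x|lborel. f x) = complex_of_real (c ^ DIM('a)) * (LINT x|lborel. f (c *\<^sub>R x))"
proof -
  have "(LINT x|lborel. f x) = (LINT x|density (distr lborel borel (\<lambda>x. 0 + c *\<^sub>R x)) (\<lambda>_. \<bar>c\<bar> ^ DIM('a)). f x)"
    using c by (subst lborel_affine[of c 0]) auto
  also have "\<dots> = (LINT x|distr lborel borel (\<lambda>x. 0 + c *\<^sub>R x). (\<bar>c\<bar> ^ DIM('a)) *\<^sub>R f x)"
    using c by (intro integral_density) auto
  also have "\<dots> = (LINT x|lborel. (\<bar>c\<bar> ^ DIM('a)) *\<^sub>R f (0 + c *\<^sub>R x))"
    by (rule integral_distr) measurable
  also have "\<dots> = complex_of_real (c ^ DIM('a)) * (LINT x|lborel. f (c *\<^sub>R x))"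
    using c by (simp add: scaleR_conv_of_real)
  finally show ?thesis .
qed

lemma integrable_gauss_scaled:
  assumes "c > 0"
  shows "integrable lborel (\<lambda>x::'a::euclidean_space. complex_of_real (gauss (c *\<^sub>R x)))"
proof -
  have *: "(lborel :: 'a measure) = density (distr lborel borel (\<lambda>x. 0 + c *\<^sub>R x)) (\<lambda>_. ennreal (\<bar>c\<bar> ^ DIM('a)))"
    using lborel_affine[of c "0::'a"] assms by simp
  have "integrable (density (distr lborel borel (\<lambda>x. 0 + c *\<^sub>R x)) (\<lambda>_. ennreal (\<bar>c\<bar> ^ DIM('a)))) (\<lambda>x::'a. complex_of_real (gauss x))"
    using integrable_gauss unfolding *[symmetric] .
  then have "integrable (distr lborel borel (\<lambda>x. 0 + c *\<^sub>R x)) (\<lambda>x::'a. (\<bar>c\<bar> ^ DIM('a)) *\<^sub>R complex_of_real (gauss x))"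
    by (subst (asm) integrable_density) auto
  then have "integrable (distr lborel borel (\<lambda>x. 0 + c *\<^sub>R x)) (\<lambda>x::'a. complex_of_real (gauss x))"
    using integrable_scaleR_right[of "1 / c ^ DIM('a)"] assms by force
  then show ?thesis
    by (subst (asm) integrable_distr_eq) auto
qed

lemma integral_lborel_translate:
  fixes f :: "'a::euclidean_space \<Rightarrow> complex"
  assumes [measurable]: "f \<in> borel_measurable borel"
  shows "(LINT x|lborel. f x) = (LINT x|lborel. f (a + x))"
proof -
  have "(LINT x|lborel. f x) = (LINT x|distr lborel borel ((+) a). f x)"
    by (simp add: lborel_distr_plus)
  also have "\<dots> = (LINT x|lborel. f (a + x))"
    by (rule integral_distr) measurable
  finally show ?thesis .
qed

subsection \<open>The Plancherel theorem\<close>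

text \<open>The Fubini arguments run over products of \<open>lborel\<close>, where measurability of
  maps such as \<open>(u, x) \<mapsto> f (x + e u)\<close> is available for Borel \<open>f\<close>;
  a representative reduces the general case to that one.\<close>

lemma lebesgue_measurable_borel_representative:
  fixes f :: "'a::euclidean_space \<Rightarrow> complex"
  assumes "f \<in> borel_measurable lebesgue"
  obtains f0 where "f0 \<in> borel_measurable borel" "AE x in lebesgue. f x = f0 x"
proof -
  have re: "(\<lambda>x. Re (f x)) \<in> borel_measurable lebesgue" and im: "(\<lambda>x. Im (f x)) \<in> borel_measurable lebesgue"
    using assms by simp_all
  obtain a b where [measurable]: "a \<in> borel_measurable lborel" "b \<in> borel_measurable lborel"
    and ab: "AE x in lborel. Re (f x) = a x" "AE x in lborel. Im (f x) = b x"
    using completion_ex_borel_measurable_real[OF re] completion_ex_borel_measurable_real[OF im] by blast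
  show ?thesis
  proof (rule that)
    show "(\<lambda>x. Complex (a x) (b x)) \<in> borel_measurable borel"
      unfolding borel_measurable_complex_iff by simp measurable
    show "AE x in lebesgue. f x = Complex (a x) (b x)"
      using AE_completion[OF ab(1)] AE_completion[OF ab(2)] by eventually_elim (simp add: complex_eq_iff)
  qed
qed

lemma gauss_nonneg [simp]: "0 \<le> gauss x" and abs_gauss [simp]: "\<bar>gauss x\<bar> = gauss x"
  using gauss_bounds(1)[of x] by simp_all

text \<open>Regularised Fourier inversion: damping the transform by a wide Gaussian amounts to
  averaging \<open>f\<close> around \<open>x\<close> at scale \<open>e\<close>. It is the
  multiplication formula for the modulated Gaussian \<open>m\<close>, followed by the substitution
  \<open>y = x + e u\<close>.\<close>

lemma gauss_mean_fourier_integral: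
  fixes f :: "real ^ 'd \<Rightarrow> complex"
  assumes [measurable]: "f \<in> borel_measurable borel" and f: "integrable lborel f" and e: "e > 0"
  shows "(LINT \<xi>|lborel. fourier_integral f \<xi> * (complex_of_real (gauss (e *\<^sub>R \<xi>)) * e1 (\<xi> \<bullet> (- x))))
    = (LINT u|lborel. f (x + e *\<^sub>R u) * complex_of_real (gauss u))"
proof -
  define m where "m \<xi> = complex_of_real (gauss (e *\<^sub>R \<xi>)) * e1 (\<xi> \<bullet> (- x))" for \<xi>
  have m [measurable]: "m \<in> borel_measurable borel" unfolding m_def[abs_def] by measurable
  have m_int: "integrable lborel m"
    unfolding m_def[abs_def] using integrable_gauss_scaled[OF e]
    by (rule integrable_mult_bounded[where C = 1]) auto
  \<comment> \<open>Self-duality of the Gaussian after rescaling; the factor \<open>e^d\<close> is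
    the one that the substitution \<open>y = x + e u\<close> supplies below.\<close>
  have m_fourier: "complex_of_real (e ^ CARD('d)) * fourier_integral m (x + e *\<^sub>R u) = complex_of_real (gauss u)" for u
  proof -
    have "complex_of_real (gauss u) = (LINT \<xi>|lborel. complex_of_real (gauss \<xi>) * e1 (\<xi> \<bullet> u))"
      by (rule gauss_fourier[symmetric])
    also have "\<dots> = complex_of_real (e ^ DIM(real ^ 'd)) *
        (LINT \<xi>|lborel. complex_of_real (gauss (e *\<^sub>R \<xi>)) * e1 ((e *\<^sub>R \<xi>) \<bullet> u))"
      by (rule integral_lborel_scale[OF _ e]) measurable
    also have "(LINT \<xi>|lborel. complex_of_real (gauss (e *\<^sub>R \<xi>)) * e1 ((e *\<^sub>R \<xi>) \<bullet> u)) = fourier_integral m (x + e *\<^sub>R u)"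
      unfolding fourier_integral_borel[OF m] m_def
      by (simp add: mult.assoc inner_add_right flip: e1_add)
    finally show ?thesis by simp
  qed
  have "(LINT \<xi>|lborel. fourier_integral f \<xi> * m \<xi>) = (LINT y|lborel. f y * fourier_integral m y)"
    using f m_int by (intro fourier_integral_multiplication) measurable
  also have "\<dots> = (LINT z|lborel. f (x + z) * fourier_integral m (x + z))"
    by (rule integral_lborel_translate) measurable
  also have "\<dots> = complex_of_real (e ^ DIM(real ^ 'd)) * (LINT u|lborel. f (x + e *\<^sub>R u) * fourier_integral m (x + e *\<^sub>R u))"
    by (rule integral_lborel_scale[OF _ e]) measurable
  also have "\<dots> = (LINT u|lborel. f (x + e *\<^sub>R u) * (complex_of_real (e ^ CARD('d)) * fourier_integral m (x + e *\<^sub>R u)))"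
    by (subst integral_mult_right_zero[symmetric]) (simp add: mult_ac)
  finally show ?thesis
    unfolding m_fourier m_def .
qed

lemma L2_borel_iff:
  assumes "f \<in> borel_measurable borel"
  shows "f \<in> L2 \<longleftrightarrow> integrable lborel (\<lambda>x. (cmod (f x))\<^sup>2)"
proof -
  have "(\<lambda>x. (cmod (f x))\<^sup>2) \<in> borel_measurable lborel" "f \<in> borel_measurable lebesgue"
    using assms by (auto intro: measurable_completion)
  then show ?thesis
    by (simp add: L2_def integrable_completion)
qed

text \<open>The \<open>L1\<close> bound is uniform in \<open>a\<close>, so a Gaussian weight in
  \<open>a\<close> makes the double integral absolutely convergent. The factor 2 comes from bounding
  a product by the sum of two squares.\<close>

lemma autocorrelation:
  fixes f :: "real ^ 'd \<Rightarrow> complex"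
  assumes [measurable]: "f \<in> borel_measurable borel" and f: "f \<in> L2"
  shows "integrable lborel (\<lambda>x. f x * cnj (f (x + a)))"
    and "(LINT x|lborel. f x * cnj (f (x + a))) = cinner (cls f) (shift (- a) (cls f))"
    and "(LINT x|lborel. cmod (f x * cnj (f (x + a)))) \<le> 2 * (norm (cls f))\<^sup>2"
proof -
  have fa: "(\<lambda>x. f (x + a)) \<in> L2"
    using L2_shift[OF f, of "- a"] by simp
  have [measurable]: "(\<lambda>x. f x * cnj (f (x + a))) \<in> borel_measurable borel"
    by (intro borel_measurable_times borel_measurable_cnj) measurable
  show int: "integrable lborel (\<lambda>x. f x * cnj (f (x + a)))"
    using L2_inner_integrable[OF f fa] by (subst (asm) integrable_completion) auto
  show "(LINT x|lborel. f x * cnj (f (x + a))) = cinner (cls f) (shift (- a) (cls f))"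
    using f fa by (simp add: shift_cls cinner_cls L2_inner_def integral_completion)
  have 1: "integrable lborel (\<lambda>x. (cmod (f x))\<^sup>2)" "(LINT x|lborel. (cmod (f x))\<^sup>2) = (norm (cls f))\<^sup>2"
    using f by (simp_all add: L2_borel_iff norm_cls_square integral_completion)
  have 2: "integrable lborel (\<lambda>x. (cmod (f (x + a)))\<^sup>2)" "(LINT x|lborel. (cmod (f (x + a)))\<^sup>2) = (norm (cls f))\<^sup>2"
  proof -
    show "integrable lborel (\<lambda>x. (cmod (f (x + a)))\<^sup>2)"
      using fa by (subst (asm) L2_borel_iff) auto
    have "(norm (cls (\<lambda>x. f (x + a))))\<^sup>2 = (norm (shift (- a) (cls f)))\<^sup>2"
      using f by (simp add: shift_cls)
    then show "(LINT x|lborel. (cmod (f (x + a)))\<^sup>2) = (norm (cls f))\<^sup>2"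
      using fa by (simp add: norm_cls_square integral_completion)
  qed
  have "(LINT x|lborel. cmod (f x * cnj (f (x + a)))) \<le> (LINT x|lborel. (cmod (f x))\<^sup>2 + (cmod (f (x + a)))\<^sup>2)"
  proof (rule integral_mono)
    show "integrable lborel (\<lambda>x. cmod (f x * cnj (f (x + a))))"
      using int by (rule integrable_norm)
    show "integrable lborel (\<lambda>x. (cmod (f x))\<^sup>2 + (cmod (f (x + a)))\<^sup>2)"
      using 1 2 by simp
    fix x
    have "2 * (cmod (f x) * cmod (f (x + a))) \<le> (cmod (f x))\<^sup>2 + (cmod (f (x + a)))\<^sup>2"
      using sum_squares_bound[of "cmod (f x)" "cmod (f (x + a))"] by (simp only: mult.assoc)
    moreover have "0 \<le> cmod (f x) * cmod (f (x + a))" by simp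
    ultimately show "cmod (f x * cnj (f (x + a))) \<le> (cmod (f x))\<^sup>2 + (cmod (f (x + a)))\<^sup>2"
      unfolding norm_mult complex_mod_cnj by linarith
  qed
  then show "(LINT x|lborel. cmod (f x * cnj (f (x + a)))) \<le> 2 * (norm (cls f))\<^sup>2"
    using 1 2 by simp
qed

text \<open>The multiplication formula is applied twice: here with the weighted conjugate of the transform,
  and within \<open>gauss_mean_fourier_integral\<close> with the modulated Gaussian.\<close>

lemma plancherel_gauss:
  fixes f :: "real ^ 'd \<Rightarrow> complex"
  assumes [measurable]: "f \<in> borel_measurable borel" and f: "integrable lborel f" "f \<in> L2" and e: "e > 0"
  shows "integrable lborel (\<lambda>\<xi>. (cmod (fourier_integral f \<xi>))\<^sup>2 * gauss (e *\<^sub>R \<xi>))"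
    and "complex_of_real (LINT \<xi>|lborel. (cmod (fourier_integral f \<xi>))\<^sup>2 * gauss (e *\<^sub>R \<xi>))
    = (LINT u|lborel. complex_of_real (gauss u) * (LINT x|lborel. f x * cnj (f (x + e *\<^sub>R u))))"
proof -
  define F where "F = fourier_integral f"
  define C where "C = (LINT x|lebesgue. cmod (f x))"
  have [measurable]: "F \<in> borel_measurable borel" unfolding F_def by measurable
  have f_leb: "integrable lebesgue f"
    using f(1) by (simp add: integrable_completion)
  have FC: "cmod (F \<xi>) \<le> C" for \<xi>
    unfolding F_def C_def by (rule cmod_fourier_integral_le[OF f_leb])
  define k where "k \<xi> = complex_of_real (gauss (e *\<^sub>R \<xi>)) * cnj (F \<xi>)" for \<xi>
  have cnjF [measurable]: "(\<lambda>\<xi>. cnj (F \<xi>)) \<in> borel_measurable borel"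
    by (rule borel_measurable_cnj) measurable
  have k [measurable]: "k \<in> borel_measurable borel" unfolding k_def[abs_def] by measurable
  have k_int: "integrable lborel k"
    unfolding k_def[abs_def] using integrable_gauss_scaled[OF e]
    by (rule integrable_mult_bounded[where C = C]) (auto simp: FC)
  have kF: "k \<xi> * F \<xi> = complex_of_real ((cmod (F \<xi>))\<^sup>2 * gauss (e *\<^sub>R \<xi>))" for \<xi>
    unfolding k_def of_real_mult complex_norm_square by (simp only: mult_ac)
  have "integrable lborel (\<lambda>\<xi>. k \<xi> * F \<xi>)"
    using k_int by (rule integrable_mult_bounded[where C = C]) (auto simp: FC)
  then show "integrable lborel (\<lambda>\<xi>. (cmod (fourier_integral f \<xi>))\<^sup>2 * gauss (e *\<^sub>R \<xi>))"
    unfolding kF F_def[symmetric] by (simp only: complex_of_real_integrable_eq)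
  have fk: "fourier_integral k x = (LINT u|lborel. cnj (f (x + e *\<^sub>R u)) * complex_of_real (gauss u))" for x
  proof -
    have "fourier_integral k x = (LINT \<xi>|lborel. cnj (F \<xi> * (complex_of_real (gauss (e *\<^sub>R \<xi>)) * e1 (\<xi> \<bullet> (- x)))))"
      unfolding fourier_integral_borel[OF k] k_def by (simp add: cnj_e1 mult_ac)
    also have "\<dots> = cnj (LINT u|lborel. f (x + e *\<^sub>R u) * complex_of_real (gauss u))"
      unfolding Bochner_Integration.integral_cnj F_def by (subst gauss_mean_fourier_integral[OF _ f(1) e]) simp_all
    also have "\<dots> = (LINT u|lborel. cnj (f (x + e *\<^sub>R u)) * complex_of_real (gauss u))"
      unfolding Bochner_Integration.integral_cnj[symmetric] by simp
    finally show ?thesis .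
  qed
  have Q [measurable]: "(\<lambda>(u, x). f x * cnj (f (x + e *\<^sub>R u))) \<in> borel_measurable (lborel \<Otimes>\<^sub>M lborel)"
    unfolding split_beta' by (intro borel_measurable_times borel_measurable_cnj) measurable
  define N where "N = 2 * (norm (cls f))\<^sup>2"
  have "integrable (lborel \<Otimes>\<^sub>M lborel) (\<lambda>(u, x). complex_of_real (gauss u) * (f x * cnj (f (x + e *\<^sub>R u))))"
  proof (rule lborel_pair.Fubini_integrable)
    show "(\<lambda>(u, x). complex_of_real (gauss u) * (f x * cnj (f (x + e *\<^sub>R u)))) \<in> borel_measurable (lborel \<Otimes>\<^sub>M lborel)"
      using Q unfolding split_beta' by measurable
    have [measurable]: "(\<lambda>u. LINT x|lborel. cmod (f x * cnj (f (x + e *\<^sub>R u)))) \<in> borel_measurable lborel"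
      using Q by (intro lborel.borel_measurable_lebesgue_integral) (auto simp: split_beta')
    have "integrable lborel (\<lambda>u. gauss u * (LINT x|lborel. cmod (f x * cnj (f (x + e *\<^sub>R u)))))"
    proof (rule Bochner_Integration.integrable_bound)
      show "integrable lborel (\<lambda>u::real^'d. gauss u * N)"
        using integrable_gauss[where 'a = "real ^ 'd"] by (simp add: complex_of_real_integrable_eq)
      show "AE u in lborel. norm (gauss u * (LINT x|lborel. cmod (f x * cnj (f (x + e *\<^sub>R u))))) \<le> norm (gauss u * N)"
        using autocorrelation(3)[OF assms(1) f(2)] gauss_bounds(1)
        by (intro AE_I2) (simp add: abs_mult N_def less_imp_le integral_nonneg mult_left_mono)
    qed measurable
    then show "integrable lborel (\<lambda>u. LINT x|lborel. norm (case (u, x) of (u, x) \<Rightarrow> complex_of_real (gauss u) * (f x * cnj (f (x + e *\<^sub>R u)))))"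
      by (simp add: norm_mult)
    show "AE u in lborel. integrable lborel (\<lambda>x. case (u, x) of (u, x) \<Rightarrow> complex_of_real (gauss u) * (f x * cnj (f (x + e *\<^sub>R u))))"
      using autocorrelation(1)[OF assms(1) f(2)] by simp
  qed
  note fub = lborel_pair.Fubini_integral[OF this]
  have "complex_of_real (LINT \<xi>|lborel. (cmod (F \<xi>))\<^sup>2 * gauss (e *\<^sub>R \<xi>)) = (LINT \<xi>|lborel. F \<xi> * k \<xi>)"
    unfolding integral_complex_of_real[symmetric] kF[symmetric] by (simp only: mult.commute)
  also have "\<dots> = (LINT x|lborel. f x * fourier_integral k x)"
    unfolding F_def using f(1) k_int by (intro fourier_integral_multiplication) measurable
  also have "\<dots> = (LINT x|lborel. LINT u|lborel. complex_of_real (gauss u) * (f x * cnj (f (x + e *\<^sub>R u))))"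
    unfolding fk integral_mult_right_zero[symmetric] by (simp only: mult_ac)
  also have "\<dots> = (LINT u|lborel. LINT x|lborel. complex_of_real (gauss u) * (f x * cnj (f (x + e *\<^sub>R u))))"
    by (rule fub)
  also have "\<dots> = (LINT u|lborel. complex_of_real (gauss u) * (LINT x|lborel. f x * cnj (f (x + e *\<^sub>R u))))"
    by (simp only: integral_mult_right_zero)
  finally show "complex_of_real (LINT \<xi>|lborel. (cmod (fourier_integral f \<xi>))\<^sup>2 * gauss (e *\<^sub>R \<xi>))
    = (LINT u|lborel. complex_of_real (gauss u) * (LINT x|lborel. f x * cnj (f (x + e *\<^sub>R u))))"
    unfolding F_def .
qed

text \<open>As the width parameter tends to 0, the damped integral of \<open>|F|^2\<close>
  approaches the full one, while on the other side continuity of translations and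
  \<open>\<integral> gauss = 1\<close> give \<open>|f|^2\<close>.\<close>

lemma plancherel_borel:
  fixes f :: "real ^ 'd \<Rightarrow> complex"
  assumes [measurable]: "f \<in> borel_measurable borel" and f: "integrable lborel f" "f \<in> L2"
  shows "fourier_integral f \<in> L2 \<and> norm (cls (fourier_integral f)) = norm (cls f)"
proof -
  define F where "F = fourier_integral f"
  have F [measurable]: "F \<in> borel_measurable borel" unfolding F_def by measurable
  define e :: "nat \<Rightarrow> real" where "e n = inverse (real (Suc n))" for n
  have e: "e n > 0" "e \<longlonglongrightarrow> 0" for n
    unfolding e_def[abs_def] by (simp, rule LIMSEQ_inverse_real_of_nat)
  have e_scaled: "(\<lambda>n. e n *\<^sub>R u) \<longlonglongrightarrow> 0" for u :: "real ^ 'd"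
    using tendsto_scaleR[OF e(2) tendsto_const[of u]] by simp
  define R where "R n = (LINT \<xi>|lborel. (cmod (F \<xi>))\<^sup>2 * gauss (e n *\<^sub>R \<xi>))" for n
  have R_int: "integrable lborel (\<lambda>\<xi>. (cmod (F \<xi>))\<^sup>2 * gauss (e n *\<^sub>R \<xi>))" for n
    unfolding F_def by (rule plancherel_gauss(1)[OF assms e(1)])
  have gauss_lim: "(\<lambda>n. gauss (e n *\<^sub>R \<xi>)) \<longlonglongrightarrow> 1" for \<xi> :: "real ^ 'd"
  proof -
    have "(\<lambda>n. gauss (e n *\<^sub>R \<xi>)) \<longlonglongrightarrow> exp (- pi * (norm (0 :: real ^ 'd))\<^sup>2)"
      unfolding gauss_def by (intro tendsto_intros e_scaled)
    then show ?thesis by simp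
  qed
  have R_lim: "R \<longlonglongrightarrow> (norm (cls f))\<^sup>2"
  proof -
    have "(\<lambda>n. LINT u|lborel. complex_of_real (gauss u) * (LINT x|lborel. f x * cnj (f (x + e n *\<^sub>R u))))
        \<longlonglongrightarrow> (LINT u|lborel. complex_of_real (gauss (u :: real ^ 'd)) * cinner (cls f) (cls f))"
    proof (rule integral_dominated_convergence[where w = "\<lambda>u. gauss u * (norm (cls f))\<^sup>2"])
      show "integrable lborel (\<lambda>u::real^'d. gauss u * (norm (cls f))\<^sup>2)"
        using integrable_gauss[where 'a = "real ^ 'd"] by (simp add: complex_of_real_integrable_eq)
      show "AE u in lborel. (\<lambda>n. complex_of_real (gauss u) * (LINT x|lborel. f x * cnj (f (x + e n *\<^sub>R u))))
          \<longlonglongrightarrow> complex_of_real (gauss u) * cinner (cls f) (cls f)"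
      proof (rule AE_I2)
        fix u
        have "(\<lambda>n. shift (- (e n *\<^sub>R u)) (cls f)) \<longlonglongrightarrow> cls f"
          using tendsto_minus[OF e_scaled[of u]] by (intro shift_tendsto) simp
        then show "(\<lambda>n. complex_of_real (gauss u) * (LINT x|lborel. f x * cnj (f (x + e n *\<^sub>R u))))
          \<longlonglongrightarrow> complex_of_real (gauss u) * cinner (cls f) (cls f)"
          unfolding autocorrelation(2)[OF assms(1) f(2)] by (intro tendsto_intros cinner.tendsto)
      qed
      show "AE u in lborel. norm (complex_of_real (gauss u) * (LINT x|lborel. f x * cnj (f (x + e n *\<^sub>R u))))
          \<le> gauss u * (norm (cls f))\<^sup>2" for n
      proof (rule AE_I2)
        fix u :: "real ^ 'd"
        have "cmod (cinner (cls f) (shift (- (e n *\<^sub>R u)) (cls f))) \<le> (norm (cls f))\<^sup>2"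
          using cmod_cinner_le[of "cls f" "shift (- (e n *\<^sub>R u)) (cls f)"] by (simp add: power2_eq_square)
        then show "norm (complex_of_real (gauss u) * (LINT x|lborel. f x * cnj (f (x + e n *\<^sub>R u))))
          \<le> gauss u * (norm (cls f))\<^sup>2"
          unfolding autocorrelation(2)[OF assms(1) f(2)] norm_mult
          using gauss_bounds(1)[of u] by (intro mult_mono) auto
      qed
      have "(\<lambda>(u, x). f x * cnj (f (x + e n *\<^sub>R u))) \<in> borel_measurable (lborel \<Otimes>\<^sub>M lborel)" for n
        unfolding split_beta' by (intro borel_measurable_times borel_measurable_cnj) measurable
      then have "(\<lambda>u. LINT x|lborel. f x * cnj (f (x + e n *\<^sub>R u))) \<in> borel_measurable lborel" for n
        by (intro lborel.borel_measurable_lebesgue_integral)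
      then show "(\<lambda>u. complex_of_real (gauss u) * (LINT x|lborel. f x * cnj (f (x + e n *\<^sub>R u)))) \<in> borel_measurable lborel" for n
        by measurable
    qed measurable
    moreover have "(LINT u|lborel. complex_of_real (gauss (u :: real ^ 'd)) * cinner (cls f) (cls f)) = cinner (cls f) (cls f)"
    proof -
      have "(LINT u|lborel. complex_of_real (gauss (u :: real ^ 'd))) = 1"
        using gauss_fourier[of "0 :: real ^ 'd"] by (simp add: gauss_def[of 0])
      then show ?thesis by (simp only: integral_mult_left_zero mult_1)
    qed
    ultimately have "(\<lambda>n. complex_of_real (R n)) \<longlonglongrightarrow> complex_of_real ((norm (cls f))\<^sup>2)"
      unfolding R_def F_def plancherel_gauss(2)[OF assms e(1)] cinner_eq_norm by (simp only:)
    then show ?thesis by (simp only: tendsto_of_real_iff)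
  qed
  \<comment> \<open>Fatou's lemma gives only an inequality, but thereby integrability of
    \<open>|F|^2\<close>, which then serves as the majorant for the exact limit.\<close>
  have "(\<integral>\<^sup>+\<xi>. ennreal ((cmod (F \<xi>))\<^sup>2) \<partial>lborel)
      = (\<integral>\<^sup>+\<xi>. liminf (\<lambda>n. ennreal ((cmod (F \<xi>))\<^sup>2 * gauss (e n *\<^sub>R \<xi>))) \<partial>lborel)"
  proof (rule nn_integral_cong)
    fix \<xi>
    have "(\<lambda>n. ennreal ((cmod (F \<xi>))\<^sup>2 * gauss (e n *\<^sub>R \<xi>))) \<longlonglongrightarrow> ennreal ((cmod (F \<xi>))\<^sup>2 * 1)"
      by (intro tendsto_ennrealI tendsto_mult tendsto_const gauss_lim)
    then show "ennreal ((cmod (F \<xi>))\<^sup>2) = liminf (\<lambda>n. ennreal ((cmod (F \<xi>))\<^sup>2 * gauss (e n *\<^sub>R \<xi>)))"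
      by (intro lim_imp_Liminf[symmetric]) auto
  qed
  also have "\<dots> \<le> liminf (\<lambda>n. \<integral>\<^sup>+\<xi>. ennreal ((cmod (F \<xi>))\<^sup>2 * gauss (e n *\<^sub>R \<xi>)) \<partial>lborel)"
    by (rule nn_integral_liminf) measurable
  also have "\<dots> = liminf (\<lambda>n. ennreal (R n))"
    unfolding R_def using R_int by (subst nn_integral_eq_integral) auto
  also have "\<dots> = ennreal ((norm (cls f))\<^sup>2)"
    using R_lim by (intro lim_imp_Liminf tendsto_ennrealI) auto
  also have "\<dots> < \<infinity>" by simp
  finally have F_int: "integrable lborel (\<lambda>\<xi>. (cmod (F \<xi>))\<^sup>2)"
    by (intro integrableI_bounded) auto
  then have FL2: "F \<in> L2"
    using F by (simp add: L2_borel_iff)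
  have "R \<longlonglongrightarrow> (LINT \<xi>|lborel. (cmod (F \<xi>))\<^sup>2)"
    unfolding R_def
  proof (rule integral_dominated_convergence[where w = "\<lambda>\<xi>. (cmod (F \<xi>))\<^sup>2"])
    show "AE \<xi> in lborel. (\<lambda>n. (cmod (F \<xi>))\<^sup>2 * gauss (e n *\<^sub>R \<xi>)) \<longlonglongrightarrow> (cmod (F \<xi>))\<^sup>2"
    proof (rule AE_I2)
      fix \<xi>
      have "(\<lambda>n. (cmod (F \<xi>))\<^sup>2 * gauss (e n *\<^sub>R \<xi>)) \<longlonglongrightarrow> (cmod (F \<xi>))\<^sup>2 * 1"
        by (intro tendsto_mult tendsto_const gauss_lim)
      then show "(\<lambda>n. (cmod (F \<xi>))\<^sup>2 * gauss (e n *\<^sub>R \<xi>)) \<longlonglongrightarrow> (cmod (F \<xi>))\<^sup>2" by simp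
    qed
    show "AE \<xi> in lborel. norm ((cmod (F \<xi>))\<^sup>2 * gauss (e n *\<^sub>R \<xi>)) \<le> (cmod (F \<xi>))\<^sup>2" for n
      by (intro AE_I2) (simp add: abs_mult mult_left_le gauss_bounds)
  qed (use F_int in measurable)
  then have "(norm (cls f))\<^sup>2 = (LINT \<xi>|lborel. (cmod (F \<xi>))\<^sup>2)"
    using R_lim by (intro LIMSEQ_unique)
  also have "\<dots> = (norm (cls F))\<^sup>2"
    using FL2 by (simp add: norm_cls_square integral_completion)
  finally have "norm (cls F) = norm (cls f)" by (simp add: power2_eq_iff_nonneg)
  with FL2 show ?thesis unfolding F_def by simp
qed

section \<open>From Borel to Lebesgue measurable functions\<close>

lemma fourier_integral_borel_representative:
  fixes f :: "real ^ 'd \<Rightarrow> complex"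
  assumes f: "integrable lebesgue f" "f \<in> L2"
    and f0: "f0 \<in> borel_measurable borel" "AE x in lebesgue. f x = f0 x"
  shows "integrable lborel f0" "f0 \<in> L2" "fourier_integral f = fourier_integral f0" "cls f = cls f0"
proof -
  have m: "f0 \<in> borel_measurable lebesgue"
    using f0(1) by (intro measurable_completion) simp
  show "integrable lborel f0"
    using integrable_cong_AE_imp[OF f(1) m] f0 by (simp add: integrable_completion eq_commute)
  show L2: "f0 \<in> L2" by (rule L2_cong_AE[OF f(2) m f0(2)])
  show "fourier_integral f = fourier_integral f0"
  proof
    fix \<xi>
    show "fourier_integral f \<xi> = fourier_integral f0 \<xi>"
      unfolding fourier_integral_e1
    proof (rule integral_cong_AE)
      have e: "(\<lambda>x. e1 (x \<bullet> \<xi>)) \<in> borel_measurable lebesgue"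
        by (intro measurable_completion) measurable
      show "(\<lambda>x. f x * e1 (x \<bullet> \<xi>)) \<in> borel_measurable lebesgue" "(\<lambda>x. f0 x * e1 (x \<bullet> \<xi>)) \<in> borel_measurable lebesgue"
        using e m L2_measurable[OF f(2)] by (auto intro: borel_measurable_times)
      show "AE x in lebesgue. f x * e1 (x \<bullet> \<xi>) = f0 x * e1 (x \<bullet> \<xi>)"
        using f0(2) by eventually_elim simp
    qed
  qed
  show "cls f = cls f0"
    using f(2) L2 f0(2) by (simp add: cls_eq_iff)
qed

lemma
  fixes f :: "real ^ 'd \<Rightarrow> complex"
  assumes f: "integrable lebesgue f" "f \<in> L2"
  shows L2_fourier_integral: "fourier_integral f \<in> L2"
    and norm_fourier_integral: "norm (cls (fourier_integral f)) = norm (cls f)"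
proof -
  obtain f0 where f0: "f0 \<in> borel_measurable borel" "AE x in lebesgue. f x = f0 x"
    using lebesgue_measurable_borel_representative[OF L2_measurable[OF f(2)]] .
  note B = fourier_integral_borel_representative[OF f f0]
  show "fourier_integral f \<in> L2" "norm (cls (fourier_integral f)) = norm (cls f)"
    using plancherel_borel[OF f0(1) B(1,2)] B(3,4) by simp_all
qed

text \<open>Turns the sesquilinear \<open>cinner\<close> into the bilinear pairing of the
  multiplication formula: \<open>cinner F (conjugate H)\<close> is the integral of the plain
  product.\<close>

lift_definition conjugate :: "'d::finite l2 \<Rightarrow> 'd l2" is "\<lambda>f x. cnj (f x)"
  by (auto intro: L2_cnj)

lemma conjugate_cls: "f \<in> L2 \<Longrightarrow> conjugate (cls f) = cls (\<lambda>x. cnj (f x))"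
  by (simp add: conjugate.abs_eq)

lemma conjugate_conjugate [simp]: "conjugate (conjugate F) = F"
  by transfer simp

lemma cinner_conjugate: "cinner (conjugate F) (conjugate H) = cnj (cinner F H)"
  by transfer (simp add: L2_inner_def flip: Bochner_Integration.integral_cnj)

lemma norm_conjugate [simp]: "norm (conjugate F) = norm F"
  by (simp add: norm_l2_def inner_l2_def cinner_conjugate)

lemma bounded_linear_conjugate: "bounded_linear conjugate"
proof (rule bounded_linear_intro[of _ 1])
  show "conjugate (F + H) = conjugate F + conjugate H" for F H :: "'a l2"
    by transfer (simp add: L2_add L2_cnj)
  show "conjugate (r *\<^sub>R F) = r *\<^sub>R conjugate F" for r and F :: "'a l2"
    unfolding scaleR_l2_def by transfer (simp add: L2_cmult L2_cnj)
qed simp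

lemma norm_cls_mono:
  assumes "f \<in> L2" "h \<in> L2" "0 \<le> C" "AE x in lebesgue. cmod (f x) \<le> C * cmod (h x)"
  shows "norm (cls f) \<le> C * norm (cls h)"
proof -
  have "(norm (cls f))\<^sup>2 \<le> (LINT x|lebesgue. C\<^sup>2 * (cmod (h x))\<^sup>2)"
    unfolding norm_cls_square[OF assms(1)]
  proof (rule integral_mono_AE)
    show "AE x in lebesgue. (cmod (f x))\<^sup>2 \<le> C\<^sup>2 * (cmod (h x))\<^sup>2"
      using assms(4) by eventually_elim (auto simp flip: power_mult_distrib intro: power_mono)
  qed (use assms L2_square_integrable in \<open>auto intro: integrable_mult_right\<close>)
  also have "\<dots> = (C * norm (cls h))\<^sup>2"
    using assms(2) by (simp add: norm_cls_square power_mult_distrib)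
  finally show ?thesis
    by (rule power2_le_imp_le) (use assms in simp)
qed

section \<open>The Fourier transform on square integrable functions\<close>

text \<open>The predicate behind the choice in \<open>fourier\<close>, with convergence expressed in
  the quotient. As a relation it holds for every representative of the transform and exposes the
  approximating sequence.\<close>

definition is_fourier :: "(real ^ 'd \<Rightarrow> complex) \<Rightarrow> (real ^ 'd \<Rightarrow> complex) \<Rightarrow> bool" where
  "is_fourier f F \<longleftrightarrow> f \<in> L2 \<and> F \<in> L2 \<and>
    (\<exists>h. (\<forall>k. integrable lebesgue (h k) \<and> h k \<in> L2) \<and>
      (\<lambda>k. cls (h k)) \<longlonglongrightarrow> cls f \<and> (\<lambda>k. cls (fourier_integral (h k))) \<longlonglongrightarrow> cls F)"

lemma L2_norm_tendsto_0_iff: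
  assumes "f \<in> L2" "\<And>k. h k \<in> L2"
  shows "(\<lambda>k. L2_norm (\<lambda>x. f x - h k x)) \<longlonglongrightarrow> 0 \<longleftrightarrow> (\<lambda>k. cls (h k)) \<longlonglongrightarrow> cls f"
proof -
  have eq: "L2_norm (\<lambda>x. f x - h k x) = ennreal (norm (cls (h k) - cls f))" for k
    using assms by (simp add: L2_norm_cls L2_diff cls_diff norm_minus_commute)
  have "(\<lambda>k. L2_norm (\<lambda>x. f x - h k x)) \<longlonglongrightarrow> 0 \<longleftrightarrow> (\<lambda>k. norm (cls (h k) - cls f)) \<longlonglongrightarrow> 0"
    unfolding eq ennreal_0[symmetric] by (rule tendsto_ennreal_iff) auto
  then show ?thesis
    by (simp add: tendsto_norm_zero_iff LIM_zero_iff)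
qed

lemma fourier_eq_SOME_is_fourier:
  assumes "f \<in> L2"
  shows "fourier f = (SOME F. is_fourier f F)"
  unfolding fourier_def
proof (rule arg_cong[where f = Eps], rule ext, rule iffI)
  fix F
  assume "F \<in> L2 \<and> (\<exists>h. (\<forall>k. integrable lebesgue (h k) \<and> h k \<in> L2) \<and>
    (\<lambda>k. L2_norm (\<lambda>x. f x - h k x)) \<longlonglongrightarrow> 0 \<and> (\<lambda>k. L2_norm (\<lambda>\<xi>. F \<xi> - fourier_integral (h k) \<xi>)) \<longlonglongrightarrow> 0)"
  then obtain h where F: "F \<in> L2" and h: "\<And>k. integrable lebesgue (h k)" "\<And>k. h k \<in> L2"
    and lim: "(\<lambda>k. L2_norm (\<lambda>x. f x - h k x)) \<longlonglongrightarrow> 0"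
      "(\<lambda>k. L2_norm (\<lambda>\<xi>. F \<xi> - fourier_integral (h k) \<xi>)) \<longlonglongrightarrow> 0" by auto
  have "(\<lambda>k. cls (h k)) \<longlonglongrightarrow> cls f" "(\<lambda>k. cls (fourier_integral (h k))) \<longlonglongrightarrow> cls F"
    using lim L2_norm_tendsto_0_iff[OF assms h(2)]
      L2_norm_tendsto_0_iff[where h = "\<lambda>k. fourier_integral (h k)", OF F L2_fourier_integral[OF h]] by simp_all
  then show "is_fourier f F"
    unfolding is_fourier_def using assms F h by auto
next
  fix F
  assume "is_fourier f F"
  then obtain h where F: "F \<in> L2" and h: "\<And>k. integrable lebesgue (h k)" "\<And>k. h k \<in> L2"
    and lim: "(\<lambda>k. cls (h k)) \<longlonglongrightarrow> cls f" "(\<lambda>k. cls (fourier_integral (h k))) \<longlonglongrightarrow> cls F"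
    unfolding is_fourier_def by auto
  have "(\<lambda>k. L2_norm (\<lambda>x. f x - h k x)) \<longlonglongrightarrow> 0"
      "(\<lambda>k. L2_norm (\<lambda>\<xi>. F \<xi> - fourier_integral (h k) \<xi>)) \<longlonglongrightarrow> 0"
    using lim L2_norm_tendsto_0_iff[OF assms h(2)]
      L2_norm_tendsto_0_iff[where h = "\<lambda>k. fourier_integral (h k)", OF F L2_fourier_integral[OF h]] by simp_all
  then show "F \<in> L2 \<and> (\<exists>h. (\<forall>k. integrable lebesgue (h k) \<and> h k \<in> L2) \<and>
    (\<lambda>k. L2_norm (\<lambda>x. f x - h k x)) \<longlonglongrightarrow> 0 \<and> (\<lambda>k. L2_norm (\<lambda>\<xi>. F \<xi> - fourier_integral (h k) \<xi>)) \<longlonglongrightarrow> 0)"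
    using F h by auto
qed

lemma integrable_mult_e1:
  assumes "integrable lebesgue f"
  shows "integrable lebesgue (\<lambda>x. f x * e1 (x \<bullet> \<xi>))"
proof (rule integrable_mult_bounded[OF assms, where C = 1])
  show "(\<lambda>x. e1 (x \<bullet> \<xi>)) \<in> borel_measurable lebesgue"
    by (intro measurable_completion) measurable
qed simp

lemma fourier_integral_diff:
  "integrable lebesgue f \<Longrightarrow> integrable lebesgue h \<Longrightarrow>
    fourier_integral (\<lambda>x. f x - h x) = (\<lambda>\<xi>. fourier_integral f \<xi> - fourier_integral h \<xi>)"
  unfolding fourier_integral_e1[abs_def]
  by (simp add: left_diff_distrib Bochner_Integration.integral_diff integrable_mult_e1)

lemma norm_fourier_integral_diff:
  assumes f: "integrable lebesgue f" "f \<in> L2" and h: "integrable lebesgue h" "h \<in> L2"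
  shows "norm (cls (fourier_integral f) - cls (fourier_integral h)) = norm (cls f - cls h)"
  using norm_fourier_integral[OF Bochner_Integration.integrable_diff[OF f(1) h(1)] L2_diff[OF f(2) h(2)]] f h
  by (simp add: fourier_integral_diff cls_diff L2_fourier_integral)

lemma L2_indicator_ball: "(indicator (ball 0 r) :: real ^ 'd \<Rightarrow> complex) \<in> L2"
proof (subst L2_nn_integral_iff)
  show "(indicator (ball 0 r) :: real ^ 'd \<Rightarrow> complex) \<in> borel_measurable lebesgue"
    by (intro borel_measurable_indicator) simp
  have "(\<integral>\<^sup>+x. ennreal ((cmod (indicator (ball (0 :: real ^ 'd) r) x))\<^sup>2) \<partial>lebesgue) = (\<integral>\<^sup>+x. indicator (ball (0 :: real ^ 'd) r) x \<partial>lebesgue)"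
    by (intro nn_integral_cong) (auto simp: indicator_def)
  also have "\<dots> = emeasure lebesgue (ball (0 :: real ^ 'd) r)"
    by (rule nn_integral_indicator) simp
  also have "\<dots> < \<infinity>"
    using emeasure_bounded_finite[of "ball (0 :: real ^ 'd) r"] by simp
  finally show "(\<integral>\<^sup>+x. ennreal ((cmod (indicator (ball (0 :: real ^ 'd) r) x))\<^sup>2) \<partial>lebesgue) < \<infinity>" .
qed

text \<open>Truncations to balls are integrable as products of two square integrable functions, and
  they converge by domination. The isometry makes their transforms a Cauchy sequence, so
  completeness provides the limit.\<close>

lemma is_fourier_exists:
  fixes f :: "real ^ 'd \<Rightarrow> complex"
  assumes f: "f \<in> L2"
  shows "\<exists>F. is_fourier f F"
proof -
  define h where "h k x = f x * indicator (ball 0 (real k)) x" for k :: nat and x :: "real ^ 'd"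
  have h_int: "integrable lebesgue (h k)" for k
    unfolding h_def by (rule L2_mult_integrable[OF f L2_indicator_ball])
  have h_meas: "h k \<in> borel_measurable lebesgue" for k
    using h_int by (rule borel_measurable_integrable)
  have le: "AE x in lebesgue. cmod (h k x) \<le> 1 * cmod (f x)" for k
    by (intro AE_I2) (simp add: h_def indicator_def)
  have lim: "AE x in lebesgue. (\<lambda>k. h k x) \<longlonglongrightarrow> f x"
  proof (rule AE_I2)
    fix x :: "real ^ 'd"
    obtain N where N: "norm x < real N" using reals_Archimedean2 by blast
    have "\<forall>\<^sub>F k in sequentially. h k x = f x"
      using eventually_ge_at_top[of N] by eventually_elim (use N in \<open>auto simp: h_def\<close>)
    then show "(\<lambda>k. h k x) \<longlonglongrightarrow> f x" by (rule tendsto_eventually)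
  qed
  note h_L2 = cls_tendsto_dominated(1)[OF f f h_meas le lim]
    and h_lim = cls_tendsto_dominated(2)[OF f f h_meas le lim]
  have "Cauchy (\<lambda>k. cls (fourier_integral (h k)))"
    using LIMSEQ_imp_Cauchy[OF h_lim]
    by (simp add: Cauchy_def dist_norm norm_fourier_integral_diff h_int h_L2)
  then obtain G where G: "(\<lambda>k. cls (fourier_integral (h k))) \<longlonglongrightarrow> G"
    using Cauchy_convergent convergent_def by blast
  then have "is_fourier f (rep_l2 G)"
    unfolding is_fourier_def using f h_int h_L2 h_lim by auto
  then show ?thesis by blast
qed

lemma is_fourier_fourier: "f \<in> L2 \<Longrightarrow> is_fourier f (fourier f)"
  using someI_ex[OF is_fourier_exists] by (simp add: fourier_eq_SOME_is_fourier)

text \<open>Distances agree for the approximants and pass to the limit. For equal inputs this is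
  independence of the approximating sequence; against \<open>is_fourier_0\<close> it is the
  isometry.\<close>

lemma is_fourier_norm_diff:
  assumes "is_fourier f F" "is_fourier g G"
  shows "norm (cls F - cls G) = norm (cls f - cls g)"
proof -
  obtain h where h: "\<And>k. integrable lebesgue (h k)" "\<And>k. h k \<in> L2"
      "(\<lambda>k. cls (h k)) \<longlonglongrightarrow> cls f" "(\<lambda>k. cls (fourier_integral (h k))) \<longlonglongrightarrow> cls F"
    using assms(1) unfolding is_fourier_def by auto
  obtain q where q: "\<And>k. integrable lebesgue (q k)" "\<And>k. q k \<in> L2"
      "(\<lambda>k. cls (q k)) \<longlonglongrightarrow> cls g" "(\<lambda>k. cls (fourier_integral (q k))) \<longlonglongrightarrow> cls G"
    using assms(2) unfolding is_fourier_def by auto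
  have "(\<lambda>k. norm (cls (fourier_integral (h k)) - cls (fourier_integral (q k)))) \<longlonglongrightarrow> norm (cls F - cls G)"
    using h q by (intro tendsto_intros)
  moreover have "(\<lambda>k. norm (cls (h k) - cls (q k))) \<longlonglongrightarrow> norm (cls f - cls g)"
    using h q by (intro tendsto_intros)
  ultimately show ?thesis
    using LIMSEQ_unique by (simp add: norm_fourier_integral_diff h q)
qed

lemma is_fourier_0: "is_fourier (\<lambda>x :: real ^ 'd. 0) (\<lambda>x. 0)"
proof -
  have "fourier_integral (\<lambda>x :: real ^ 'd. 0) = (\<lambda>\<xi>. 0)"
    by (simp add: fourier_integral_def[abs_def])
  then show ?thesis
    unfolding is_fourier_def by (intro conjI exI[of _ "\<lambda>k x. 0"]) auto
qed

lemma is_fourier_norm: "is_fourier f F \<Longrightarrow> norm (cls F) = norm (cls f)"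
  using is_fourier_norm_diff[OF _ is_fourier_0] by (simp add: cls_zero)

text \<open>An exact computation on the integrable approximants, carried over because translation
  and modulation are bounded. The positive sign in the exponent is that of the kernel.\<close>

lemma is_fourier_shift:
  assumes "is_fourier f F"
  shows "is_fourier (\<lambda>x. f (x - s)) (\<lambda>\<xi>. e1 (s \<bullet> \<xi>) * F \<xi>)"
proof -
  obtain h where h: "\<And>k. integrable lebesgue (h k)" "\<And>k. h k \<in> L2"
      "(\<lambda>k. cls (h k)) \<longlonglongrightarrow> cls f" "(\<lambda>k. cls (fourier_integral (h k))) \<longlonglongrightarrow> cls F"
    and L2: "f \<in> L2" "F \<in> L2"
    using assms unfolding is_fourier_def by auto
  have eq: "fourier_integral (\<lambda>x. h k (x - s)) = (\<lambda>\<xi>. e1 (s \<bullet> \<xi>) * fourier_integral (h k) \<xi>)" for k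
  proof
    fix \<xi>
    have m: "(\<lambda>x. e1 (s \<bullet> \<xi>) * (h k x * e1 (x \<bullet> \<xi>))) \<in> borel_measurable lebesgue"
      using borel_measurable_times[OF borel_measurable_const borel_measurable_integrable[OF integrable_mult_e1[OF h(1)]]] .
    have "h k (x - s) * e1 (x \<bullet> \<xi>) = e1 (s \<bullet> \<xi>) * (h k (x - s) * e1 ((x - s) \<bullet> \<xi>))" for x
      using e1_add[of "s \<bullet> \<xi>" "(x - s) \<bullet> \<xi>"] by (simp add: inner_diff_left)
    then have "fourier_integral (\<lambda>x. h k (x - s)) \<xi> = (LINT x|lebesgue. e1 (s \<bullet> \<xi>) * (h k (x - s) * e1 ((x - s) \<bullet> \<xi>)))"
      by (simp only: fourier_integral_e1)
    also have "\<dots> = (LINT x|lebesgue. e1 (s \<bullet> \<xi>) * (h k x * e1 (x \<bullet> \<xi>)))"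
      by (rule integral_lebesgue_shift[OF m])
    also have "\<dots> = e1 (s \<bullet> \<xi>) * fourier_integral (h k) \<xi>"
      by (simp only: fourier_integral_e1 integral_mult_right_zero)
    finally show "fourier_integral (\<lambda>x. h k (x - s)) \<xi> = e1 (s \<bullet> \<xi>) * fourier_integral (h k) \<xi>" .
  qed
  have "(\<lambda>k. shift s (cls (h k))) \<longlonglongrightarrow> shift s (cls f)"
    by (rule bounded_linear.tendsto[OF bounded_linear_shift h(3)])
  moreover have "(\<lambda>k. modulate s (cls (fourier_integral (h k)))) \<longlonglongrightarrow> modulate s (cls F)"
    by (rule bounded_linear.tendsto[OF bounded_linear_modulate h(4)])
  ultimately show ?thesis
    unfolding is_fourier_def using L2 h(1,2)
    by (intro conjI exI[of _ "\<lambda>k x. h k (x - s)"] allI)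
       (auto simp: L2_shift L2_modulate integrable_lebesgue_shift eq shift_cls modulate_cls L2_fourier_integral)
qed

lemma fourier_integral_multiplication_L2:
  fixes f g :: "real ^ 'd \<Rightarrow> complex"
  assumes f: "integrable lebesgue f" "f \<in> L2" and g: "integrable lebesgue g" "g \<in> L2"
  shows "cinner (cls (fourier_integral f)) (conjugate (cls g)) = cinner (cls f) (conjugate (cls (fourier_integral g)))"
proof -
  obtain f0 where f0: "f0 \<in> borel_measurable borel" "AE x in lebesgue. f x = f0 x"
    using lebesgue_measurable_borel_representative[OF L2_measurable[OF f(2)]] .
  obtain g0 where g0: "g0 \<in> borel_measurable borel" "AE x in lebesgue. g x = g0 x"
    using lebesgue_measurable_borel_representative[OF L2_measurable[OF g(2)]] .
  note B = fourier_integral_borel_representative[OF f f0] fourier_integral_borel_representative[OF g g0]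
  have m: "f0 \<in> borel_measurable lborel" "g0 \<in> borel_measurable lborel" using f0 g0 by simp_all
  have "(LINT \<xi>|lebesgue. fourier_integral f0 \<xi> * g0 \<xi>) = (LINT \<xi>|lborel. fourier_integral f0 \<xi> * g0 \<xi>)"
    using f0(1) g0(1) by (intro integral_completion) simp
  also have "\<dots> = (LINT x|lborel. f0 x * fourier_integral g0 x)"
    using f0(1) g0(1) B by (intro fourier_integral_multiplication) auto
  also have "\<dots> = (LINT x|lebesgue. f0 x * fourier_integral g0 x)"
    using f0(1) g0(1) by (intro integral_completion[symmetric]) simp
  finally show ?thesis
    using B L2_fourier_integral[OF f] L2_fourier_integral[OF g]
    by (simp add: conjugate_cls cinner_cls L2_cnj L2_inner_def)
qed

lemma is_fourier_duality:
  assumes "is_fourier f F" "is_fourier g G"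
  shows "cinner (cls F) (conjugate (cls g)) = cinner (cls f) (conjugate (cls G))"
proof -
  obtain h where h: "\<And>k. integrable lebesgue (h k)" "\<And>k. h k \<in> L2"
      "(\<lambda>k. cls (h k)) \<longlonglongrightarrow> cls f" "(\<lambda>k. cls (fourier_integral (h k))) \<longlonglongrightarrow> cls F"
    using assms(1) unfolding is_fourier_def by auto
  obtain q where q: "\<And>k. integrable lebesgue (q k)" "\<And>k. q k \<in> L2"
      "(\<lambda>k. cls (q k)) \<longlonglongrightarrow> cls g" "(\<lambda>k. cls (fourier_integral (q k))) \<longlonglongrightarrow> cls G"
    using assms(2) unfolding is_fourier_def by auto
  note conj = bounded_linear.tendsto[OF bounded_linear_conjugate]
  have "(\<lambda>k. cinner (cls (fourier_integral (h k))) (conjugate (cls (q k)))) \<longlonglongrightarrow> cinner (cls F) (conjugate (cls g))"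
    by (rule cinner.tendsto[OF h(4) conj[OF q(3)]])
  moreover have "(\<lambda>k. cinner (cls (h k)) (conjugate (cls (fourier_integral (q k))))) \<longlonglongrightarrow> cinner (cls f) (conjugate (cls G))"
    by (rule cinner.tendsto[OF h(3) conj[OF q(4)]])
  ultimately show ?thesis
    using LIMSEQ_unique by (simp add: fourier_integral_multiplication_L2 h q)
qed

text \<open>If \<open>U\<close> is the Fourier transform and \<open>U'\<close> its conjugate \<open>F \<mapsto> cnj (U (cnj F))\<close>, duality gives
  \<open>\<langle>U U' F, F\<rangle> = \<parallel>U' F\<parallel>\<^sup>2\<close>; as both maps are isometries, \<open>\<parallel>U U' F - F\<parallel> = 0\<close>.\<close>

lemma is_fourier_surj:
  assumes F: "F \<in> L2"
  obtains f where "is_fourier f F"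
proof -
  obtain K where K: "is_fourier (\<lambda>x. cnj (F x)) K"
    using is_fourier_exists[OF L2_cnj[OF F]] by blast
  then have KL2: "K \<in> L2" unfolding is_fourier_def by simp
  obtain G where G: "is_fourier (\<lambda>x. cnj (K x)) G"
    using is_fourier_exists[OF L2_cnj[OF KL2]] by blast
  have norm_K: "norm (cls K) = norm (cls F)"
    using is_fourier_norm[OF K] F by (simp flip: conjugate_cls)
  have norm_G: "norm (cls G) = norm (cls F)"
    using is_fourier_norm[OF G] KL2 norm_K by (simp flip: conjugate_cls)
  have "cinner (cls G) (cls F) = cinner (conjugate (cls K)) (conjugate (cls K))"
    using is_fourier_duality[OF G K] F KL2 by (simp flip: conjugate_cls)
  then have "inner (cls G) (cls F) = (norm (cls F))\<^sup>2"
    by (simp add: cinner_eq_norm norm_K inner_l2_def)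
  then have "(norm (cls G - cls F))\<^sup>2 = 0"
    using norm_G unfolding power2_norm_eq_inner inner_diff_left inner_diff_right
    by (simp add: inner_commute[of "cls F"] flip: power2_norm_eq_inner)
  then have "cls G = cls F" by simp
  then have "is_fourier (\<lambda>x. cnj (K x)) F"
    using G F unfolding is_fourier_def by simp
  then show ?thesis by (rule that)
qed

lemma inv_fourier:
  assumes F: "F \<in> L2"
  shows "inv_fourier F \<in> L2" and "AE \<xi> in lebesgue. fourier (inv_fourier F) \<xi> = F \<xi>"
proof -
  obtain f where f: "is_fourier f F" using is_fourier_surj[OF F] .
  then have fL2: "f \<in> L2" unfolding is_fourier_def by simp
  have f': "is_fourier f (fourier f)" using is_fourier_fourier[OF fL2] .
  have "cls (fourier f) = cls F"
    using is_fourier_norm_diff[OF f' f] by simp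
  then have "AE \<xi> in lebesgue. fourier f \<xi> = F \<xi>"
    using f' F unfolding is_fourier_def by (simp add: cls_eq_iff)
  then have "\<exists>f. f \<in> L2 \<and> (AE \<xi> in lebesgue. fourier f \<xi> = F \<xi>)" using fL2 by blast
  from someI_ex[OF this] show "inv_fourier F \<in> L2" "AE \<xi> in lebesgue. fourier (inv_fourier F) \<xi> = F \<xi>"
    unfolding inv_fourier_def by simp_all
qed

section \<open>Momentum norm and translations\<close>

text \<open>Surjectivity of the transform guarantees that the choice in \<open>inv_fourier\<close>
  has a candidate, and the isometry evaluates its norm.\<close>

lemma M_norm_eq:
  assumes "P_op w (fourier f) \<in> L2"
  shows "M_norm w f = L2_norm (P_op w (fourier f))"
proof -
  define F where "F = P_op w (fourier f)"
  have F: "F \<in> L2" using assms by (simp add: F_def)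
  note inv = inv_fourier[OF F]
  note is_f = is_fourier_fourier[OF inv(1)]
  have "norm (cls (inv_fourier F)) = norm (cls (fourier (inv_fourier F)))"
    using is_fourier_norm[OF is_f] by simp
  also have "cls (fourier (inv_fourier F)) = cls F"
    using is_f inv(2) F unfolding is_fourier_def by (simp add: cls_eq_iff)
  finally show ?thesis
    using F inv(1) by (simp add: M_norm_def M_op_def F_def[symmetric] L2_norm_cls)
qed

text \<open>On the Fourier side translation by \<open>t w\<close> is multiplication by
  \<open>e1 (t (w \<bullet> \<xi>))\<close>, which differs from 1 by at most
  \<open>2 pi |t| |w \<bullet> \<xi>|\<close>. A finite momentum norm is thus a Lipschitz condition
  on translations along \<open>w\<close>.\<close>

lemma norm_shift_diff_le:
  assumes f: "f \<in> L2" and P: "P_op w (fourier f) \<in> L2"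
  shows "norm (shift (t *\<^sub>R w) (cls f) - cls f) \<le> 2 * pi * \<bar>t\<bar> * norm (cls (P_op w (fourier f)))"
proof -
  define F where "F = fourier f"
  have is_F: "is_fourier f F" unfolding F_def by (rule is_fourier_fourier[OF f])
  then have F: "F \<in> L2" unfolding is_fourier_def by simp
  note mod = L2_modulate[OF F, of "t *\<^sub>R w"]
  have "norm (shift (t *\<^sub>R w) (cls f) - cls f) = norm (cls (\<lambda>x. f (x - t *\<^sub>R w)) - cls f)"
    using f by (simp add: shift_cls)
  also have "\<dots> = norm (cls (\<lambda>\<xi>. e1 ((t *\<^sub>R w) \<bullet> \<xi>) * F \<xi>) - cls F)"
    by (rule is_fourier_norm_diff[OF is_fourier_shift[OF is_F] is_F, symmetric])
  also have "\<dots> = norm (cls (\<lambda>\<xi>. e1 ((t *\<^sub>R w) \<bullet> \<xi>) * F \<xi> - F \<xi>))"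
    using mod F by (simp add: cls_diff)
  also have "\<dots> \<le> (2 * pi * \<bar>t\<bar>) * norm (cls (P_op w F))"
  proof (rule norm_cls_mono)
    show "AE \<xi> in lebesgue. cmod (e1 ((t *\<^sub>R w) \<bullet> \<xi>) * F \<xi> - F \<xi>) \<le> 2 * pi * \<bar>t\<bar> * cmod (P_op w F \<xi>)"
    proof (rule AE_I2)
      fix \<xi>
      have "cmod (e1 ((t *\<^sub>R w) \<bullet> \<xi>) * F \<xi> - F \<xi>) = cmod (e1 (t * (w \<bullet> \<xi>)) - 1) * cmod (F \<xi>)"
        by (simp add: left_diff_distrib flip: norm_mult)
      also have "\<dots> \<le> 2 * pi * \<bar>t * (w \<bullet> \<xi>)\<bar> * cmod (F \<xi>)"
        by (intro mult_right_mono cmod_e1_minus_1_le) simp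
      finally show "cmod (e1 ((t *\<^sub>R w) \<bullet> \<xi>) * F \<xi> - F \<xi>) \<le> 2 * pi * \<bar>t\<bar> * cmod (P_op w F \<xi>)"
        by (simp add: P_op_def norm_mult abs_mult mult.assoc)
    qed
  qed (use mod F P in \<open>auto simp: L2_diff F_def\<close>)
  finally show ?thesis unfolding F_def .
qed

subsection \<open>Gabor systems\<close>

lemma real_vec_add: "real_vec (m + n) = real_vec m + real_vec n"
  by (simp add: real_vec_def vec_eq_iff)

lemma real_vec_uminus: "real_vec (- m) = - real_vec m"
  by (simp add: real_vec_def vec_eq_iff)

lemma real_vec_0 [simp]: "real_vec 0 = 0"
  by (simp add: real_vec_def vec_eq_iff)

lemma e1_real_vec_inner [simp]:
  "e1 (real_vec m \<bullet> real_vec n) = 1" "e1 (- (real_vec m \<bullet> real_vec n)) = 1"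
proof -
  have "real_vec m \<bullet> real_vec n = of_int (\<Sum>i\<in>UNIV. m $ i * n $ i)"
    by (simp add: inner_vec_def real_vec_def)
  then show "e1 (real_vec m \<bullet> real_vec n) = 1" "e1 (- (real_vec m \<bullet> real_vec n)) = 1"
    by (simp_all only: of_int_minus[symmetric] e1_of_int)
qed

definition tf :: "(int ^ 'd) \<times> (int ^ 'd) \<Rightarrow> 'd::finite l2 \<Rightarrow> 'd l2" where
  "tf k F = modulate (real_vec (snd k)) (shift (real_vec (fst k)) F)"

lemma
  assumes "g \<in> L2"
  shows gabor_L2: "gabor g k \<in> L2" and cls_gabor: "cls (gabor g k) = tf k (cls g)"
proof -
  obtain m n where k: "k = (m, n)" by (cases k)
  have eq: "gabor g k = (\<lambda>x. e1 (real_vec n \<bullet> x) * g (x - real_vec m))"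
    by (simp add: gabor_def k e1_def fun_eq_iff)
  show "gabor g k \<in> L2" "cls (gabor g k) = tf k (cls g)"
    unfolding eq using assms by (simp_all add: L2_modulate L2_shift tf_def k shift_cls modulate_cls)
qed

lemma bounded_linear_tf: "bounded_linear (tf k)"
  unfolding tf_def[abs_def] by (rule bounded_linear_compose[OF bounded_linear_modulate bounded_linear_shift])

lemma tf_0 [simp]: "tf 0 F = F"
  by (simp add: tf_def)

lemma tf_add: "tf k (F + H) = tf k F + tf k H"
  by (simp add: tf_def shift_add modulate_add)

lemma tf_scaleC: "tf k (c *\<^sub>C F) = c *\<^sub>C tf k F"
  by (simp add: tf_def shift_scaleC modulate_scaleC)

text \<open>The Weyl phase is 1 at integer points, so \<open>tf\<close> is a genuine action of the
  additive group of index pairs. Reindexing of Gabor sums by group operations rests on this.\<close>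

lemma tf_tf: "tf j (tf k F) = tf (j + k) F"
  by (simp add: tf_def shift_modulate modulate_scaleC modulate_modulate shift_shift real_vec_add)

lemma cinner_tf_left: "cinner (tf k F) H = cinner F (tf (- k) H)"
  by (simp add: tf_def cinner_modulate_left cinner_shift_left shift_modulate real_vec_uminus)

lemma cinner_tf_right: "cinner F (tf k H) = cinner (tf (- k) F) H"
  by (simp add: cinner_tf_left)

text \<open>For a general vector \<open>a\<close> the phase survives; only the modulation part of
  \<open>tf k\<close> contributes to it.\<close>

lemma shift_tf: "shift a (tf k F) = e1 (- (real_vec (snd k) \<bullet> a)) *\<^sub>C tf k (shift a F)"
  by (simp add: tf_def shift_modulate shift_shift add.commute)

lemma is_P_tf:
  assumes "is_P v F P"
  shows "is_P v (tf k F) (tf k P + complex_of_real (v \<bullet> real_vec (fst k)) *\<^sub>C tf k F)"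
  using is_P_modulate[OF is_P_shift[OF assms]] by (simp add: tf_def modulate_add modulate_scaleC)

text \<open>Reindexing the series by \<open>k \<mapsto> j + k\<close>. Consequently the inverse
  frame operator commutes with \<open>tf j\<close>, and the dual frame is itself the Gabor system of
  \<open>D\<close>.\<close>

lemma frame_op_tf:
  assumes fr: "frame_bounds UNIV A B (\<lambda>k. tf k G)"
  shows "frame_op (\<lambda>k. tf k G) (tf j F) = tf j (frame_op (\<lambda>k. tf k G) F)"
proof (rule has_sum_unique)
  have "((\<lambda>k. cinner (tf j F) (tf (j + k) G) *\<^sub>C tf (j + k) G) has_sum frame_op (\<lambda>k. tf k G) (tf j F)) UNIV"
    using has_sum_reindex_bij_betw[OF bij_plus[of j], THEN iffD2, OF has_sum_frame_op[OF fr, of "tf j F"]] .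
  then show "((\<lambda>k. cinner F (tf k G) *\<^sub>C tf (j + k) G) has_sum frame_op (\<lambda>k. tf k G) (tf j F)) UNIV"
    by (simp add: cinner_tf_left tf_tf)
  show "((\<lambda>k. cinner F (tf k G) *\<^sub>C tf (j + k) G) has_sum tf j (frame_op (\<lambda>k. tf k G) F)) UNIV"
    using has_sum_bounded_linear[OF bounded_linear_tf[of j] has_sum_frame_op[OF fr, of F]]
    by (simp add: tf_scaleC tf_tf)
qed

section \<open>The commutator series and its limit\<close>

text \<open>Dominated convergence for sums: outside a finite set the tail of \<open>b\<close> is
  small uniformly in \<open>n\<close>, and on the finite set each \<open>\<phi> n k\<close> tends to
  0.\<close>

lemma infsum_dominated_tendsto_0:
  fixes b :: "'k \<Rightarrow> real" and \<phi> :: "nat \<Rightarrow> 'k \<Rightarrow> real"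
  assumes b: "b summable_on UNIV" "\<And>k. 0 \<le> b k"
    and \<phi>: "\<And>n k. 0 \<le> \<phi> n k" "\<And>n k. \<phi> n k \<le> C" "\<And>k. (\<lambda>n. \<phi> n k) \<longlonglongrightarrow> 0"
  shows "(\<lambda>k. \<phi> n k * b k) summable_on UNIV" and "(\<lambda>n. \<Sum>\<^sub>\<infinity>k. \<phi> n k * b k) \<longlonglongrightarrow> 0"
proof -
  have C: "0 \<le> C" using \<phi>(1,2) order_trans by blast
  show summ: "(\<lambda>k. \<phi> n k * b k) summable_on UNIV" for n
    by (rule summable_on_comparison_test[where f = "\<lambda>k. C * b k"])
       (auto intro: summable_on_cmult_right b mult_right_mono mult_nonneg_nonneg \<phi>)
  show "(\<lambda>n. \<Sum>\<^sub>\<infinity>k. \<phi> n k * b k) \<longlonglongrightarrow> 0"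
  proof (rule LIMSEQ_I)
    fix r :: real assume r: "0 < r"
    \<comment> \<open>The summand 1 keeps the denominator positive when \<open>C = 0\<close>;
      multiplied by \<open>C\<close> the threshold is at most \<open>r / 2\<close>.\<close>
    have pos: "0 < r / (2 * (C + 1))" using r C by simp
    obtain K0 where K0: "finite K0" "K0 \<subseteq> UNIV"
        "\<And>K. finite K \<Longrightarrow> K \<subseteq> UNIV \<Longrightarrow> K \<inter> K0 = {} \<Longrightarrow> sum b K < r / (2 * (C + 1))"
      by (rule summable_on_nonneg_small_tail[OF b pos]) (simp add: that)
    have "(\<lambda>n. \<Sum>k\<in>K0. \<phi> n k * b k) \<longlonglongrightarrow> (\<Sum>k\<in>K0. 0 * b k)"
      by (intro tendsto_sum tendsto_mult tendsto_const \<phi>(3))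
    then have "\<forall>\<^sub>F n in sequentially. (\<Sum>k\<in>K0. \<phi> n k * b k) < r / 2"
      by (rule order_tendstoD(2)) (use r in simp)
    then obtain N where N: "\<And>n. n \<ge> N \<Longrightarrow> (\<Sum>k\<in>K0. \<phi> n k * b k) < r / 2"
      unfolding eventually_sequentially by blast
    have "norm ((\<Sum>\<^sub>\<infinity>k. \<phi> n k * b k) - 0) < r" if n: "n \<ge> N" for n
    proof -
      have "(\<Sum>\<^sub>\<infinity>k. \<phi> n k * b k) \<le> (\<Sum>k\<in>K0. \<phi> n k * b k) + C * (r / (2 * (C + 1)))"
      proof (rule infsum_le_finite_sums[OF summ])
        fix K :: "'k set" assume K: "finite K"
        have "(\<Sum>k\<in>K. \<phi> n k * b k) = (\<Sum>k\<in>K \<inter> K0. \<phi> n k * b k) + (\<Sum>k\<in>K - K0. \<phi> n k * b k)"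
          using K by (rule sum.Int_Diff)
        also have "(\<Sum>k\<in>K \<inter> K0. \<phi> n k * b k) \<le> (\<Sum>k\<in>K0. \<phi> n k * b k)"
          using K0(1) \<phi>(1) b(2) by (intro sum_mono2) auto
        also have "(\<Sum>k\<in>K - K0. \<phi> n k * b k) \<le> (\<Sum>k\<in>K - K0. C * b k)"
          using \<phi>(2) b(2) by (intro sum_mono mult_right_mono) auto
        also have "\<dots> = C * sum b (K - K0)" by (simp add: sum_distrib_left)
        also have "\<dots> \<le> C * (r / (2 * (C + 1)))"
        proof (intro mult_left_mono C)
          show "sum b (K - K0) \<le> r / (2 * (C + 1))"
            by (rule less_imp_le, rule K0(3)) (use K in auto)
        qed
        finally show "(\<Sum>k\<in>K. \<phi> n k * b k) \<le> (\<Sum>k\<in>K0. \<phi> n k * b k) + C * (r / (2 * (C + 1)))" by simp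
      qed
      also have "\<dots> < r / 2 + r / 2"
        using N[OF n] C r by (intro add_less_le_mono) (auto simp: field_simps)
      finally have "(\<Sum>\<^sub>\<infinity>k. \<phi> n k * b k) < r" by simp
      moreover have "0 \<le> (\<Sum>\<^sub>\<infinity>k. \<phi> n k * b k)"
        using \<phi>(1) b(2) by (intro infsum_nonneg) simp
      ultimately show ?thesis by simp
    qed
    then show "\<exists>N. \<forall>n\<ge>N. norm ((\<Sum>\<^sub>\<infinity>k. \<phi> n k * b k) - 0) < r" by blast
  qed
qed

text \<open>The series is the difference of the expansions of \<open>\<langle>p, T\<^sub>s D - D\<rangle>\<close> (reindexed by \<open>k \<mapsto> - k\<close>) and of
  \<open>\<langle>y, q\<rangle>\<close>. The terms \<open>v \<cdot> m\<close> and \<open>exp (2 \<pi> i n \<cdot> s) - 1\<close> produced by commuting \<open>P\<^sub>v\<close> and \<open>T\<^sub>s\<close> past \<open>\<pi>\<^sub>k\<close>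
  are multiplied by \<open>\<langle>\<pi>\<^sub>k G, D\<rangle>\<close>, hence vanish by biorthogonality.\<close>

lemma position_translation_identity:
  fixes s :: "real ^ 'd" and G D :: "'d::finite l2"
  assumes fr: "frame_bounds UNIV A B (\<lambda>k. tf k G)"
    and D: "frame_op (\<lambda>k. tf k G) D = G"
    and bi: "\<And>k. cinner (tf k G) D = (if k = 0 then 1 else 0)"
    and p: "is_P v G p" and q: "is_P v D q"
  defines "y \<equiv> shift (- s) G - G"
  shows "((\<lambda>k. cinner y (tf k D) * ((e1 (- (real_vec (snd k) \<bullet> s)) - 1) * cinner (tf k G) q))
    has_sum complex_of_real (v \<bullet> s) * cinner G (shift s D)) UNIV"
proof -
  have SD: "frame_op (\<lambda>k. tf k G) (tf k D) = tf k G" for k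
    by (simp add: frame_op_tf[OF fr] D)
  have coeff_p: "cinner p (tf k D) = cinner (tf (- k) G) q" for k
  proof -
    have "cinner p (tf k D) = cinner G (tf k q + complex_of_real (v \<bullet> real_vec (fst k)) *\<^sub>C tf k D)"
      by (rule is_P_cinner[OF p is_P_tf[OF q]])
    also have "\<dots> = cinner G (tf k q) + complex_of_real (v \<bullet> real_vec (fst k)) * cinner (tf (- k) G) D"
      by (simp add: cinner_add_right cinner_scaleC_right cinner_tf_right)
    also have "complex_of_real (v \<bullet> real_vec (fst k)) * cinner (tf (- k) G) D = 0"
      by (auto simp: bi)
    finally show ?thesis by (simp add: cinner_tf_right)
  qed
  have coeff_D: "cinner (tf k G) (shift s D - D) = e1 (real_vec (snd k) \<bullet> s) * cinner y (tf (- k) D)" for k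
  proof -
    have "cinner (tf k G) (shift s D) = cinner (shift (- s) (tf k G)) D"
      by (simp add: cinner_shift_left)
    also have "\<dots> = e1 (real_vec (snd k) \<bullet> s) * cinner (tf k (y + G)) D"
      by (simp add: shift_tf cinner_scaleC_left y_def)
    also have "\<dots> = e1 (real_vec (snd k) \<bullet> s) * cinner y (tf (- k) D) + e1 (real_vec (snd k) \<bullet> s) * cinner (tf k G) D"
      by (simp only: tf_add cinner_add_left distrib_left cinner_tf_left[of k y])
    also have "e1 (real_vec (snd k) \<bullet> s) * cinner (tf k G) D = cinner (tf k G) D"
      by (auto simp: bi)
    finally show ?thesis by (simp add: cinner.diff_right)
  qed
  note expansion = dual_frame_expansion(1)[OF fr SD]
  have 1: "((\<lambda>k. cinner (tf (- k) G) q * (e1 (real_vec (snd k) \<bullet> s) * cinner y (tf (- k) D)))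
      has_sum cinner p (shift s D - D)) UNIV"
    using expansion[of p "shift s D - D"] by (simp only: coeff_p coeff_D)
  have "((\<lambda>k. cinner (tf k G) q * (e1 (- (real_vec (snd k) \<bullet> s)) * cinner y (tf k D)))
      has_sum cinner p (shift s D - D)) UNIV"
    using has_sum_reindex_bij_betw[OF bij_uminus, THEN iffD2, OF 1] by (simp add: real_vec_uminus)
  from has_sum_add[OF this has_sum_uminusI[OF expansion[of y q]]]
  have "((\<lambda>k. cinner y (tf k D) * ((e1 (- (real_vec (snd k) \<bullet> s)) - 1) * cinner (tf k G) q))
      has_sum cinner p (shift s D - D) - cinner y q) UNIV"
    by (simp add: algebra_simps)
  moreover have "cinner p (shift s D - D) - cinner y q = complex_of_real (v \<bullet> s) * cinner G (shift s D)"
    by (simp add: y_def cinner.diff_left cinner.diff_right is_P_cinner[OF p is_P_shift[OF q]]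
        is_P_cinner[OF p q] cinner_add_right cinner_scaleC_right cinner_shift_left)
  ultimately show ?thesis by simp
qed

text \<open>For \<open>s = t w\<close>, both sides of the squared estimate carry \<open>t^2\<close>:
  on the left from \<open>v \<bullet> s\<close>, on the right from the Lipschitz bound. After
  cancelling it, the right side still contains the phase-weighted sum, which tends to 0, while the
  left side tends to \<open>|v \<bullet> w|^2\<close> because \<open><G, D> = 1\<close>.\<close>

lemma orthogonal_if_localized:
  assumes fr: "frame_bounds UNIV A B (\<lambda>k. tf k G)"
    and D: "frame_op (\<lambda>k. tf k G) D = G"
    and bi: "\<And>k. cinner (tf k G) D = (if k = 0 then 1 else 0)"
    and p: "is_P v G p" and q: "is_P v D q"
    and lip: "\<And>t. norm (shift (t *\<^sub>R w) G - G) \<le> C * \<bar>t\<bar>"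
  shows "v \<bullet> w = 0"
proof -
  have A: "0 < A" using fr unfolding frame_bounds_def by blast
  define t :: "nat \<Rightarrow> real" where "t n = inverse (real (Suc n))" for n
  have t0: "t n > 0" and t: "t \<longlonglongrightarrow> 0" for n
    unfolding t_def[abs_def] by (simp, rule LIMSEQ_inverse_real_of_nat)
  have tw: "(\<lambda>n. t n *\<^sub>R w) \<longlonglongrightarrow> 0"
    using tendsto_scaleR[OF t tendsto_const[of w]] by simp
  define b where "b k = (cmod (cinner (tf k G) q))\<^sup>2" for k
  have b: "b summable_on UNIV" "0 \<le> b k" for k
  proof -
    have "b = (\<lambda>k. (cmod (cinner q (tf k G)))\<^sup>2)"
      unfolding b_def by (subst cinner_commute) simp
    then show "b summable_on UNIV" using fr unfolding frame_bounds_def by simp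
  qed (simp add: b_def)
  \<comment> \<open>The squared phase differences; being chords of the unit circle they are bounded
    by 4, and they tend to 0 for each fixed \<open>k\<close>.\<close>
  define \<phi> where "\<phi> n k = (cmod (e1 (- (real_vec (snd k) \<bullet> (t n *\<^sub>R w))) - 1))\<^sup>2" for n and k :: "(int ^ 'a) \<times> (int ^ 'a)"
  have \<phi>: "0 \<le> \<phi> n k" "\<phi> n k \<le> 4" "(\<lambda>n. \<phi> n k) \<longlonglongrightarrow> 0" for n k
  proof -
    have "cmod (e1 (- (real_vec (snd k) \<bullet> (t n *\<^sub>R w))) - 1) \<le> 2"
      using norm_triangle_ineq4[of "e1 (- (real_vec (snd k) \<bullet> (t n *\<^sub>R w)))" 1] by simp
    then show "\<phi> n k \<le> 4"
      unfolding \<phi>_def using power_mono[of _ 2 2] by fastforce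
    have "(\<lambda>n. e1 (- (real_vec (snd k) \<bullet> (t n *\<^sub>R w)))) \<longlonglongrightarrow> e1 (- (real_vec (snd k) \<bullet> 0))"
      by (rule isCont_tendsto_compose[OF isCont_e1]) (intro tendsto_intros tw)
    then have "(\<lambda>n. \<phi> n k) \<longlonglongrightarrow> (cmod (e1 (- (real_vec (snd k) \<bullet> 0)) - 1))\<^sup>2"
      unfolding \<phi>_def by (intro tendsto_intros)
    then show "(\<lambda>n. \<phi> n k) \<longlonglongrightarrow> 0" by simp
  qed (simp add: \<phi>_def)
  note dom = infsum_dominated_tendsto_0[OF b \<phi>]
  have SD: "frame_op (\<lambda>k. tf k G) (tf k D) = tf k G" for k
    by (simp add: frame_op_tf[OF fr] D)
  have bound: "(cmod (complex_of_real (v \<bullet> w) * cinner G (shift (t n *\<^sub>R w) D)))\<^sup>2 \<le> C\<^sup>2 / A * (\<Sum>\<^sub>\<infinity>k. \<phi> n k * b k)" for n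
  proof -
    define s where "s = t n *\<^sub>R w"
    define y where "y = shift (- s) G - G"
    have sq: "(cmod ((e1 (- (real_vec (snd k) \<bullet> s)) - 1) * cinner (tf k G) q))\<^sup>2 = \<phi> n k * b k" for k
      by (simp add: norm_mult power_mult_distrib \<phi>_def b_def s_def)
    have "(cmod (complex_of_real (v \<bullet> s) * cinner G (shift s D)))\<^sup>2
        \<le> (\<Sum>\<^sub>\<infinity>k. (cmod (cinner y (tf k D)))\<^sup>2) * (\<Sum>\<^sub>\<infinity>k. (cmod ((e1 (- (real_vec (snd k) \<bullet> s)) - 1) * cinner (tf k G) q))\<^sup>2)"
      using position_translation_identity[OF fr D bi p q, of s] dual_frame_expansion(2)[OF fr SD, of y] dom(1)
      unfolding y_def[symmetric] by (intro Cauchy_Schwarz_has_sum) (auto simp: sq)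
    also have "\<dots> = (\<Sum>\<^sub>\<infinity>k. (cmod (cinner y (tf k D)))\<^sup>2) * (\<Sum>\<^sub>\<infinity>k. \<phi> n k * b k)"
      by (simp only: sq)
    also have "\<dots> \<le> ((norm y)\<^sup>2 / A) * (\<Sum>\<^sub>\<infinity>k. \<phi> n k * b k)"
      using \<phi>(1) b(2) by (intro mult_right_mono dual_frame_expansion(3)[OF fr SD] infsum_nonneg) auto
    also have "\<dots> \<le> ((C * t n)\<^sup>2 / A) * (\<Sum>\<^sub>\<infinity>k. \<phi> n k * b k)"
    proof (intro mult_right_mono divide_right_mono power_mono)
      show "norm y \<le> C * t n"
        \<comment> \<open>The vector \<open>y\<close> involves the translation by
          \<open>- s\<close>, hence the Lipschitz bound at \<open>- t n\<close>.\<close>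
        using lip[of "- t n"] t0[of n] by (simp add: y_def s_def)
    qed (use A \<phi>(1) b(2) in \<open>auto intro: infsum_nonneg\<close>)
    finally have "(t n)\<^sup>2 * (cmod (complex_of_real (v \<bullet> w) * cinner G (shift s D)))\<^sup>2 \<le> (t n)\<^sup>2 * (C\<^sup>2 / A * (\<Sum>\<^sub>\<infinity>k. \<phi> n k * b k))"
      by (simp add: s_def norm_mult power_mult_distrib mult_ac)
    then show ?thesis
      unfolding s_def by (rule mult_left_le_imp_le) (use t0[of n] in simp)
  qed
  have "(\<lambda>n. (cmod (complex_of_real (v \<bullet> w) * cinner G (shift (t n *\<^sub>R w) D)))\<^sup>2) \<longlonglongrightarrow> (cmod (complex_of_real (v \<bullet> w) * cinner G D))\<^sup>2"
    by (intro tendsto_intros cinner.tendsto shift_tendsto tw)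
  moreover have "(\<lambda>n. C\<^sup>2 / A * (\<Sum>\<^sub>\<infinity>k. \<phi> n k * b k)) \<longlonglongrightarrow> C\<^sup>2 / A * 0"
    by (intro tendsto_mult tendsto_const dom(2))
  ultimately have "(cmod (complex_of_real (v \<bullet> w) * cinner G D))\<^sup>2 \<le> C\<^sup>2 / A * 0"
    by (rule LIMSEQ_le) (use bound in blast)
  moreover have "cinner G D = 1" using bi[of 0] by simp
  ultimately show ?thesis by simp
qed

section \<open>Transfer to the operators on functions\<close>

text \<open>Convergence in \<open>L2_norm\<close> along finite index sets is \<open>has_sum\<close>
  in the quotient. Existence of the sum makes the choice in \<open>frame_operator\<close>
  meaningful, and uniqueness of sums fixes the class of the chosen function.\<close>

lemma cls_frame_operator:
  fixes \<phi> :: "'k \<Rightarrow> real ^ 'd \<Rightarrow> complex"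
  assumes g: "\<And>k. \<phi> k \<in> L2" and fr: "frame_bounds UNIV A B (\<lambda>k. cls (\<phi> k))" and h: "h \<in> L2"
  shows "frame_operator UNIV \<phi> h \<in> L2"
    and "cls (frame_operator UNIV \<phi> h) = frame_op (\<lambda>k. cls (\<phi> k)) (cls h)"
proof -
  have iff: "((\<lambda>K. L2_norm (\<lambda>x. u x - (\<Sum>k\<in>K. L2_inner h (\<phi> k) * \<phi> k x))) \<longlongrightarrow> 0) (finite_subsets_at_top UNIV)
      \<longleftrightarrow> ((\<lambda>k. cinner (cls h) (cls (\<phi> k)) *\<^sub>C cls (\<phi> k)) has_sum cls u) UNIV" if u: "u \<in> L2" for u
  proof -
    define T where "T K = (\<Sum>k\<in>K. cinner (cls h) (cls (\<phi> k)) *\<^sub>C cls (\<phi> k))" for K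
    have "\<forall>\<^sub>F K in finite_subsets_at_top UNIV.
        L2_norm (\<lambda>x. u x - (\<Sum>k\<in>K. L2_inner h (\<phi> k) * \<phi> k x)) = ennreal (norm (T K - cls u))"
    proof (rule eventually_finite_subsets_at_top_weakI)
      fix K :: "'k set" assume K: "finite K"
      have S: "(\<lambda>x. \<Sum>k\<in>K. L2_inner h (\<phi> k) * \<phi> k x) \<in> L2"
        using K g by (intro L2_sum L2_cmult)
      have "cls (\<lambda>x. \<Sum>k\<in>K. L2_inner h (\<phi> k) * \<phi> k x) = T K"
        unfolding T_def using K g h by (subst cls_sum) (auto simp: L2_cmult cls_scaleC cinner_cls)
      then show "L2_norm (\<lambda>x. u x - (\<Sum>k\<in>K. L2_inner h (\<phi> k) * \<phi> k x)) = ennreal (norm (T K - cls u))"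
        using u S by (simp add: L2_norm_cls L2_diff cls_diff norm_minus_commute)
    qed
    then have "((\<lambda>K. L2_norm (\<lambda>x. u x - (\<Sum>k\<in>K. L2_inner h (\<phi> k) * \<phi> k x))) \<longlongrightarrow> 0) (finite_subsets_at_top UNIV)
        \<longleftrightarrow> ((\<lambda>K. ennreal (norm (T K - cls u))) \<longlongrightarrow> ennreal 0) (finite_subsets_at_top UNIV)"
      by (simp add: tendsto_cong)
    also have "\<dots> \<longleftrightarrow> ((\<lambda>K. norm (T K - cls u)) \<longlongrightarrow> 0) (finite_subsets_at_top UNIV)"
      by (rule tendsto_ennreal_iff) auto
    also have "\<dots> \<longleftrightarrow> (T \<longlongrightarrow> cls u) (finite_subsets_at_top UNIV)"
      by (simp add: tendsto_norm_zero_iff LIM_zero_iff)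
    finally show ?thesis unfolding has_sum_def T_def[abs_def] .
  qed
  define Q where "Q u \<longleftrightarrow> u \<in> L2 \<and>
    ((\<lambda>K. L2_norm (\<lambda>x. u x - (\<Sum>k\<in>K. L2_inner h (\<phi> k) * \<phi> k x))) \<longlongrightarrow> 0) (finite_subsets_at_top UNIV)" for u
  have "Q (rep_l2 (frame_op (\<lambda>k. cls (\<phi> k)) (cls h)))"
    unfolding Q_def using iff[of "rep_l2 (frame_op (\<lambda>k. cls (\<phi> k)) (cls h))"] has_sum_frame_op[OF fr] by simp
  then have "Q (frame_operator UNIV \<phi> h)"
    unfolding frame_operator_def Q_def[symmetric] by (rule someI[of Q])
  then show "frame_operator UNIV \<phi> h \<in> L2"
      "cls (frame_operator UNIV \<phi> h) = frame_op (\<lambda>k. cls (\<phi> k)) (cls h)"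
    using iff[of "frame_operator UNIV \<phi> h"] has_sum_unique[OF _ has_sum_frame_op[OF fr]] unfolding Q_def by auto
qed

text \<open>Surjectivity of the frame operator supplies a candidate for the choice; whichever
  representative is picked solves the equation on classes.\<close>

lemma cls_canonical_dual:
  assumes g: "g \<in> L2" and fr: "frame_bounds UNIV A B (\<lambda>k. tf k (cls g))"
  shows "canonical_dual g \<in> L2" and "frame_op (\<lambda>k. tf k (cls g)) (cls (canonical_dual g)) = cls g"
proof -
  have fr': "frame_bounds UNIV A B (\<lambda>k. cls (gabor g k))"
    using fr by (simp add: cls_gabor[OF g])
  have iff: "(AE x in lebesgue. frame_operator UNIV (gabor g) h x = g x) \<longleftrightarrow> frame_op (\<lambda>k. tf k (cls g)) (cls h) = cls g"
    if h: "h \<in> L2" for h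
    using cls_frame_operator[OF gabor_L2[OF g] fr' h] g by (simp add: cls_gabor[OF g] flip: cls_eq_iff)
  obtain D where D: "frame_op (\<lambda>k. tf k (cls g)) D = cls g"
    using frame_op_surj[OF fr] .
  have "\<exists>h. h \<in> L2 \<and> (AE x in lebesgue. frame_operator UNIV (gabor g) h x = g x)"
    using D iff[of "rep_l2 D"] by (intro exI[of _ "rep_l2 D"]) simp
  from someI_ex[OF this]
  show "canonical_dual g \<in> L2" "frame_op (\<lambda>k. tf k (cls g)) (cls (canonical_dual g)) = cls g"
    unfolding canonical_dual_def[symmetric] using iff by auto
qed

lemma AE_linear_form_nonzero:
  fixes v :: "'a::euclidean_space"
  assumes "v \<noteq> 0"
  shows "AE x in lebesgue. v \<bullet> x \<noteq> 0"
proof (rule AE_I')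
  show "{x. v \<bullet> x = 0} \<in> null_sets lebesgue"
    using negligible_hyperplane[of v 0] assms by (simp add: negligible_iff_null_sets)
qed auto

text \<open>The linear form vanishes only on a hyperplane, which is a null set, so multiplication by
  it is injective on classes.\<close>

lemma L2_norm_P_op_nonzero:
  assumes f: "f \<in> L2" "cls f \<noteq> 0" and v: "v \<noteq> 0"
  shows "L2_norm (P_op v f) \<noteq> 0"
proof
  assume 0: "L2_norm (P_op v f) = 0"
  then have P: "P_op v f \<in> L2" by (auto simp: L2_norm_def split: if_splits)
  with 0 have "cls (P_op v f) = cls (\<lambda>x. 0)" by (simp add: L2_norm_cls cls_zero)
  then have "AE x in lebesgue. P_op v f x = 0" using P by (simp add: cls_eq_iff)
  with AE_linear_form_nonzero[OF v] have "AE x in lebesgue. f x = 0"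
    by eventually_elim (simp add: P_op_def)
  then have "cls f = cls (\<lambda>x. 0)" using f(1) by (simp add: cls_eq_iff)
  with f(2) show False by (simp add: cls_zero)
qed

lemma M_norm_nonzero:
  assumes f: "f \<in> L2" "cls f \<noteq> 0" and w: "w \<noteq> 0"
  shows "M_norm w f \<noteq> 0"
proof (cases "P_op w (fourier f) \<in> L2")
  case True
  note is_F = is_fourier_fourier[OF f(1)]
  have "fourier f \<in> L2" using is_F unfolding is_fourier_def by simp
  moreover have "cls (fourier f) \<noteq> 0"
    using is_fourier_norm[OF is_F] f(2) by (metis norm_eq_zero)
  ultimately show ?thesis
    unfolding M_norm_eq[OF True] by (rule L2_norm_P_op_nonzero[OF _ _ w])
qed (simp add: M_norm_def)

theorem theorem2p1:
  fixes g :: "real ^ 'd \<Rightarrow> complex" and v w :: "real ^ 'd"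
  assumes "g \<in> L2"
    and "is_exact_frame UNIV (gabor g)"
    and "v \<bullet> w \<noteq> 0"
  shows "L2_norm (P_op v g) * M_norm w g *
         L2_norm (P_op v (canonical_dual g)) * M_norm w (canonical_dual g) = \<infinity>"
proof -
  define G where "G = cls g"
  define h where "h = canonical_dual g"
  note frame_iff = is_frame_iff_frame_bounds[of _ "gabor g", OF gabor_L2[OF assms(1)], unfolded cls_gabor[OF assms(1)]]
  obtain A B where fr: "frame_bounds UNIV A B (\<lambda>k. tf k G)"
    using assms(2) unfolding is_exact_frame_def frame_iff G_def by blast
  \<comment> \<open>Index 0 is the one whose frame element is \<open>G\<close> itself, and the
    canonical dual is its preimage under the frame operator.\<close>
  have ex: "\<not> (\<exists>A B. frame_bounds (UNIV - {0}) A B (\<lambda>k. tf k G))"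
    using assms(2) unfolding is_exact_frame_def frame_iff G_def by blast
  have h: "h \<in> L2" and D: "frame_op (\<lambda>k. tf k G) (cls h) = G"
    using cls_canonical_dual[OF assms(1) fr[unfolded G_def]] unfolding G_def h_def by auto
  have bi: "cinner (tf k G) (cls h) = (if k = 0 then 1 else 0)" for k
    using exact_frame_biorthogonal[OF fr ex, of "cls h"] D by simp
  \<comment> \<open>The biorthogonality relation at index 0 says \<open><G, D> = 1\<close>.\<close>
  have nonzero: "G \<noteq> 0" "cls h \<noteq> 0"
    using bi[of 0] by (auto simp: cinner.zero_left cinner.zero_right)
  have vw: "v \<noteq> 0" "w \<noteq> 0" using assms(3) by auto
  have "\<not> (P_op v g \<in> L2 \<and> P_op v h \<in> L2 \<and> P_op w (fourier g) \<in> L2)"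
  proof
    assume *: "P_op v g \<in> L2 \<and> P_op v h \<in> L2 \<and> P_op w (fourier g) \<in> L2"
    define C where "C = 2 * pi * norm (cls (P_op w (fourier g)))"
    have "norm (shift (t *\<^sub>R w) G - G) \<le> C * \<bar>t\<bar>" for t
      using norm_shift_diff_le[OF assms(1), of w t] * by (simp add: C_def G_def mult_ac)
    then have "v \<bullet> w = 0"
      using * is_P_cls[OF assms(1), of v] is_P_cls[OF h, of v]
      by (intro orthogonal_if_localized[OF fr D bi, of v "cls (P_op v g)" "cls (P_op v h)" w C]) (auto simp: G_def)
    with assms(3) show False ..
  qed
  then have "L2_norm (P_op v g) = \<infinity> \<or> L2_norm (P_op v h) = \<infinity> \<or> M_norm w g = \<infinity>"
    by (auto simp: L2_norm_def M_norm_def)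
  \<comment> \<open>In \<open>ennreal\<close> the product of \<infinity> and 0 is 0, so an infinite
    factor settles the product only once no factor vanishes.\<close>
  moreover have "L2_norm (P_op v g) \<noteq> 0" "M_norm w g \<noteq> 0" "L2_norm (P_op v h) \<noteq> 0" "M_norm w h \<noteq> 0"
    using nonzero vw assms(1) h by (auto simp: G_def L2_norm_P_op_nonzero M_norm_nonzero)
  ultimately show ?thesis
    unfolding h_def[symmetric] by (auto simp: ennreal_mult_eq_top_iff)
qed

end
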